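(* Let $k,n$ be positive integers such that $2 \leq k \leq \lfloor n/2 \rfloor$. The distinguishing chromatic number of the circulant graph $C_n(1,k)$ is given by \[ \chi_D(C_n(1,k)) = \begin{cases} n & \text{if } (n,k) \in \{(4,2),(5,2),(6,2),(6,3),(8,3)\};\\ 5 & \text{if } (n,k) = (10,3);\\ 4 & \text{if } (n,k) \in \{(15,4),(13,5)\};\\ 3 & \text{if } k = n/2 \text{ and } n \geq 8;\\ 5 & \text{if } k = n/2-1 \text{ and } n \geq 10;\\ 4 & \text{if } k=2 \text{ or } k=(n-1)/2, \text{ and } n \geq 7;\\ 3 & \text{otherwise.} \end{cases} \]
   Context: For positive integers $n,k$ with $1\le k\le \lfloor n/2\rfloor$, the circulant graph $C_n(1,k)$ is the simple undirected graph with vertices $v_0,\dots,v_{n-1}$ (indices modulo $n$), where two distinct vertices $v_i,v_j$ are adjacent if and only if $i-j \equiv \pm 1$ or $i-j\equiv \pm k \pmod n$. The distinguishing chromatic number $\chi_D(G)$ of a graph $G$ is the minimum number of colors in a proper vertex coloring of $G$ such that the only automorphism of $G$ preserving the color of every vertex is the identity. *)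

theory Defs
  imports Complex_Main "HOL-Number_Theory.Cong" "Graph_Theory.Pair_Digraph"
begin

text \<open>
  Finite simple undirected graphs are pair digraphs satisfying \<^locale>\<open>pair_graph\<close> (finite,
  loop-free, symmetric); an undirected edge is represented by its two opposite arcs.
\<close>

definition circulant :: "nat \<Rightarrow> nat \<Rightarrow> nat pair_pre_digraph" where
  "circulant n k = \<lparr> pverts = {..<n},
     parcs = {(i, j). i < n \<and> j < n \<and> i \<noteq> j \<and>
       ([int i - int j = 1] (mod int n) \<or> [int i - int j = - 1] (mod int n) \<or>
        [int i - int j = int k] (mod int n) \<or> [int i - int j = - int k] (mod int n))} \<rparr>"

definition automorphism :: "'a pair_pre_digraph \<Rightarrow> ('a \<Rightarrow> 'a) \<Rightarrow> bool" where
  "automorphism G f \<longleftrightarrow> bij_betw f (pverts G) (pverts G) \<and>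
     (\<forall>u\<in>pverts G. \<forall>v\<in>pverts G. (f u, f v) \<in> parcs G \<longleftrightarrow> (u, v) \<in> parcs G)"

definition proper_colouring :: "'a pair_pre_digraph \<Rightarrow> ('a \<Rightarrow> 'c) \<Rightarrow> bool" where
  "proper_colouring G c \<longleftrightarrow> (\<forall>(u, v)\<in>parcs G. c u \<noteq> c v)"

text \<open>Values of maps outside the vertex set are irrelevant, so being the identity means fixing
  every vertex.\<close>

definition distinguishing :: "'a pair_pre_digraph \<Rightarrow> ('a \<Rightarrow> 'c) \<Rightarrow> bool" where
  "distinguishing G c \<longleftrightarrow>
     (\<forall>f. automorphism G f \<and> (\<forall>v\<in>pverts G. c (f v) = c v) \<longrightarrow> (\<forall>v\<in>pverts G. f v = v))"

text \<open>Meant for finite graphs, where natural numbers suffice as colours and the minimum is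
  attained.\<close>

definition distinguishing_chromatic_number :: "'a pair_pre_digraph \<Rightarrow> nat" where
  "distinguishing_chromatic_number G =
     (LEAST m. \<exists>c :: 'a \<Rightarrow> nat. proper_colouring G c \<and> distinguishing G c \<and> card (c ` pverts G) = m)"

lemma pair_graph_circulant: "pair_graph (circulant n k)"
proof
  have "parcs (circulant n k) \<subseteq> {..<n} \<times> {..<n}"
    by (auto simp: circulant_def)
  then show "finite (parcs (circulant n k))"
    by (rule finite_subset) auto
  have flip: "[int j - int i = a] (mod int n)" if "[int i - int j = - a] (mod int n)" for i j a
    using that cong_minus_minus_iff[of "int i - int j" "- a" "int n"] by simp
  have "(j, i) \<in> parcs (circulant n k)" if "(i, j) \<in> parcs (circulant n k)" for i j
    using that flip[of i j 1] flip[of i j "- 1"] flip[of i j "int k"] flip[of i j "- int k"]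
    by (auto simp: circulant_def)
  then show "symmetric (with_proj (circulant n k))"
    by (auto simp: symmetric_def intro: symI)
qed (auto simp: circulant_def)

lemma distinguishing_chromatic_number_attained:
  assumes "pair_graph G"
  shows "\<exists>c :: 'a \<Rightarrow> nat. proper_colouring G c \<and> distinguishing G c \<and>
           card (c ` pverts G) = distinguishing_chromatic_number (G :: 'a pair_pre_digraph)"
proof -
  interpret pair_graph G by fact
  obtain c :: "'a \<Rightarrow> nat" where inj: "inj_on c (pverts G)"
    using finite_imp_inj_to_nat_seg[OF pair_finite_verts] by auto
  have "proper_colouring G c"
    unfolding proper_colouring_def using inj pair_no_loops
    by (fastforce dest: inj_onD in_arcsD1 in_arcsD2)
  moreover have "distinguishing G c"
    unfolding distinguishing_def automorphism_def using inj
    by (auto dest: inj_onD bij_betwE)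
  ultimately have "\<exists>m. \<exists>c :: 'a \<Rightarrow> nat. proper_colouring G c \<and> distinguishing G c \<and>
      card (c ` pverts G) = m"
    by blast
  then show ?thesis
    unfolding distinguishing_chromatic_number_def by (rule LeastI_ex)
qed

end

theory Submission
  imports Defs
begin

text \<open>
  Three colours are necessary because a proper 2-colouring alternates along the cycle, so that the
  rotation by 2 preserves it. For the upper bound, counting common neighbours shows that, outside
  the exceptional families, every automorphism of \<open>C\<^sub>n(1,k)\<close> is affine,
  \<open>x \<mapsto> u x + b\<close> with \<open>u\<close> one of \<open>\<plusminus>1, \<plusminus>k\<close>. If \<open>t\<close> and \<open>t k mod n\<close> both lie strictly between
  \<open>n/3\<close> and \<open>2n/3\<close>, then cutting \<open>\<int>/n\<close> into three arcs and colouring \<open>x\<close> by the arc of \<open>t x\<close> is a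
  proper 3-colouring with slack. An affine map preserving the arcs is trivial modulo \<open>n / gcd t n\<close>,
  since a reflection would reverse their cyclic order, and the slack allows one or two vertices to be
  recoloured so that the remaining symmetries are destroyed too. A suitable \<open>t\<close> is found close to
  \<open>n/2\<close>, except for \<open>n = 3k\<close> and bipartite graphs, which have explicit colourings.
\<close>

section \<open>Residue-class formulation\<close>

text \<open>The obstacle is a multiplier \<open>u = k\<close> or \<open>u = - k\<close> with
  \<open>k^2\<close> congruent to 1 or -1 modulo \<open>n\<close>: it is a symmetry of the graph,
  and if \<open>d = gcd t n\<close> exceeds 1 it may fix every value \<open>t x mod n\<close>, so
  that no colouring by arcs detects it. This is why a second vertex is recoloured, at the price of
  the slack \<open>n + 2 d \<le> 3 t\<close>, and why \<open>t\<close> has the form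
  \<open>(n - j) / 2\<close> with small \<open>j\<close>: then \<open>d\<close> divides
  \<open>j\<close>. For \<open>n = 3 k\<close> arcs cannot work, since \<open>t k\<close> is a
  multiple of \<open>n / 3\<close>. Values other than 3 have several sources: five graphs are
  complete multipartite; \<open>C_10(1,3)\<close> and the graphs with \<open>k = n/2 - 1\<close>
  allow vertices or pairs of vertices to be exchanged locally; for \<open>k = 2\<close>, and for
  \<open>k = (n - 1)/2\<close>, which gives an isomorphic graph, triangles force every 3-colouring
  to be periodic; \<open>C_13(1,5)\<close> has no 3-colouring at all, and every 3-colouring of
  \<open>C_15(1,4)\<close> has a symmetry.\<close>

text \<open>All integers serve as vertices, identified modulo \<open>n\<close>.\<close>

definition cadj :: "int \<Rightarrow> int \<Rightarrow> int \<Rightarrow> int \<Rightarrow> bool" where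
  "cadj n k x y \<longleftrightarrow> n dvd x - y - 1 \<or> n dvd x - y + 1 \<or> n dvd x - y - k \<or> n dvd x - y + k"

text \<open>\<open>F\<close> need not be periodic. Read from right to left, the first equivalence
  makes \<open>F\<close> well defined on residue classes; from left to right it makes it injective
  there.\<close>

definition caut :: "int \<Rightarrow> int \<Rightarrow> (int \<Rightarrow> int) \<Rightarrow> bool" where
  "caut n k F \<longleftrightarrow> (\<forall>x y. n dvd F x - F y \<longleftrightarrow> n dvd x - y) \<and> (\<forall>z. \<exists>x. n dvd F x - z) \<and>
     (\<forall>x y. cadj n k (F x) (F y) \<longleftrightarrow> cadj n k x y)"

definition ccolouring :: "int \<Rightarrow> int \<Rightarrow> (int \<Rightarrow> nat) \<Rightarrow> bool" where
  "ccolouring n k C \<longleftrightarrow> (\<forall>x y. n dvd x - y \<longrightarrow> C x = C y) \<and>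
     (\<forall>x. C x \<noteq> C (x + 1) \<and> C x \<noteq> C (x + k))"

definition cdist :: "int \<Rightarrow> int \<Rightarrow> (int \<Rightarrow> nat) \<Rightarrow> bool" where
  "cdist n k C \<longleftrightarrow> (\<forall>F. caut n k F \<longrightarrow> (\<forall>x. C (F x) = C x) \<longrightarrow> (\<forall>x. n dvd F x - x))"

lemma ccolouring_cong: "ccolouring n k C \<Longrightarrow> n dvd x - y \<Longrightarrow> C x = C y"
  by (auto simp: ccolouring_def)

lemma ccolouring_cadj: "ccolouring n k C \<Longrightarrow> cadj n k x y \<Longrightarrow> C x \<noteq> C y"
proof -
  assume C: "ccolouring n k C" and "cadj n k x y"
  then consider "n dvd x - (y + 1)" | "n dvd (x + 1) - y" | "n dvd x - (y + k)" | "n dvd (x + k) - y"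
    by (auto simp: cadj_def algebra_simps)
  then show ?thesis
    using C by cases (metis ccolouring_def)+
qed

lemma mod_dvd_diff: "(n::int) dvd x mod n - x" "n dvd x - x mod n"
  by (metis dvd_minus_mod dvd_diff_commute, simp add: dvd_minus_mod)

lemma cadj_cong:
  assumes "n dvd x - x'" "n dvd y - y'"
  shows "cadj n k x y \<longleftrightarrow> cadj n k x' y'"
proof -
  have d: "n dvd x - y - (x' - y')"
    using dvd_diff[OF assms] by (simp add: algebra_simps)
  have "n dvd x - y - a \<longleftrightarrow> n dvd x' - y' - a" for a
  proof
    assume "n dvd x - y - a"
    from dvd_diff[OF this d] show "n dvd x' - y' - a" by (simp only: diff_diff_eq2 diff_right_commute) (simp add: algebra_simps)
  next
    assume "n dvd x' - y' - a"
    from dvd_add[OF this d] show "n dvd x - y - a" by (simp add: algebra_simps)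
  qed
  from this[of 1] this[of "-1"] this[of k] this[of "-k"] show ?thesis
    by (auto simp: cadj_def)
qed

lemma parcs_circulant:
  assumes "i < n" "j < n"
  shows "(i, j) \<in> parcs (circulant n k) \<longleftrightarrow> i \<noteq> j \<and> cadj (int n) (int k) (int i) (int j)"
  using assms by (auto simp: circulant_def cadj_def cong_iff_dvd_diff)

lemma pverts_circulant [simp]: "pverts (circulant n k) = {..<n}"
  by (simp add: circulant_def)

lemma dvd_diff_nat_eq: "i < n \<Longrightarrow> j < n \<Longrightarrow> int n dvd int i - int j \<longleftrightarrow> i = j"
  by (metis cong_iff_dvd_diff cong_int_iff cong_less_modulus_unique_nat cong_refl)

text \<open>This is what allows \<open>cadj\<close> to omit the condition that the two ends
  differ.\<close>

lemma cadj_irrefl: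
  assumes "2 \<le> n" "\<not> n dvd k"
  shows "\<not> cadj (int n) (int k) x x"
  using assms by (auto simp: cadj_def)

text \<open>An automorphism of the finite graph becomes a map on all integers by reducing its
  argument modulo \<open>n\<close>, so that \<open>cdist\<close> applies to it. Not every colour
  below \<open>m\<close> has to occur.\<close>

lemma dcn_le:
  fixes n k m :: nat
  assumes "2 \<le> n" "\<not> n dvd k" and C: "ccolouring (int n) (int k) C"
    and dist: "cdist (int n) (int k) C" and less: "\<And>x. C x < m"
  shows "distinguishing_chromatic_number (circulant n k) \<le> m"
proof -
  let ?G = "circulant n k" and ?c = "\<lambda>i. C (int i)"
  have "proper_colouring ?G ?c"
    unfolding proper_colouring_def
  proof clarify
    fix i j assume ij: "(i, j) \<in> parcs ?G" "C (int i) = C (int j)"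
    then have "i < n" "j < n" by (auto simp: circulant_def)
    with ij ccolouring_cadj[OF C] show False by (auto simp: parcs_circulant)
  qed
  moreover have "distinguishing ?G ?c"
    unfolding distinguishing_def
  proof (intro allI impI ballI, elim conjE)
    fix f v assume f: "automorphism ?G f" and cf: "\<forall>v\<in>pverts ?G. ?c (f v) = ?c v" and v: "v \<in> pverts ?G"
    define F where "F x = int (f (nat (x mod int n)))" for x
    define r where "r x = nat (x mod int n)" for x
    have r: "r x < n" "int n dvd int (r x) - x" "int n dvd x - int (r x)" for x
      using assms(1) by (auto simp: r_def mod_dvd_diff nat_less_iff)
    have F: "F x = int (f (r x))" for x by (simp add: F_def r_def)
    have bij: "bij_betw f {..<n} {..<n}" using f by (simp add: automorphism_def)
    then have fl: "f i < n" if "i < n" for i using that by (auto dest: bij_betwE)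
    have adj: "(f i, f j) \<in> parcs ?G \<longleftrightarrow> (i, j) \<in> parcs ?G" if "i < n" "j < n" for i j
      using f that by (auto simp: automorphism_def)
    have reqv: "r x = r y \<longleftrightarrow> int n dvd x - y" for x y
      using assms(1) by (simp add: r_def mod_eq_dvd_iff[symmetric] nat_eq_iff)
    have finj: "f i = f j \<longleftrightarrow> i = j" if "i < n" "j < n" for i j
      using bij that by (auto simp: bij_betw_def dest: inj_onD)
    have 1: "int n dvd F x - F y \<longleftrightarrow> int n dvd x - y" for x y
      using fl[OF r(1)] r(1) finj reqv unfolding F by (simp add: dvd_diff_nat_eq)
    have 2: "\<exists>x. int n dvd F x - z" for z
    proof -
      have "r z \<in> f ` {..<n}" using bij r(1) by (simp add: bij_betw_def)
      then obtain i where i: "i < n" "f i = r z" by auto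
      then have "F (int i) = int (r z)" by (simp add: F_def)
      then show ?thesis using r(2) by metis
    qed
    have 3: "cadj (int n) (int k) (F x) (F y) \<longleftrightarrow> cadj (int n) (int k) x y" for x y
    proof -
      have "cadj (int n) (int k) (F x) (F y) \<longleftrightarrow> (f (r x), f (r y)) \<in> parcs ?G"
        unfolding F using fl r(1) cadj_irrefl[OF assms(1,2)] by (auto simp: parcs_circulant)
      also have "\<dots> \<longleftrightarrow> (r x, r y) \<in> parcs ?G" using adj r(1) by blast
      also have "\<dots> \<longleftrightarrow> cadj (int n) (int k) (r x) (r y)"
        using r(1) cadj_irrefl[OF assms(1,2)] by (auto simp: parcs_circulant)
      also have "\<dots> \<longleftrightarrow> cadj (int n) (int k) x y"
        using cadj_cong[OF r(2) r(2)] .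
      finally show ?thesis .
    qed
    have 4: "C (F x) = C x" for x
      using cf r(1) ccolouring_cong[OF C r(2)] unfolding F by simp
    from 1 2 3 have "caut (int n) (int k) F" unfolding caut_def by blast
    with 4 dist have "int n dvd F (int v) - int v" unfolding cdist_def by blast
    with v fl show "f v = v" by (simp add: F_def dvd_diff_nat_eq)
  qed
  moreover have "card (?c ` pverts ?G) \<le> card {..<m}"
    using less by (intro card_mono) auto
  ultimately show ?thesis
    unfolding distinguishing_chromatic_number_def
    by (intro order_trans[OF Least_le]) auto
qed

lemma dcn_gt:
  fixes n k m :: nat
  assumes "2 \<le> n" "\<not> n dvd k"
    and no: "\<And>C. ccolouring (int n) (int k) C \<Longrightarrow> cdist (int n) (int k) C \<Longrightarrow> (\<And>x. C x < m) \<Longrightarrow> False"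
  shows "m < distinguishing_chromatic_number (circulant n k)"
proof (rule ccontr)
  let ?G = "circulant n k"
  assume "\<not> ?thesis"
  with distinguishing_chromatic_number_attained[OF pair_graph_circulant[of n k]]
  obtain c :: "nat \<Rightarrow> nat" where c: "proper_colouring ?G c" "distinguishing ?G c"
    "card (c ` {..<n}) \<le> m" by auto
  \<comment> \<open>The attained colouring may use arbitrary numbers; \<open>h\<close> renames its
    at most \<open>m\<close> colours into numbers below \<open>m\<close>.\<close>
  then obtain h :: "nat \<Rightarrow> nat" where h: "inj_on h (c ` {..<n})" "h ` c ` {..<n} \<subseteq> {..<m}"
    by (metis card_le_inj card_lessThan finite_imageI finite_lessThan)
  define r where "r x = nat (x mod int n)" for x
  have r: "r x < n" "int n dvd int (r x) - x" "int n dvd x - int (r x)" for x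
    using assms(1) by (auto simp: r_def mod_dvd_diff nat_less_iff)
  have reqv: "r x = r y \<longleftrightarrow> int n dvd x - y" for x y
    using assms(1) by (simp add: r_def mod_eq_dvd_iff[symmetric] nat_eq_iff)
  have ri: "r (int i) = i" if "i < n" for i using that by (simp add: r_def)
  define C where "C x = h (c (r x))" for x
  have hc: "C x = C y \<longleftrightarrow> c (r x) = c (r y)" for x y
    using h(1) r(1) by (auto simp: C_def dest: inj_onD)
  have adj: "(r x, r y) \<in> parcs ?G \<longleftrightarrow> cadj (int n) (int k) x y" for x y
    using r(1) cadj_irrefl[OF assms(1,2)] cadj_cong[OF r(2) r(2)]
    by (metis parcs_circulant)
  have pc: "C x \<noteq> C y" if "cadj (int n) (int k) x y" for x y
    using that adj c(1) unfolding hc proper_colouring_def by blast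
  have "ccolouring (int n) (int k) C"
    unfolding ccolouring_def
  proof (intro conjI allI impI)
    fix x y assume "int n dvd x - y"
    then have "r x = r y" using reqv by blast
    then show "C x = C y" by (simp add: C_def)
  next
    fix x show "C x \<noteq> C (x + 1)" "C x \<noteq> C (x + int k)"
      using pc[of x "x+1"] pc[of x "x + int k"] by (auto simp: cadj_def)
  qed
  moreover have "cdist (int n) (int k) C"
    unfolding cdist_def
  proof (intro allI impI)
    fix F x assume F: "caut (int n) (int k) F" and CF: "\<forall>x. C (F x) = C x"
    define f where "f i = r (F (int i))" for i
    have rF: "r (F x) = r (F y) \<longleftrightarrow> r x = r y" for x y
      using F unfolding reqv caut_def by blast
    have inj: "inj_on f {..<n}"
    proof (rule inj_onI)
      fix i j assume "i \<in> {..<n}" "j \<in> {..<n}" "f i = f j"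
      then show "i = j" using rF[of "int i" "int j"] by (simp add: f_def ri)
    qed
    moreover have sub: "f ` {..<n} \<subseteq> {..<n}" using r(1) by (auto simp: f_def)
    ultimately have "bij_betw f {..<n} {..<n}"
      by (simp add: bij_betw_def endo_inj_surj)
    moreover have "(f i, f j) \<in> parcs ?G \<longleftrightarrow> (i, j) \<in> parcs ?G" if "i < n" "j < n" for i j
    proof -
      have "(f i, f j) \<in> parcs ?G \<longleftrightarrow> cadj (int n) (int k) (int i) (int j)"
        unfolding f_def adj using F unfolding caut_def by blast
      then show ?thesis using adj[of "int i" "int j"] that by (simp add: ri)
    qed
    ultimately have "automorphism ?G f" by (auto simp: automorphism_def)
    moreover have "c (f v) = c v" if "v < n" for v
    proof -
      have "C (F (int v)) = C (int v)" using CF by blast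
      then show ?thesis using that unfolding hc by (simp add: f_def ri)
    qed
    ultimately have "f v = v" if "v < n" for v
      using c(2) that unfolding distinguishing_def by auto
    from this[OF r(1)[of x]] have "r (F (int (r x))) = r x" by (simp add: f_def)
    moreover have "r (F (int (r x))) = r (F x)" using rF ri r(1) by blast
    ultimately show "int n dvd F x - x" using reqv by metis
  qed
  moreover have "C x < m" for x using h(2) r(1) by (auto simp: C_def)
  ultimately show False using no by blast
qed

section \<open>Automorphisms are affine\<close>

lemma dvd_small: "\<bar>a\<bar> < n \<Longrightarrow> n dvd a \<Longrightarrow> a = 0" for a n :: int
  using dvd_imp_le_int[of a n] by fastforce

lemma dvd_diff_trans: "(n::int) dvd x - y \<Longrightarrow> n dvd y - z \<Longrightarrow> n dvd x - z"
  using dvd_add[of n "x - y" "y - z"] by simp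

lemma dvd_diff_sym: "(n::int) dvd x - y \<longleftrightarrow> n dvd y - x"
  by (rule dvd_diff_commute)

lemma cadjE:
  assumes "cadj n k x y"
  obtains a where "a \<in> {1, -1, k, -k}" "n dvd x - y - a"
  using assms unfolding cadj_def by fastforce

lemma cadj_offset: "a \<in> {1, -1, k, -k} \<Longrightarrow> n dvd x - y - a \<Longrightarrow> cadj n k x y"
  unfolding cadj_def by auto

lemma caut_inj: "caut n k F \<Longrightarrow> n dvd F x - F y \<longleftrightarrow> n dvd x - y"
  by (simp add: caut_def)

lemma caut_cadj: "caut n k F \<Longrightarrow> cadj n k (F x) (F y) \<longleftrightarrow> cadj n k x y"
  by (simp add: caut_def)

lemma caut_surj: "caut n k F \<Longrightarrow> \<exists>x. n dvd F x - z"
  by (simp add: caut_def)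

lemma caut_step:
  assumes "caut n k F"
  obtains a where "a \<in> {1, -1, k, -k}" "n dvd F (x + 1) - F x - a"
  using cadjE[of n k "F (x + 1)" "F x"] caut_cadj[OF assms, of "x + 1" x]
  by (auto simp: cadj_def)

lemma affine_of_const_step:
  fixes F :: "int \<Rightarrow> int"
  assumes "\<And>x. n dvd F (x + 1) - F x - u"
  shows "n dvd F x - F 0 - u * x"
proof (induction x rule: int_induct[where k = 0])
  case (step1 i)
  then show ?case using dvd_add[OF assms[of i] step1(2)] by (simp add: algebra_simps)
next
  case (step2 i)
  then show ?case using dvd_diff[OF step2(2) assms[of "i - 1"]] by (simp add: algebra_simps)
qed simp

text \<open>The neighbour \<open>k\<close> of 0 goes to a neighbour of \<open>F 0\<close>, so
  \<open>u * k\<close> is congruent to one of the four offsets. If \<open>u\<close> is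
  \<open>k\<close> or \<open>- k\<close>, the offsets \<open>k\<close> and \<open>- k\<close> would
  make \<open>u\<close> annihilate \<open>k - 1\<close> or \<open>k + 1\<close>, against
  injectivity; the offsets 1 and -1 remain.\<close>

lemma affine_unit:
  assumes F: "caut n k F" and aff: "\<And>x. n dvd F x - F 0 - u * x"
    and u: "u \<in> {1, -1, k, -k}" and k: "\<not> n dvd k - 1" "\<not> n dvd k + 1"
  shows "u = 1 \<or> u = -1 \<or> (u = k \<or> u = -k) \<and> (n dvd k^2 - 1 \<or> n dvd k^2 + 1)"
proof -
  have inj: "n dvd x" if "n dvd u * x" for x
  proof -
    have "n dvd F x - F 0" using dvd_add[OF aff[of x] that] by simp
    then show ?thesis using caut_inj[OF F, of x 0] by simp
  qed
  have "n dvd k^2 - 1 \<or> n dvd k^2 + 1" if uk: "u = k \<or> u = -k"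
  proof -
    have "cadj n k (F k) (F 0)" using caut_cadj[OF F, of k 0] by (simp add: cadj_def)
    then obtain a where a: "a \<in> {1, -1, k, -k}" "n dvd F k - F 0 - a" by (rule cadjE)
    from dvd_diff[OF a(2) aff[of k]] have d: "n dvd u * k - a" by simp
    have "\<not> n dvd u * (k - 1)" "\<not> n dvd u * (k + 1)" using inj k by blast+
    with uk a(1) d show ?thesis
      by (auto simp: algebra_simps power2_eq_square)
        (metis dvd_minus_iff minus_add_distrib minus_diff_eq uminus_add_conv_diff diff_minus_eq_add add.commute)+
  qed
  with u show ?thesis by auto
qed

text \<open>For \<open>k \<ge> 4\<close> the number 2 is a difference of two offsets only as 1 -
  (-1), so \<open>x\<close> is the only common neighbour of \<open>x - 1\<close> and
  \<open>x + 1\<close>. If \<open>F\<close> leads from \<open>x\<close> to these two by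
  \<open>a\<close> and \<open>b\<close>, then \<open>F x + a + b\<close> is a common neighbour of
  their images, hence equals \<open>F x\<close>. So all steps of \<open>F\<close> agree.\<close>

lemma affine_generic:
  fixes n k :: int
  assumes F: "caut n k F" and k: "4 \<le> k" and n: "2 * k + 3 \<le> n \<or> n = 2 * k"
  obtains u where "u = 1 \<or> u = -1 \<or> (u = k \<or> u = -k) \<and> (n dvd k^2 - 1 \<or> n dvd k^2 + 1)"
    "\<And>x. n dvd F x - F 0 - u * x"
proof -
  have unique: "n dvd z - x" if z: "cadj n k z (x - 1)" "cadj n k z (x + 1)" for z x
  proof -
    from z(1) obtain a where a: "a \<in> {1, -1, k, -k}" "n dvd z - (x - 1) - a" by (rule cadjE)
    from z(2) obtain b where b: "b \<in> {1, -1, k, -k}" "n dvd z - (x + 1) - b" by (rule cadjE)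
    \<comment> \<open>For \<open>n = 2 * k\<close> the offsets \<open>k\<close> and
      \<open>- k\<close> coincide modulo \<open>n\<close>; representing both by \<open>k\<close>
      keeps \<open>a' - b' - 2\<close> smaller than \<open>n\<close> in absolute value.\<close>
    have norm: "\<exists>a'. a' \<in> {1, -1, k, -k} \<and> n dvd y - a' \<and> (n = 2 * k \<longrightarrow> a' \<noteq> - k)"
      if "a \<in> {1, -1, k, -k}" "n dvd y - a" for a y
    proof (cases "n = 2 * k \<and> a = - k")
      case True
      then have "y - k = (y - a) - n" by simp
      then have "n dvd y - k" using that(2) by (simp only: dvd_diff dvd_refl)
      then show ?thesis using True k by (intro exI[of _ k]) auto
    qed (use that in auto)
    from norm[OF a] norm[OF b] obtain a' b' where
      a': "a' \<in> {1, -1, k, -k}" "n dvd z - (x - 1) - a'" "n = 2 * k \<longrightarrow> a' \<noteq> - k" and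
      b': "b' \<in> {1, -1, k, -k}" "n dvd z - (x + 1) - b'" "n = 2 * k \<longrightarrow> b' \<noteq> - k"
      by blast
    have "n dvd (z - (x + 1) - b') - (z - (x - 1) - a')" by (rule dvd_diff[OF b'(2) a'(2)])
    then have "n dvd a' - b' - 2" by (simp add: algebra_simps)
    moreover have "\<bar>a' - b' - 2\<bar> < n"
      using n
    proof
      assume "2 * k + 3 \<le> n"
      with a'(1) b'(1) k show ?thesis by auto
    next
      assume "n = 2 * k"
      with a' b' k show ?thesis by auto
    qed
    ultimately have "a' - b' - 2 = 0" by (rule dvd_small[rotated])
    then have "a' = 1" using a'(1) b'(1) k by auto
    with a'(2) show ?thesis by simp
  qed
  have straight: "n dvd a + b"
    if a: "a \<in> {1, -1, k, -k}" "n dvd F (x + 1) - F x - a"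
    and b: "b \<in> {1, -1, k, -k}" "n dvd F (x - 1) - F x - b" for a b x
  proof -
    obtain w where w: "n dvd F w - (F x + a + b)" using caut_surj[OF F] by blast
    have "cadj n k (F w) (F (x + 1))"
      using dvd_diff[OF w a(2)] b(1) by (intro cadj_offset[of b]) (auto simp: algebra_simps)
    moreover have "cadj n k (F w) (F (x - 1))"
      using dvd_diff[OF w b(2)] a(1) by (intro cadj_offset[of a]) (auto simp: algebra_simps)
    ultimately have "n dvd w - x" using unique caut_cadj[OF F] by blast
    then have "n dvd F w - F x" using caut_inj[OF F] by blast
    from dvd_diff[OF this w] show ?thesis by (simp add: algebra_simps)
  qed
  obtain u where u: "u \<in> {1, -1, k, -k}" "n dvd F (0 + 1) - F 0 - u" by (rule caut_step[OF F])
  have step: "n dvd F (x + 1) - F x - (F x - F (x - 1))" for x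
  proof -
    obtain a where a: "a \<in> {1, -1, k, -k}" "n dvd F (x + 1) - F x - a" by (rule caut_step[OF F])
    obtain b where b: "b \<in> {1, -1, k, -k}" "n dvd F (x - 1 + 1) - F (x - 1) - b" by (rule caut_step[OF F])
    have "n dvd F (x - 1) - F x - (- b)"
      using b(2) dvd_minus_iff[of n "F x - F (x - 1) - b"] by (simp add: algebra_simps)
    with straight[OF a, of "-b"] b(1) have "n dvd a - b" by auto
    from dvd_add[OF this dvd_diff[OF a(2) b(2)]] show ?thesis by (simp add: algebra_simps)
  qed
  have const: "n dvd F (x + 1) - F x - u" for x
  proof (induction x rule: int_induct[where k = 0])
    case base then show ?case using u by simp
  next
    case (step1 i)
    then show ?case using dvd_add[OF step[of "i + 1"] step1(2)] by (simp add: algebra_simps)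
  next
    case (step2 i)
    then show ?case using dvd_diff[OF step2(2) step[of i]] by (simp add: algebra_simps)
  qed
  have aff: "n dvd F x - F 0 - u * x" for x by (rule affine_of_const_step) (rule const)
  have "\<not> n dvd k - 1" "\<not> n dvd k + 1"
    using dvd_small[of "k - 1" n] dvd_small[of "k + 1" n] n k by auto
  from that[OF affine_unit[OF F aff u(1) this] aff] show ?thesis .
qed

text \<open>For \<open>n \<ge> 7\<close> an edge \<open>{x, x + 1}\<close> lies in two triangles, an
  edge \<open>{x, x + 2}\<close> in only one. Hence unit steps go to unit steps, and two successive
  ones cannot cancel.\<close>

lemma affine_2:
  fixes n :: int
  assumes F: "caut n 2 F" and n: "7 \<le> n"
  obtains u where "u = 1 \<or> u = -1" "\<And>x. n dvd F x - F 0 - u * x"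
proof -
  have one: "\<exists>a. (a = 1 \<or> a = -1) \<and> n dvd F (x + 1) - F x - a" for x
  proof -
    obtain a where a: "a \<in> {1, -1, 2, -2}" "n dvd F (x + 1) - F x - a" by (rule caut_step[OF F])
    have "a \<noteq> 2 * e" if e: "e = 1 \<or> e = -1" for e
    proof
      assume ae: "a = 2 * e"
      have mid: "n dvd F z - F x - e" if "cadj n 2 z x" "cadj n 2 z (x + 1)" for z
      proof -
        from that caut_cadj[OF F] have "cadj n 2 (F z) (F x)" "cadj n 2 (F z) (F (x + 1))" by auto
        then obtain b c where b: "b \<in> {1, -1, 2, -2}" "n dvd F z - F x - b"
          and c: "c \<in> {1, -1, 2, -2}" "n dvd F z - F (x + 1) - c" by (metis cadjE)
        from dvd_diff[OF dvd_diff[OF b(2) c(2)] a(2)] have "n dvd c - b + 2 * e"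
          by (simp add: ae algebra_simps)
        then have "c - b + 2 * e = 0" using e b(1) c(1) n by (intro dvd_small) auto
        then have "b = e" using e b(1) c(1) by auto
        with b show ?thesis by simp
      qed
      have "n dvd F (x + 2) - F x - e" "n dvd F (x - 1) - F x - e"
        by (rule mid; simp add: cadj_def)+
      from dvd_diff[OF this] have "n dvd F (x + 2) - F (x - 1)" by simp
      then have "n dvd 3" using caut_inj[OF F, of "x+2" "x-1"] by simp
      then show False using dvd_small[of 3 n] n by auto
    qed
    from this[of 1] this[of "-1"] a show ?thesis by auto
  qed
  obtain e where e: "\<And>x. e x = 1 \<or> e x = -1" "\<And>x. n dvd F (x + 1) - F x - e x"
    using one by metis
  have eq: "e (x + 1) = e x" for x
  proof (rule ccontr)
    assume "e (x + 1) \<noteq> e x"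
    then have "e (x + 1) = - e x" using e(1)[of x] e(1)[of "x+1"] by auto
    with dvd_add[OF e(2)[of x] e(2)[of "x + 1"]] have "n dvd F (x + 2) - F x" by (simp add: algebra_simps)
    then have "n dvd 2" using caut_inj[OF F, of "x+2" x] by simp
    then show False using dvd_small[of 2 n] n by auto
  qed
  have "e x = e 0" for x
  proof (induction x rule: int_induct[where k = 0])
    case (step2 i) then show ?case using eq[of "i - 1"] by simp
  qed (use eq in auto)
  then show ?thesis using that[of "e 0"] e affine_of_const_step[of n F "e 0"] by metis
qed

text \<open>Used in \<open>affine_3\<close> to turn congruences between sums of offsets, which are
  odd, into equations. The only exception left is \<open>n = 12\<close>, where 6 and -6 are
  identified.\<close>

lemma even_dvd_small:
  fixes n e :: int
  assumes "9 \<le> n" "n \<noteq> 10" "even e" "\<bar>e\<bar> \<le> 12" "n dvd e"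
  shows "e = 0 \<or> n = 12 \<and> \<bar>e\<bar> = 12"
proof -
  obtain q where q: "e = n * q" using assms(5) by auto
  have "\<bar>q\<bar> < 2"
  proof (rule ccontr)
    assume "\<not> \<bar>q\<bar> < 2"
    then have "9 * 2 \<le> n * \<bar>q\<bar>" using assms(1) by (intro mult_mono) auto
    then show False using q assms(1,4) by (simp add: abs_mult)
  qed
  then have "q = 0 \<or> q = 1 \<or> q = -1" by auto
  moreover have "n \<noteq> 9" "n \<noteq> 11" if "q \<noteq> 0"
    using q assms(3) calculation that by auto
  ultimately show ?thesis using q assms by auto
qed

text \<open>Vertices at distance 2 on the cycle are exactly those with at least three common
  neighbours.\<close>

lemma affine_3:
  fixes n :: int
  assumes F: "caut n 3 F" and n: "9 \<le> n" "n \<noteq> 10"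
  obtains u where "u = 1 \<or> u = -1" "\<And>x. n dvd F x - F 0 - u * x"
proof -
  define S :: "int set" where "S = {1, -1, 3, -3}"
  have S: "\<exists>a\<in>S. n dvd F x - F y - a" if "cadj n 3 x y" for x y
    using that caut_cadj[OF F] by (metis S_def cadjE)
  have oddS: "odd a" "\<bar>a\<bar> \<le> 3" if "a \<in> S" for a using that by (auto simp: S_def)
  have two: "\<exists>e. (e = 1 \<or> e = -1) \<and> n dvd F (x + 2) - F x - 2 * e" for x
  proof -
    have nbr: "\<exists>a\<in>S. \<exists>b\<in>S. n dvd F z - F x - a \<and> n dvd F (x + 2) - F z - b"
      if "cadj n 3 z x" "cadj n 3 (x + 2) z" for z using that S by blast
    have "\<exists>a1\<in>S. \<exists>b1\<in>S. n dvd F (x + 1) - F x - a1 \<and> n dvd F (x + 2) - F (x + 1) - b1"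
      "\<exists>a2\<in>S. \<exists>b2\<in>S. n dvd F (x + 3) - F x - a2 \<and> n dvd F (x + 2) - F (x + 3) - b2"
      "\<exists>a3\<in>S. \<exists>b3\<in>S. n dvd F (x - 1) - F x - a3 \<and> n dvd F (x + 2) - F (x - 1) - b3"
      by (rule nbr; simp add: cadj_def)+
    then obtain a1 b1 a2 b2 a3 b3 where
      ab: "a1 \<in> S" "b1 \<in> S" "n dvd F (x + 1) - F x - a1" "n dvd F (x + 2) - F (x + 1) - b1"
       "a2 \<in> S" "b2 \<in> S" "n dvd F (x + 3) - F x - a2" "n dvd F (x + 2) - F (x + 3) - b2"
       "a3 \<in> S" "b3 \<in> S" "n dvd F (x - 1) - F x - a3" "n dvd F (x + 2) - F (x - 1) - b3"
      by blast
    define D where "D = a1 + b1"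
    have D: "n dvd F (x + 2) - F x - D"
      using dvd_add[OF ab(3,4)] by (simp add: D_def algebra_simps)
    have D2: "n dvd D - a2 - b2" using dvd_diff[OF dvd_add[OF ab(7,8)] D] by (simp add: algebra_simps)
    have D3: "n dvd D - a3 - b3" using dvd_diff[OF dvd_add[OF ab(11,12)] D] by (simp add: algebra_simps)
    have evD: "even D" "\<bar>D\<bar> \<le> 6"
      using oddS[OF ab(1)] oddS[OF ab(2)] by (auto simp: D_def)
    have E2: "D - a2 - b2 = 0 \<or> n = 12 \<and> \<bar>D - a2 - b2\<bar> = 12"
      using oddS[OF ab(5)] oddS[OF ab(6)] evD by (intro even_dvd_small n D2) auto
    have E3: "D - a3 - b3 = 0 \<or> n = 12 \<and> \<bar>D - a3 - b3\<bar> = 12"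
      using oddS[OF ab(9)] oddS[OF ab(10)] evD by (intro even_dvd_small n D3) auto
    have ne: "\<not> n dvd c" if "0 < \<bar>c\<bar>" "\<bar>c\<bar> < 9" for c
      using dvd_small[of c n] that n by auto
    have ne12: "a1 \<noteq> a2" using dvd_diff[OF ab(3) ab(7)] caut_inj[OF F, of "x+1" "x+3"] ne[of "-2"] by auto
    have ne13: "a1 \<noteq> a3" using dvd_diff[OF ab(3) ab(11)] caut_inj[OF F, of "x+1" "x-1"] ne[of 2] by auto
    have ne23: "a2 \<noteq> a3" using dvd_diff[OF ab(7) ab(11)] caut_inj[OF F, of "x+3" "x-1"] ne[of 4] by auto
    have D0: "D \<noteq> 0" using D caut_inj[OF F, of "x+2" x] ne[of 2] by auto
    have mem: "s = 1 \<or> s = -1 \<or> s = 3 \<or> s = -3" if "s \<in> S" for s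
      using that by (auto simp: S_def)
    have c2: "a2 + b2 = D \<or> D = 6 \<and> a2 = -3 \<or> D = -6 \<and> a2 = 3"
      using E2 evD(2) oddS(2)[OF ab(5)] oddS(2)[OF ab(6)] by linarith
    have c3: "a3 + b3 = D \<or> D = 6 \<and> a3 = -3 \<or> D = -6 \<and> a3 = 3"
      using E3 evD(2) oddS(2)[OF ab(9)] oddS(2)[OF ab(10)] by linarith
    \<comment> \<open>A sum \<open>D\<close> of absolute value 4 or 6 admits at most two first
      summands, too few for the three distinct common neighbours \<open>x + 1\<close>,
      \<open>x + 3\<close>, \<open>x - 1\<close>. The alternatives mixing 6 and -6 belong to
      \<open>n = 12\<close>.\<close>
    have ext: "(D = 6 \<longrightarrow> a = 3 \<or> a = -3) \<and> (D = 4 \<longrightarrow> a = 1 \<or> a = 3) \<and>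
        (D = -6 \<longrightarrow> a = 3 \<or> a = -3) \<and> (D = -4 \<longrightarrow> a = -1 \<or> a = -3)"
      if "a \<in> S" "b \<in> S" "a + b = D \<or> D = 6 \<and> a = -3 \<or> D = -6 \<and> a = 3" for a b
      using mem[OF that(1)] mem[OF that(2)] that(3) by (elim disjE) simp_all
    have "D = 6 \<or> D = 4 \<or> D = 2 \<or> D = 0 \<or> D = -2 \<or> D = -4 \<or> D = -6"
      using mem[OF ab(1)] mem[OF ab(2)] unfolding D_def by (elim disjE) simp_all
    moreover have "a1 + b1 = D" by (simp add: D_def)
    ultimately have "D = 2 \<or> D = -2"
      using ext[OF ab(1,2)] ext[OF ab(5,6) c2] ext[OF ab(9,10) c3] ne12 ne13 ne23 D0
      by (elim disjE) auto
    with D show ?thesis by (intro exI[of _ "D div 2"]) auto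
  qed
  obtain e where e: "\<And>x. e x = 1 \<or> e x = -1" "\<And>x. n dvd F (x + 2) - F x - 2 * e x"
    using two by metis
  have "\<exists>a\<in>S. n dvd F (x + 1) - F x - a" for x
    by (rule S) (simp add: cadj_def)
  then obtain d where d: "\<And>x. d x \<in> S" "\<And>x. n dvd F (x + 1) - F x - d x" by metis
  have small: "z = 0" if "n dvd z" "\<bar>z\<bar> \<le> 10" "even z" for z
    using even_dvd_small[OF n, of z] that by auto
  have dd: "d x + d (x + 1) = 2 * e x" for x
  proof -
    have "n dvd d x + d (x + 1) - 2 * e x"
      using dvd_diff[OF e(2)[of x] dvd_add[OF d(2)[of x] d(2)[of "x+1"]]]
      by (simp add: algebra_simps)
    from small[OF this] show ?thesis using d(1)[of x] d(1)[of "x+1"] e(1)[of x] by (auto simp: S_def)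
  qed
  have ee: "e (x + 2) = e x" for x
  proof (rule ccontr)
    assume "e (x + 2) \<noteq> e x"
    then have "e (x + 2) = - e x" using e(1)[of x] e(1)[of "x+2"] by auto
    with dvd_add[OF e(2)[of x] e(2)[of "x + 2"]] have "n dvd F (x + 4) - F x" by (simp add: algebra_simps)
    then have "n dvd 4" using caut_inj[OF F, of "x+4" x] by simp
    then show False using small[of 4] by auto
  qed
  have ddd: "d x + d (x + 1) + d (x + 2) \<in> S" for x
  proof -
    obtain a where a: "a \<in> S" "n dvd F (x + 3) - F x - a"
      using S[of "x + 3" x] by (auto simp: cadj_def)
    have "n dvd d x + d (x + 1) + d (x + 2) - a"
      using dvd_diff[OF a(2) dvd_add[OF d(2)[of x] dvd_add[OF d(2)[of "x+1"] d(2)[of "x+2"]]]]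
      by (simp add: algebra_simps)
    moreover have "even (d x + d (x + 1) + d (x + 2) - a)"
      using d(1)[of x] d(1)[of "x+1"] d(1)[of "x+2"] a(1) oddS by auto
    moreover have "\<bar>d x + d (x + 1) + d (x + 2) - a\<bar> \<le> 10"
      using dd[of x] e(1)[of x] oddS[OF a(1)] oddS[OF d(1)[of "x+2"]] by auto
    ultimately have "d x + d (x + 1) + d (x + 2) - a = 0" using small by blast
    with a show ?thesis by simp
  qed
  \<comment> \<open>Two-term sums equal to 2 would also allow the steps 3, -1, 3, -1; these are
    excluded because the three-term sum 5 is no offset. If \<open>e\<close> changed sign, solving
    for \<open>d\<close> as far as \<open>x + 4\<close> would lead outside \<open>S\<close>.\<close>
  have de: "d x = e x \<and> d (x + 1) = e x" for x
  proof -
    have mem: "d y = 1 \<or> d y = -1 \<or> d y = 3 \<or> d y = -3" for y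
      using d(1)[of y] by (auto simp: S_def)
    have memd: "d y + d (y + 1) + d (y + 2) \<in> {1, -1, 3, -3}" for y
      using ddd[of y] by (simp add: S_def)
    have shift: "x + 1 + 1 = x + 2" "x + 2 + 1 = x + 3" "x + 1 + 2 = x + 3" "x + 3 + 1 = x + 4"
      "x + 2 + 2 = x + 4" by simp_all
    have "d x = 2 * e x - d (x + 1)" "d (x + 2) = 2 * e (x + 1) - d (x + 1)"
      "d (x + 3) = 2 * e x - d (x + 2)" "d (x + 4) = 2 * e (x + 1) - d (x + 3)"
      using dd[of x] dd[of "x+1"] dd[of "x+2"] dd[of "x+3"] ee[of x] ee[of "x+1"]
      unfolding shift by simp_all
    moreover have "d x \<in> {1, -1, 3, -3}" "d (x + 2) \<in> {1, -1, 3, -3}" "d (x + 3) \<in> {1, -1, 3, -3}"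
       "d (x + 4) \<in> {1, -1, 3, -3}" using d(1) by (simp_all only: S_def)
    moreover have "d (x + 1) + d (x + 2) + d (x + 3) \<in> {1, -1, 3, -3}"
      using memd[of "x+1"] unfolding shift .
    moreover note memd[of x]
    ultimately show ?thesis
      using mem[of "x+1"] e(1)[of x] e(1)[of "x+1"] by (elim disjE) simp_all
  qed
  have eq: "e (x + 1) = e x" for x using de[of x] de[of "x+1"] by simp
  have "e x = e 0" for x
  proof (induction x rule: int_induct[where k = 0])
    case (step2 i) then show ?case using eq[of "i - 1"] by simp
  qed (use eq in auto)
  then show ?thesis using that[of "e 0"] e(1) d(2) de affine_of_const_step[of n F "e 0"] by metis
qed

section \<open>Colourings by arcs\<close>

text \<open>The \<open>A / d\<close> multiples of \<open>d\<close> in the arc are sent to an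
  arithmetic progression in the same arc, which has room only for steps \<open>0\<close>,
  \<open>d\<close> and \<open>- d\<close>. Step 0 would also send 0 into the arc; the other two give
  the identity and the reflection of the arc about its centre.\<close>

lemma arc_preserving_affine:
  fixes n d A u \<beta> :: int
  assumes d: "0 < d" "d dvd A" "d dvd n" "d dvd \<beta>" and A: "2 * d \<le> A" "2 * A < n"
    and inv: "\<And>y. d dvd y \<Longrightarrow> (u * y + \<beta>) mod n \<in> {A..<2 * A} \<longleftrightarrow> y mod n \<in> {A..<2 * A}"
  shows "n dvd u * d - d \<and> n dvd \<beta> \<or> n dvd u * d + d \<and> n dvd \<beta> - (3 * A - d)"
proof -
  define s where "s = nat (A div d)"
  have As: "A = int s * d" and s: "2 \<le> s"
  proof -
    have "A div d * d = A" using d(2) by simp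
    moreover have "2 \<le> A div d" using A(1) d(1,2) by (auto elim!: dvdE simp: mult.commute)
    ultimately show "A = int s * d" "2 \<le> s" by (auto simp: s_def)
  qed
  define z where "z i = (u * (A + int i * d) + \<beta>) mod n" for i
  have z: "z i \<in> {A..<2 * A}" "d dvd z i" if "i < s" for i
  proof -
    have "int i * d < int s * d" using that d(1) by simp
    then have "A + int i * d < 2 * A" "A \<le> A + int i * d" using As d(1) by auto
    then have "(A + int i * d) mod n \<in> {A..<2 * A}" using A d(1) by (simp add: mod_pos_pos_trivial)
    then show "z i \<in> {A..<2 * A}" unfolding z_def using inv[of "A + int i * d"] d(2) by simp
    show "d dvd z i" unfolding z_def using d by (simp add: dvd_mod)
  qed
  have zle: "z i \<le> 2 * A - d" if "i < s" for i
  proof -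
    have "d dvd 2 * A - z i" "0 < 2 * A - z i" using z[OF that] d(2) by auto
    then show ?thesis using zdvd_imp_le by fastforce
  qed
  have zcong: "n dvd z i - (u * (A + int i * d) + \<beta>)" for i
    unfolding z_def by (rule mod_dvd_diff(1))
  define g where "g = z 1 - z 0"
  have step: "n dvd z (Suc i) - z i - u * d" for i
    using dvd_diff[OF zcong[of "Suc i"] zcong[of i]] by (simp add: algebra_simps)
  have gu: "n dvd g - u * d" using step[of 0] by (simp add: g_def)
  have zi: "z i = z 0 + int i * g" if "i < s" for i
    using that
  proof (induction i)
    case (Suc i)
    have "n dvd z (Suc i) - z i - g" using dvd_diff[OF step[of i] gu] by (simp add: algebra_simps)
    \<comment> \<open>All values lie in an arc of length \<open>A\<close> with
      \<open>2 * A < n\<close>, so steps that are congruent modulo \<open>n\<close> are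
      equal.\<close>
    moreover have "\<bar>z (Suc i) - z i - g\<bar> < n"
      using z(1)[of "Suc i"] z(1)[of i] z(1)[of 0] z(1)[of 1] Suc.prems s A(2) unfolding g_def by auto
    ultimately have "z (Suc i) - z i - g = 0" by (rule dvd_small[rotated])
    then show ?case using Suc by (simp add: algebra_simps)
  qed simp
  have dg: "d dvd g" unfolding g_def using z(2)[of 0] z(2)[of 1] s by simp
  have last: "z (s - 1) = z 0 + (int s - 1) * g" using zi[of "s - 1"] s by simp
  have le: "\<bar>z (s - 1) - z 0\<bar> \<le> (int s - 1) * d"
    using z(1)[of 0] z(1)[of "s - 1"] zle[of 0] zle[of "s - 1"] s As by (auto simp: algebra_simps)
  have "\<bar>g\<bar> \<le> d"
  proof -
    have "(int s - 1) * \<bar>g\<bar> \<le> (int s - 1) * d" using le s unfolding last by (simp add: abs_mult)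
    then show ?thesis using s by simp
  qed
  then have "g = 0 \<or> g = d \<or> g = - d"
    using dg zdvd_imp_le[of d g] zdvd_imp_le[of d "-g"] by (cases "g = 0"; cases "g > 0") auto
  then show ?thesis
  proof (elim disjE)
    assume "g = 0"
    then have "n dvd u * d" using gu by simp
    then have "n dvd u * A" unfolding As by (metis dvd_mult mult.left_commute)
    then have "n dvd (u * 0 + \<beta>) - (u * A + \<beta>)" by simp
    then have "(u * 0 + \<beta>) mod n = (u * A + \<beta>) mod n" by (simp only: mod_eq_dvd_iff)
    then have "(u * 0 + \<beta>) mod n \<in> {A..<2 * A}" using z(1)[of 0] s by (simp add: z_def)
    then show ?thesis using inv[of 0] A d(1) by simp
  next
    assume g: "g = d"
    then have ud: "n dvd u * d - d" using gu by (simp add: dvd_diff_commute)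
    have "z 0 + (int s - 1) * d \<le> 2 * A - d" using zle[of "s - 1"] s unfolding last g by simp
    then have "z 0 = A" using z(1)[of 0] s As by (auto simp: algebra_simps)
    then have "n dvd A - (u * A + \<beta>)" using zcong[of 0] by simp
    moreover have "n dvd int s * (u * d - d)" using ud by simp
    then have "n dvd u * A - A" by (simp add: As algebra_simps)
    ultimately have "n dvd (A - (u * A + \<beta>)) + (u * A - A)" by (rule dvd_add)
    then show ?thesis using ud by simp
  next
    assume g: "g = - d"
    then have ud: "n dvd u * d + d" using gu dvd_minus_iff[of n "- d - u * d"] by (simp add: algebra_simps)
    have "z 0 - (int s - 1) * d \<ge> A" using z(1)[of "s - 1"] s unfolding last g by simp
    then have "z 0 = 2 * A - d" using zle[of 0] s As by (auto simp: algebra_simps)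
    then have "n dvd (2 * A - d) - (u * A + \<beta>)" using zcong[of 0] by simp
    moreover have "n dvd int s * (u * d + d)" using ud by simp
    then have "n dvd u * A + A" by (simp add: As algebra_simps)
    ultimately have "n dvd ((2 * A - d) - (u * A + \<beta>)) + (u * A + A)" by (rule dvd_add)
    then have "n dvd \<beta> - (3 * A - d)"
      using dvd_minus_iff[of n "\<beta> - (3 * A - d)"] by (simp add: algebra_simps)
    then show ?thesis using ud by simp
  qed
qed

text \<open>An affine map that preserves the arcs and fixes 0 fixes all fibres of \<open>x \<mapsto> t x mod n\<close>;
  the vertex \<open>v\<close> chosen here is moved by it.\<close>

lemma moved_vertex:
  fixes n k t d :: int
  assumes n: "odd n" "0 < n" and d: "d = gcd t n" "4 * d < n"
    and sq: "n dvd k^2 - 1 \<or> n dvd k^2 + 1" and k: "\<not> n dvd k - 1" "\<not> n dvd k + 1"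
  obtains v where "n dvd t * v - d" "\<And>u. u = k \<or> u = - k \<Longrightarrow> n dvd u * d - d \<Longrightarrow> \<not> n dvd u * v - v"
proof -
  have d0: "0 < d" and dn: "d dvd n" and dt: "d dvd t" using n d by (auto simp: gcd_pos_int)
  obtain m where m: "n = d * m" using dn by auto
  have m4: "4 < m" using d(2) d0 by (simp add: m mult.commute[of 4])
  obtain t' where t': "t = d * t'" using dt by auto
  obtain x0 q where "x0 * t + q * n = d" using bezout_int[of t n] d(1) by auto
  then have x0: "n dvd t * x0 - d" by (metis add_diff_cancel_left' diff_diff_eq2 diff_self dvd_minus_iff
        dvd_triv_right minus_diff_eq mult.commute diff_0 uminus_add_conv_diff add.commute)
  \<comment> \<open>\<open>m = n / d\<close> is in the kernel of multiplication by \<open>t\<close>,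
    which makes \<open>x0 + m\<close> a second candidate for \<open>v\<close>.\<close>
  have tm: "n dvd t * m" by (simp add: m t')
  \<comment> \<open>Otherwise \<open>d\<close> and \<open>m\<close> both divide
    \<open>u - 1\<close>, and \<open>n\<close> divides \<open>u^2 - 1\<close>. With
    \<open>u - 1 = m * e\<close> the number \<open>d\<close> divides \<open>e * (u + 1)\<close> and
    \<open>e * (u - 1)\<close>, hence \<open>e * 2\<close>, hence \<open>e\<close> because
    \<open>n\<close> is odd; so \<open>u\<close> would be 1 modulo \<open>n\<close>.\<close>
  have no: "\<not> n dvd (u - 1) * m" if u: "u = k \<or> u = - k" and ud: "n dvd u * d - d" for u
  proof
    assume "n dvd (u - 1) * m"
    then have du: "d dvd u - 1" using m4 by (simp add: m)
    have "d * m dvd d * (u - 1)" using ud by (simp add: m algebra_simps)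
    then have "m dvd u - 1" using d0 by simp
    then obtain e where e: "u - 1 = m * e" by auto
    have u2: "u^2 = k^2" using u by auto
    have "m dvd (u - 1) * (u + 1)" using \<open>m dvd u - 1\<close> by simp
    then have "m dvd k^2 - 1" using u2 by (simp add: algebra_simps power2_eq_square)
    have "\<not> n dvd k^2 + 1"
    proof
      assume "n dvd k^2 + 1"
      then have "m dvd k^2 + 1" using m dvd_trans by (metis dvd_triv_right)
      from dvd_diff[OF this \<open>m dvd k^2 - 1\<close>] have "m dvd 2" by simp
      then show False using m4 zdvd_imp_le[of m 2] by simp
    qed
    with sq have "n dvd u^2 - 1" using u2 by simp
    also have "u^2 - 1 = m * (e * (u + 1))" using e by (simp add: power2_eq_square algebra_simps)
    finally have "d dvd e * (u + 1)" using m4 by (simp add: m mult.commute)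
    moreover have "d dvd e * (u - 1)" using du by simp
    ultimately have "d dvd e * (u + 1) - e * (u - 1)" by (rule dvd_diff)
    then have "d dvd e * 2" by (simp add: algebra_simps)
    moreover have "coprime d 2" using n(1) dn by (simp add: coprime_commute) (metis dvd_trans)
    ultimately have "d dvd e" by (simp add: coprime_dvd_mult_left_iff)
    then have "n dvd u - 1" unfolding e m by (simp add: mult.commute)
    with u k dvd_minus_iff[of n "k + 1"] show False by auto
  qed
  \<comment> \<open>At most one of \<open>k\<close> and \<open>- k\<close> fixes \<open>d\<close>,
    so a single \<open>v\<close> can be chosen to suit both signs.\<close>
  have unique: "u = u'" if "u = k \<or> u = - k" "n dvd u * d - d" "u' = k \<or> u' = - k" "n dvd u' * d - d" for u u'
  proof (rule ccontr)
    assume "u \<noteq> u'"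
    then have "u' = - u" using that by auto
    with dvd_add[OF that(2,4)] have "n dvd - (2 * d)" by simp
    then have "n dvd 2 * d" by (simp only: dvd_minus_iff)
    then show False using zdvd_imp_le[of n "2 * d"] d0 d(2) by simp
  qed
  show thesis
  proof (cases "\<exists>u. (u = k \<or> u = - k) \<and> n dvd u * d - d \<and> n dvd u * x0 - x0")
    case True
    then obtain u where u: "u = k \<or> u = - k" "n dvd u * d - d" "n dvd u * x0 - x0" by blast
    show ?thesis
    proof (rule that[of "x0 + m"])
      show "n dvd t * (x0 + m) - d" using dvd_add[OF x0 tm] by (simp add: algebra_simps)
      fix u' assume u': "u' = k \<or> u' = - k" "n dvd u' * d - d"
      then have "u' = u" using unique u by blast
      show "\<not> n dvd u' * (x0 + m) - (x0 + m)"
      proof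
        assume "n dvd u' * (x0 + m) - (x0 + m)"
        from dvd_diff[OF this u(3)] have "n dvd (u - 1) * m" by (simp add: \<open>u' = u\<close> algebra_simps)
        with no u show False by blast
      qed
    qed
  next
    case False
    then show ?thesis using that[OF x0] by blast
  qed
qed

lemma dvd_less_imp_le: "d dvd a \<Longrightarrow> d dvd b \<Longrightarrow> 0 < d \<Longrightarrow> a < b \<Longrightarrow> a + d \<le> b" for a b d :: int
  using zdvd_imp_le[of d "b - a"] by auto

text \<open>The arcs are \<open>[0, A)\<close>, \<open>[A, 2A)\<close> and \<open>[2A, n)\<close>,
  the last shorter than \<open>A\<close>. The offsets 1 and \<open>k\<close> move \<open>t x\<close>
  by amounts in \<open>[A, n - A]\<close> and so out of each arc. Recoloured vertices get colour 2,
  which leaves the middle arc intact for \<open>arc_preserving_affine\<close>.\<close>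

lemma arc_colouring:
  fixes n k t :: int
  assumes t: "n < 3 * t" "2 * t < n" "n < 3 * (t * k mod n)" "3 * (t * k mod n) < 2 * n"
    and aff: "\<And>F. caut n k F \<Longrightarrow> \<exists>u. (u = 1 \<or> u = -1 \<or>
        (u = k \<or> u = -k) \<and> (n dvd k^2 - 1 \<or> n dvd k^2 + 1)) \<and> (\<forall>x. n dvd F x - F 0 - u * x)"
    and k: "\<not> n dvd k - 1" "\<not> n dvd k + 1"
    and trouble: "n dvd k^2 - 1 \<or> n dvd k^2 + 1 \<Longrightarrow> n dvd k * t - t \<or> n dvd k * t + t \<Longrightarrow> gcd t n > 1 \<Longrightarrow>
        odd n \<and> n + 2 * gcd t n \<le> 3 * t"
  obtains C where "ccolouring n k C" "cdist n k C" "\<And>x. C x < 3"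
proof -
  define d where "d = gcd t n"
  define \<kappa> where "\<kappa> = t * k mod n"
  define y where "y x = t * x mod n" for x
  define A where "A = min t (min \<kappa> (n - \<kappa>))"
  have n0: "0 < n" and t0: "0 < t" using t by auto
  have d0: "0 < d" and dn: "d dvd n" and dt: "d dvd t" using n0 by (auto simp: d_def gcd_pos_int)
  have d\<kappa>: "d dvd \<kappa>" unfolding \<kappa>_def using dn dt by (simp add: dvd_mod)
  have dA: "d dvd A" unfolding A_def using dt d\<kappa> dn by (auto simp: min_def)
  have "n < 3 * A" using t[folded \<kappa>_def] by (auto simp: A_def min_def)
  \<comment> \<open>Both sides are multiples of \<open>d\<close>, so a strict inequality gains
    \<open>d\<close>. This is the room for appending the value 0, read as \<open>n\<close>, to the
    third arc.\<close>
  then have A3: "n + d \<le> 3 * A" using dn dA d0 by (intro dvd_less_imp_le) auto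
  have A2: "2 * A < n" using t(2) by (simp add: A_def min_def)
  have At: "A \<le> t" "t \<le> n - A" and A\<kappa>: "A \<le> \<kappa>" "\<kappa> \<le> n - A" using t by (auto simp: A_def)
  have "d < A" using A2 A3 by auto
  then have Ad: "2 * d \<le> A" using dvd_less_imp_le[of d d A] dA d0 by auto
  have d4: "4 * d < n" using Ad A2 by auto
  have d5: "5 * d \<le> n" using dvd_less_imp_le[of d "4 * d" n] d4 d0 dn by auto
  have y: "0 \<le> y x" "y x < n" "d dvd y x" "n dvd y x - t * x" for x
    using n0 dn dt by (auto simp: y_def dvd_mod mod_dvd_diff)
  have ycong: "y x = y x'" if "n dvd x - x'" for x x'
  proof -
    have "n dvd t * x - t * x'" using that by (simp add: right_diff_distrib[symmetric])
    then show ?thesis by (simp add: y_def mod_eq_dvd_iff)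
  qed
  have yeq: "y x = r" if "0 \<le> r" "r < n" "n dvd t * x - r" for x r
  proof -
    have "t * x mod n = r mod n" using that(3) by (simp add: mod_eq_dvd_iff)
    then show ?thesis using that by (simp add: y_def)
  qed
  have ysurj: "\<exists>x. n dvd t * x - r" if r: "d dvd r" for r
  proof -
    obtain p q where "p * t + q * n = d" using bezout_int[of t n] by (auto simp: d_def)
    moreover obtain c where "r = d * c" using r by auto
    ultimately have "t * (p * c) - r = n * (- q * c)" by (simp add: algebra_simps flip: distrib_left)
    then show ?thesis by (metis dvd_triv_left)
  qed
  (* T: some u = k or u = - k acts trivially modulo n / d, so recolouring 0 alone leaves a symmetry. *)
  define T where "T \<longleftrightarrow> (n dvd k^2 - 1 \<or> n dvd k^2 + 1) \<and> (n dvd k * t - t \<or> n dvd k * t + t) \<and> d > 1"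
  \<comment> \<open>Under \<open>T\<close> the residue \<open>\<kappa>\<close> is \<open>t\<close>
    or \<open>n - t\<close>, so \<open>A = t\<close> and the hypothesis \<open>trouble\<close>
    supplies the slack for appending the value \<open>d\<close>, read as \<open>n + d\<close>, as
    well.\<close>
  have TA: "n + 2 * d \<le> 3 * A" "odd n" if T
  proof -
    have "n dvd \<kappa> - t * k" by (simp add: \<kappa>_def mod_dvd_diff)
    then have "n dvd \<kappa> - t \<or> n dvd \<kappa> + t"
      using that dvd_add[of n "\<kappa> - t * k" "k * t - t"] dvd_add[of n "\<kappa> - t * k" "k * t + t"]
      unfolding T_def by (auto simp: algebra_simps)
    then have "n dvd \<kappa> - t \<or> n dvd (\<kappa> + t) - n" by auto
    moreover have "\<bar>\<kappa> - t\<bar> < n" "\<bar>(\<kappa> + t) - n\<bar> < n" using t unfolding \<kappa>_def[symmetric] by auto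
    ultimately have "\<kappa> - t = 0 \<or> \<kappa> + t - n = 0" by (metis dvd_small)
    then have "A = t" using t(2) by (auto simp: A_def)
    with trouble that show "n + 2 * d \<le> 3 * A" "odd n" unfolding T_def d_def by auto
  qed
  obtain v where v: "T \<Longrightarrow> n dvd t * v - d"
    "\<And>u. T \<Longrightarrow> u = k \<or> u = - k \<Longrightarrow> n dvd u * d - d \<Longrightarrow> \<not> n dvd u * v - v"
  proof (cases T)
    case True
    then show ?thesis
      using moved_vertex[of n d t k] that n0 d4 k TA(2) unfolding T_def d_def by metis
  qed (use that in blast)
  define E where "E x \<longleftrightarrow> n dvd x \<or> T \<and> n dvd x - v" for x
  have Ey: "n dvd x \<and> y x = 0 \<or> T \<and> n dvd x - v \<and> y x = d" if "E x" for x
  proof -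
    have "y 0 = 0" by (simp add: y_def)
    moreover have "y v = d" if T using yeq[of d v] v(1)[OF that] d0 d5 by auto
    ultimately show ?thesis using that ycong[of x 0] ycong[of x v] unfolding E_def by auto
  qed
  have Econg: "E x \<longleftrightarrow> E x'" if "n dvd x - x'" for x x'
  proof -
    have "n dvd x - a \<longleftrightarrow> n dvd x' - a" for a
      using dvd_diff_trans[OF that, of a] dvd_diff_trans[of n x' x a] that dvd_diff_sym by metis
    from this[of 0] this[of v] show ?thesis by (simp add: E_def)
  qed
  define C :: "int \<Rightarrow> nat" where
    "C x = (if E x then 2 else if y x < A then 0 else if y x < 2 * A then 1 else 2)" for x
  have C1: "C x = 1 \<longleftrightarrow> y x \<in> {A..<2 * A}" for x
    using Ey[of x] Ad d0 by (auto simp: C_def)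
  have C2: "E x" if "C x = 2" "y x < A" for x
    using that by (auto simp: C_def split: if_splits)
  have proper: "C x \<noteq> C (x + h)" if h: "A \<le> t * h mod n" "t * h mod n \<le> n - A" for x h
  proof
    assume eq: "C x = C (x + h)"
    have "n dvd (y (x + h) - t * (x + h)) - (y x - t * x) - (t * h mod n - t * h)"
      by (rule dvd_diff[OF dvd_diff[OF y(4) y(4)] mod_dvd_diff(1)])
    then have dv: "n dvd y (x + h) - y x - t * h mod n" by (simp add: algebra_simps)
    then have dv': "n dvd y (x + h) - y x - t * h mod n + n" by simp
    have sub: "y (x + h) = y x + t * h mod n \<or> y (x + h) = y x + t * h mod n - n"
      using dvd_small[OF _ dv] dvd_small[OF _ dv'] y(1,2)[of x] y(1,2)[of "x + h"] h A2 A3 d0 by linarith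
    \<comment> \<open>Lifting the values of recoloured vertices by \<open>n\<close> puts the whole
      class of colour 2 into \<open>[2A, 3A)\<close>, where no step of a neighbour fits.\<close>
    define z where "z x = (if E x then y x + n else y x)" for x
    have z: "2 * A \<le> z x \<and> z x < 3 * A \<and> (z x = y x \<or> z x = y x + n)" if "C x = 2" for x
      using that Ey[of x] y(1,2)[of x] A2 A3 TA(1) d0 by (auto simp: C_def z_def split: if_splits)
    consider "C x = 0" "C (x + h) = 0" | "C x = 1" "C (x + h) = 1" | "C x = 2" "C (x + h) = 2"
      using eq by (auto simp: C_def split: if_splits)
    then show False
    proof cases
      case 1
      then have "y x < A" "y (x + h) < A" by (auto simp: C_def split: if_splits)
      then show False using sub y(1)[of x] y(1)[of "x+h"] h by auto
    next
      case 2
      then show False using sub h unfolding C1 by auto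
    next
      case 3
      from z[OF 3(1)] z[OF 3(2)] sub h A2 A3 d0 show False by auto
    qed
  qed
  have "ccolouring n k C"
    unfolding ccolouring_def
  proof (intro conjI allI impI)
    fix x x' assume "n dvd x - x'"
    then show "C x = C x'" using ycong Econg by (simp add: C_def)
  next
    fix x
    have "t * 1 mod n = t" using t t0 by simp
    then show "C x \<noteq> C (x + 1)" using proper[of 1 x] At by simp
    show "C x \<noteq> C (x + k)" using proper[of k x] A\<kappa> by (simp add: \<kappa>_def)
  qed
  moreover have "cdist n k C"
    unfolding cdist_def
  proof (intro allI impI)
    fix F x assume F: "caut n k F" and CF: "\<forall>x. C (F x) = C x"
    obtain u where u: "u = 1 \<or> u = -1 \<or> (u = k \<or> u = -k) \<and> (n dvd k^2 - 1 \<or> n dvd k^2 + 1)"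
      and Fu: "\<And>x. n dvd F x - F 0 - u * x" using aff[OF F] by blast
    define \<beta> where "\<beta> = t * F 0"
    have tF: "n dvd t * F x - (u * r + \<beta>)" if "n dvd t * x - r" for x r
    proof -
      have "n dvd t * (F x - F 0 - u * x) + u * (t * x - r)" using Fu that by simp
      then show ?thesis by (simp add: \<beta>_def algebra_simps)
    qed
    have yF: "y (F x) = (u * r + \<beta>) mod n" if "n dvd t * x - r" for x r
      using tF[OF that] by (simp add: y_def mod_eq_dvd_iff)
    have "(u * r + \<beta>) mod n \<in> {A..<2 * A} \<longleftrightarrow> r mod n \<in> {A..<2 * A}" if r: "d dvd r" for r
    proof -
      obtain x where x: "n dvd t * x - r" using ysurj[OF r] by blast
      then have "y x = r mod n" by (simp add: y_def mod_eq_dvd_iff)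
      then show ?thesis using CF C1[of x] C1[of "F x"] yF[OF x] by simp
    qed
    then consider "n dvd u * d - d" "n dvd \<beta>" | "n dvd u * d + d" "n dvd \<beta> - (3 * A - d)"
      using arc_preserving_affine[of d A n \<beta> u] d0 dA dn dt Ad A2 by (auto simp: \<beta>_def)
    then show "n dvd F x - x"
    proof cases
      \<comment> \<open>The reflection moves the value \<open>2 * A\<close>, which has colour 2, to
        \<open>A - d\<close>. That value has colour 0 except at recoloured vertices, whose values
        are only 0 and \<open>d\<close>; \<open>A = 2 * d\<close> would contradict the slack under
        \<open>T\<close>.\<close>
      case 2
      obtain p where p: "n dvd t * p - 2 * A" using ysurj[of "2 * A"] dA by auto
      have "y p = 2 * A" using yeq[OF _ _ p] A2 Ad d0 by auto
      then have "C p = 2" using Ad d0 by (auto simp: C_def)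
      obtain s where s: "A = d * s" using dA by auto
      have "n dvd 2 * s * (u * d + d)" using 2(1) by simp
      then have "n dvd u * (2 * A) + 2 * A" by (simp add: s algebra_simps)
      from dvd_add[OF dvd_add[OF this 2(2)] tF[OF p]] have "n dvd t * F p - (A - d)"
        by (simp add: algebra_simps)
      then have "y (F p) = A - d" using yeq[of "A - d" "F p"] A2 Ad d0 by auto
      moreover have "E (F p)" using \<open>C p = 2\<close> CF calculation d0 by (intro C2) auto
      ultimately show ?thesis using Ey[of "F p"] Ad d0 d5 TA(1) by auto
    next
      \<comment> \<open>Now \<open>F\<close> preserves every fibre of \<open>t x mod n\<close>. In
        the fibre of value 0 only the vertex 0 has colour 2, so it is fixed and \<open>F\<close> is
        multiplication by \<open>u\<close>. If \<open>u\<close> is not 1, then \<open>T\<close>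
        holds, and \<open>v\<close> is likewise alone in its fibre, but \<open>u\<close> moves
        it.\<close>
      case 1
      have "y (F 0) = 0" using yeq[of 0 "F 0"] 1(2) n0 by (simp add: \<beta>_def)
      moreover have "C 0 = 2" by (simp add: C_def E_def)
      ultimately have "E (F 0)" using CF Ad d0 by (intro C2) auto
      with \<open>y (F 0) = 0\<close> Ey[of "F 0"] d0 have "n dvd F 0" by auto
      have Fu': "n dvd F x - u * x" for x using dvd_add[OF Fu[of x] \<open>n dvd F 0\<close>] by simp
      have "u = 1"
      proof (rule ccontr)
        assume "u \<noteq> 1"
        have "\<not> n dvd 2 * d" using zdvd_imp_le[of n "2 * d"] d0 d4 by auto
        then have "u \<noteq> -1" using 1(1) dvd_minus_iff[of n "2 * d"] by auto
        with u \<open>u \<noteq> 1\<close> have uk: "u = k \<or> u = - k" and sq: "n dvd k^2 - 1 \<or> n dvd k^2 + 1" by auto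
        obtain t' where t': "t = d * t'" using dt by auto
        have "n dvd (u * d - d) * t'" using 1(1) by simp
        then have "n dvd u * t - t" by (simp add: t' algebra_simps)
        then have "n dvd k * t - t \<or> n dvd - (k * t + t)" using uk by auto
        then have "n dvd k * t - t \<or> n dvd k * t + t" by (simp only: dvd_minus_iff)
        moreover have "d \<noteq> 1"
        proof
          assume "d = 1"
          then have "n dvd u - 1" using 1(1) by simp
          then show False using uk k dvd_minus_iff[of n "k + 1"] by auto
        qed
        ultimately have T using sq d0 by (simp add: T_def)
        then have "E v" "y v = d" using yeq[of d v] v(1) d0 d5 by (auto simp: E_def)
        then have "C v = 2" by (simp add: C_def)
        have "y (F v) = d"
        proof (rule yeq)
          show "n dvd t * F v - d"
            using dvd_add[OF dvd_add[OF tF[OF v(1)[OF \<open>T\<close>]] 1(2)] 1(1)] by (simp add: algebra_simps)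
        qed (use d0 d5 in auto)
        then have "E (F v)" using \<open>C v = 2\<close> CF Ad d0 by (intro C2) auto
        with Ey[of "F v"] \<open>y (F v) = d\<close> d0 have "n dvd F v - v" by auto
        from dvd_diff[OF this Fu'[of v]] have "n dvd u * v - v" by simp
        with v(2)[OF \<open>T\<close> uk 1(1)] show False by blast
      qed
      then show ?thesis using Fu'[of x] by simp
    qed
  qed
  moreover have "C x < 3" for x by (simp add: C_def)
  ultimately show ?thesis using that by blast
qed

section \<open>Existence of the multiplier \<open>t\<close>\<close>

definition arc_step :: "int \<Rightarrow> int \<Rightarrow> int \<Rightarrow> bool" where
  "arc_step n k t \<longleftrightarrow> n < 3 * t \<and> 2 * t < n \<and> n < 3 * (t * k mod n) \<and> 3 * (t * k mod n) < 2 * n \<and>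
     ((n dvd k^2 - 1 \<or> n dvd k^2 + 1) \<longrightarrow> gcd t n > 1 \<longrightarrow> odd n \<and> n + 2 * gcd t n \<le> 3 * t)"

text \<open>The choice is \<open>t = (n - j) / 2\<close>. Then \<open>gcd t n\<close> divides
  \<open>n - 2 t = j\<close>, so \<open>7 * j \<le> n\<close> gives
  \<open>n + 2 * gcd t n \<le> 3 * t\<close>. The equation \<open>tk\<close> says that
  \<open>x\<close> is the residue of \<open>t k\<close>.\<close>

lemma arc_stepI:
  fixes n k j x q :: int
  assumes j: "0 < j" "even (n - j)" "3 * j < n" and x: "n < 3 * x" "3 * x < 2 * n"
    and tk: "(n - j) * k = 2 * x + 2 * n * q"
    and sq: "n dvd k^2 - 1 \<or> n dvd k^2 + 1 \<Longrightarrow> gcd ((n - j) div 2) n > 1 \<Longrightarrow> gcd ((n - j) div 2) n dvd j \<Longrightarrow>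
        odd n \<and> 7 * j \<le> n"
  shows "\<exists>t. arc_step n k t"
proof -
  define t where "t = (n - j) div 2"
  have t: "2 * t = n - j" using j(2) by (simp add: t_def)
  have "2 * (t * k) = 2 * (x + n * q)" using tk unfolding t[symmetric] by (simp add: algebra_simps)
  then have "t * k = x + n * q" by simp
  then have "t * k mod n = x mod n" by simp
  also have "x mod n = x" using x by (intro mod_pos_pos_trivial) auto
  finally have tkx: "t * k mod n = x" .
  have "odd n \<and> n + 2 * gcd t n \<le> 3 * t" if "n dvd k^2 - 1 \<or> n dvd k^2 + 1" "gcd t n > 1"
  proof -
    have "gcd t n dvd n - 2 * t" by simp
    then have g: "gcd t n dvd j" using t by simp
    then have "odd n \<and> 7 * j \<le> n" using sq[folded t_def] that by blast
    moreover have "gcd t n \<le> j" using g j(1) by (rule zdvd_imp_le)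
    ultimately show ?thesis using t by linarith
  qed
  moreover have "n < 3 * t" "2 * t < n" using j t by linarith+
  ultimately have "arc_step n k t" using x unfolding arc_step_def tkx by blast
  then show ?thesis ..
qed

lemma odd_dvd_eq:
  fixes c n :: int
  assumes "odd c" "0 < c" "c < 3 * n" "n dvd c"
  shows "n = c"
proof -
  obtain q where q: "c = n * q" using assms(4) by auto
  have "0 < n" using assms by simp
  then have "0 < q" "n * q < n * 3" using q assms(2,3) by (auto simp: zero_less_mult_iff)
  then have "q = 1 \<or> q = 2" using \<open>0 < n\<close> by auto
  then show ?thesis using q assms(1) by auto
qed

lemma even_square_pm1:
  fixes n k :: int
  assumes "even n" "even k"
  shows "\<not> (n dvd k^2 - 1 \<or> n dvd k^2 + 1)"
proof -
  have "\<not> even (k^2 - 1)" "\<not> even (k^2 + 1)" using assms(2) by simp_all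
  then show ?thesis using dvd_trans[OF assms(1)] by blast
qed

text \<open>With \<open>t = n/2 - 1\<close> the product \<open>t k\<close> is congruent to
  \<open>- k\<close>, because \<open>k\<close> is even; parity rules out \<open>k^2\<close>
  congruent to 1 or -1.\<close>

lemma arc_step_even_even:
  fixes n k :: int
  assumes "even n" "even k" "2 * k \<le> n" "n < 3 * k" "8 \<le> n"
  shows "\<exists>t. arc_step n k t"
proof (rule arc_stepI[where j = 2 and x = "n - k" and q = "k div 2 - 1"])
  show "(n - 2) * k = 2 * (n - k) + 2 * n * (k div 2 - 1)"
    using assms(2) by (auto elim!: evenE simp: algebra_simps)
  show "odd n \<and> 7 * 2 \<le> n" if "n dvd k^2 - 1 \<or> n dvd k^2 + 1"
    using that even_square_pm1 assms by blast
qed (use assms in auto)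

text \<open>\<open>t = (n - 1)/2\<close> is coprime to \<open>n\<close>, and the residue
  \<open>(n - k)/2\<close> of \<open>t k\<close> exceeds \<open>n/3\<close> exactly when
  \<open>3 * k < n\<close>.\<close>

lemma arc_step_odd_odd_large:
  fixes n k :: int
  assumes "odd n" "odd k" "3 * k < n" "3 \<le> k"
  shows "\<exists>t. arc_step n k t"
proof (rule arc_stepI[where j = 1 and x = "(n - k) div 2" and q = "(k - 1) div 2"])
  show "(n - 1) * k = 2 * ((n - k) div 2) + 2 * n * ((k - 1) div 2)"
    using assms(1,2) by (auto elim!: oddE simp: algebra_simps)
  have "2 * ((n - k) div 2) = n - k" using assms(1,2) by simp
  then show "n < 3 * ((n - k) div 2)" "3 * ((n - k) div 2) < 2 * n" using assms(3,4) by linarith+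
qed (use assms in auto)

text \<open>For \<open>t = (n - j)/2\<close> the product \<open>t k\<close> is congruent to
  \<open>- j k / 2\<close>, which is in the middle third if \<open>2 n < 3 j k < 4 n\<close>. So
  \<open>j\<close> is the least number above \<open>2 n / (3 k)\<close> with the parity of
  \<open>n\<close>. For \<open>(15, 4)\<close> this gives \<open>j = 3\<close> and
  \<open>gcd t n = 3\<close>, and \<open>7 * j \<le> n\<close> fails.\<close>

lemma arc_step_even_large:
  fixes n k :: int
  assumes k: "even k" "4 \<le> k" and n: "3 * k < n" "(n, k) \<noteq> (15, 4)"
  shows "\<exists>t. arc_step n k t"
proof -
  define q where "q = 2 * n div (3 * k)"
  define j where "j = (if even (n - (q + 1)) then q + 1 else q + 2)"
  have j: "even (n - j)" "j = q + 1 \<or> j = q + 2" by (auto simp: j_def)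
  have q: "3 * k * q \<le> 2 * n" "2 * n < 3 * k * (q + 1)" "0 \<le> q"
  proof -
    have "2 * n = 3 * k * q + 2 * n mod (3 * k)" by (simp add: q_def)
    moreover have "0 \<le> 2 * n mod (3 * k)" "2 * n mod (3 * k) < 3 * k" using k by auto
    ultimately show "3 * k * q \<le> 2 * n" "2 * n < 3 * k * (q + 1)" by (auto simp: algebra_simps)
    show "0 \<le> q" using n k by (simp add: q_def pos_imp_zdiv_nonneg_iff)
  qed
  have jk: "2 * n < 3 * (k * j)" "3 * (k * j) \<le> 2 * n + 6 * k"
    using j(2) q k by (auto simp: algebra_simps)
  obtain h where h: "k = 2 * h" using k by auto
  show ?thesis
  proof (rule arc_stepI[where j = j and x = "n - j * h" and q = "h - 1"])
    show "(n - j) * k = 2 * (n - j * h) + 2 * n * (h - 1)" by (simp add: h algebra_simps)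
    have "3 * (k * j) < 4 * n" using jk n by simp
    then show "n < 3 * (n - j * h)" by (simp add: h algebra_simps)
    show "3 * (n - j * h) < 2 * n" using jk(1) by (simp add: h algebra_simps)
    have "(k - 2) * (3 * k + 1) \<le> (k - 2) * n" using k n by (intro mult_left_mono) auto
    then have "3 * (k * k) - 5 * k - 2 \<le> k * n - 2 * n" by (simp add: algebra_simps)
    moreover have "4 * k \<le> k * k" using k by simp
    ultimately have "3 * (k * j) < k * n" using jk(2) k by linarith
    then have "k * (3 * j) < k * n" by simp
    then show "3 * j < n" using k by simp
    show "odd n \<and> 7 * j \<le> n"
      if sq: "n dvd k^2 - 1 \<or> n dvd k^2 + 1" and g: "gcd ((n - j) div 2) n > 1"
    proof
      show "odd n" using even_square_pm1 k sq by blast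
      show "7 * j \<le> n"
      \<comment> \<open>For large \<open>k\<close> the upper bound on \<open>j\<close> suffices. For
        \<open>k\<close> equal to 4, 6 or 8 only the few divisors \<open>n > 3 * k\<close> of
        \<open>k^2 - 1\<close> or \<open>k^2 + 1\<close> remain.\<close>
      proof (cases "10 \<le> k")
        case True
        have "(3 * k - 14) * (3 * k + 1) \<le> (3 * k - 14) * n" using True n by (intro mult_left_mono) auto
        then have "9 * (k * k) - 39 * k - 14 \<le> 3 * (k * n) - 14 * n" by (simp add: algebra_simps)
        moreover have "10 * k \<le> k * k" using True by simp
        ultimately have "42 * k \<le> 3 * (k * n) - 14 * n" using True by linarith
        then have "k * (21 * j) \<le> k * (3 * n)" using jk(2) by (simp add: algebra_simps)
        then show ?thesis using k by simp
      next
        case False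
        with k have "k = 4 \<or> k = 6 \<or> k = 8" by presburger
        then show ?thesis
        proof (elim disjE)
          assume k4: "k = 4"
          with sq n odd_dvd_eq[of 15 n] odd_dvd_eq[of 17 n] have "n = 17" by auto
          then have "j = 3" by (simp add: j_def q_def k4)
          with g \<open>n = 17\<close> show ?thesis by (simp add: gcd_non_0_int)
        next
          assume k6: "k = 6"
          with sq n odd_dvd_eq[of 35 n] odd_dvd_eq[of 37 n] have "n = 35 \<or> n = 37" by auto
          then show ?thesis by (auto simp: j_def q_def k6)
        next
          assume k8: "k = 8"
          with sq n odd_dvd_eq[of 63 n] odd_dvd_eq[of 65 n] have "n = 63 \<or> n = 65" by auto
          then show ?thesis by (auto simp: j_def q_def k8)
        qed
      qed
    qed
  qed (use j q in auto)
qed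

text \<open>Modulo \<open>n\<close> the number \<open>2 k\<close> is \<open>- \<delta>\<close>, so
  \<open>4 k^2\<close> is \<open>\<delta>^2\<close> and \<open>n\<close> divides one of the positive
  numbers \<open>\<delta>^2 - 4\<close> and \<open>\<delta>^2 + 4\<close>. It shows that
  \<open>\<delta>\<close> is large whenever the troublesome multipliers exist.\<close>

lemma square_near:
  fixes n k \<delta> :: int
  assumes "n = 2 * k + \<delta>" "3 \<le> \<delta>" "n dvd k^2 - 1 \<or> n dvd k^2 + 1"
  shows "n \<le> \<delta> * \<delta> + 4"
proof -
  have eq: "\<delta> * \<delta> = 4 * k^2 + n * (\<delta> - 2 * k)" by (simp add: assms(1) algebra_simps power2_eq_square)
  have "n dvd \<delta> * \<delta> - 4 \<or> n dvd \<delta> * \<delta> + 4"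
    using assms(3)
  proof
    assume "n dvd k^2 - 1"
    then have "n dvd 4 * (k^2 - 1) + n * (\<delta> - 2 * k)" by (simp only: dvd_add dvd_mult dvd_triv_left)
    then show ?thesis by (simp add: eq algebra_simps)
  next
    assume "n dvd k^2 + 1"
    then have "n dvd 4 * (k^2 + 1) + n * (\<delta> - 2 * k)" by (simp only: dvd_add dvd_mult dvd_triv_left)
    then show ?thesis by (simp add: eq algebra_simps)
  qed
  moreover have "3 * 3 \<le> \<delta> * \<delta>" using assms(2) by (intro mult_mono) auto
  ultimately show ?thesis
    using zdvd_imp_le[of n "\<delta> * \<delta> - 4"] zdvd_imp_le[of n "\<delta> * \<delta> + 4"] by auto
qed

text \<open>Raising \<open>j\<close> by 4 lowers \<open>t\<close> by 2 and so adds
  \<open>\<delta> = n - 2 * k\<close> to \<open>t k\<close> modulo \<open>n\<close>. From the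
  residue \<open>k/2\<close> at \<open>j = -1\<close>, the least number \<open>L\<close> of such
  steps that passes \<open>n/3\<close> is taken; it does not overshoot \<open>2 n/3\<close>. The
  first case, \<open>j = 3\<close>, is \<open>L = 1\<close>.\<close>

lemma arc_step_odd_even_small:
  fixes n k :: int
  assumes "odd n" "even k" "4 \<le> k" "2 * k + 3 \<le> n" "n < 3 * k"
  shows "\<exists>t. arc_step n k t"
proof -
  obtain h where h: "k = 2 * h" using assms(2) by auto
  show ?thesis
  proof (cases "9 * k < 4 * n")
    case True
    show ?thesis
    proof (rule arc_stepI[where j = 3 and x = "n - 3 * h" and q = "h - 1"])
      show "(n - 3) * k = 2 * (n - 3 * h) + 2 * n * (h - 1)" by (simp add: h algebra_simps)
      show "odd n \<and> 7 * 3 \<le> n"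
        if sq: "n dvd k^2 - 1 \<or> n dvd k^2 + 1" and g: "gcd ((n - 3) div 2) n > 1"
          and gj: "gcd ((n - 3) div 2) n dvd 3"
      proof (rule ccontr)
        assume a: "\<not> ?thesis"
        have "gcd ((n - 3) div 2) n = 3" using odd_dvd_eq[OF _ _ _ gj] g by simp
        then have "3 dvd n" by (metis gcd_dvd2)
        moreover have "11 \<le> n" "n < 21" using a assms by auto
        ultimately have "n = 15" using assms(1) by presburger
        then have "k = 6" using assms(4,5) by simp
        with \<open>n = 15\<close> sq show False by simp
      qed
    qed (use assms True h in auto)
  next
    case False
    define \<delta> where "\<delta> = n - 2 * k"
    have \<delta>: "3 \<le> \<delta>" "n = 4 * h + \<delta>" "2 * \<delta> \<le> h" using assms False h by (auto simp: \<delta>_def)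
    define L where "L = (n - 3 * h) div (3 * \<delta>) + 1"
    have L: "n - 3 * h < 3 * (\<delta> * L)" "3 * (\<delta> * L) \<le> n - 3 * h + 3 * \<delta>" "1 \<le> L"
    proof -
      have "n - 3 * h = 3 * \<delta> * (L - 1) + (n - 3 * h) mod (3 * \<delta>)" by (simp add: L_def)
      moreover have "0 \<le> (n - 3 * h) mod (3 * \<delta>)" "(n - 3 * h) mod (3 * \<delta>) < 3 * \<delta>"
        using \<delta> by auto
      ultimately show "n - 3 * h < 3 * (\<delta> * L)" "3 * (\<delta> * L) \<le> n - 3 * h + 3 * \<delta>"
        by (auto simp: algebra_simps)
      show "1 \<le> L" unfolding L_def using \<delta> by (simp add: pos_imp_zdiv_nonneg_iff)
    qed
    \<comment> \<open>Since \<open>3 \<delta> L \<le> h + 4 \<delta>\<close>, lower bounds on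
      \<open>\<delta>\<close> limit \<open>L\<close>, and thereby \<open>j = 4 L - 1\<close>, in
      terms of \<open>h\<close>.\<close>
    have grow: "c * (3 * L - 4) \<le> h" if "3 \<le> L" "0 \<le> c" "c \<le> \<delta>" for c
    proof -
      have "c * (3 * L - 4) \<le> \<delta> * (3 * L - 4)" using that by (intro mult_right_mono) auto
      also have "\<dots> \<le> h" using L(2) \<delta>(2) by (simp add: algebra_simps)
      finally show ?thesis .
    qed
    show ?thesis
    proof (rule arc_stepI[where j = "4 * L - 1" and x = "h + \<delta> * L" and q = "h - L"])
      show "(n - (4 * L - 1)) * k = 2 * (h + \<delta> * L) + 2 * n * (h - L)"
        by (simp add: \<delta>_def h algebra_simps)
      show "n < 3 * (h + \<delta> * L)" "3 * (h + \<delta> * L) < 2 * n" using L assms(5) by (auto simp: \<delta>_def)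
      show "3 * (4 * L - 1) < n"
      proof (cases "L \<le> 2")
        case False
        then show ?thesis using grow[of 3] \<delta> by simp
      qed (use \<delta> in simp)
      show "odd n \<and> 7 * (4 * L - 1) \<le> n" if "n dvd k^2 - 1 \<or> n dvd k^2 + 1"
      proof
        have "n \<le> \<delta> * \<delta> + 4" using square_near[OF _ \<delta>(1) that] by (simp add: \<delta>_def)
        then have "9 * \<delta> \<le> \<delta> * \<delta> + 4" using \<delta> by simp
        \<comment> \<open>The smallness of \<open>\<delta>\<close> gives
          \<open>9 \<delta> \<le> n\<close>, while the square condition gives
          \<open>n \<le> \<delta>^2 + 4\<close>.\<close>
        have "9 \<le> \<delta>"
        proof (rule ccontr)
          assume "\<not> 9 \<le> \<delta>"
          then have "\<delta> * \<delta> \<le> 8 * \<delta>" using \<delta>(1) by (intro mult_right_mono) auto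
          with \<open>9 * \<delta> \<le> \<delta> * \<delta> + 4\<close> have "\<delta> = 3 \<or> \<delta> = 4" using \<delta>(1) by linarith
          with \<open>9 * \<delta> \<le> \<delta> * \<delta> + 4\<close> show False by auto
        qed
        show "7 * (4 * L - 1) \<le> n"
        proof (cases "L \<le> 2")
          case False
          then show ?thesis using grow[of 9] \<open>9 \<le> \<delta>\<close> \<delta> by simp
        qed (use \<delta> \<open>9 \<le> \<delta>\<close> in simp)
      qed (use assms in auto)
    qed (use L assms in auto)
  qed
qed

text \<open>The same walk in steps of \<open>\<delta>\<close>, now from
  \<open>t = (n - 1)/2\<close>, where the residue of \<open>t k\<close> is
  \<open>w = (n - k)/2\<close>, below \<open>n/3\<close> because \<open>n < 3 * k\<close>. For
  \<open>(13, 5)\<close> it would need \<open>j = 5\<close>, which violates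
  \<open>3 * j < n\<close>.\<close>

lemma arc_step_odd_odd_small:
  fixes n k :: int
  assumes "odd n" "odd k" "2 * k + 3 \<le> n" "n < 3 * k" "(n, k) \<noteq> (13, 5)"
  shows "\<exists>t. arc_step n k t"
proof -
  define \<delta> where "\<delta> = n - 2 * k"
  define w where "w = (n - k) div 2"
  have w: "2 * w = n - k" using assms(1,2) by (simp add: w_def)
  have \<delta>: "3 \<le> \<delta>" "n = 4 * w - \<delta>" "k = 2 * w - \<delta>" "\<delta> < w" using assms w by (auto simp: \<delta>_def)
  define L where "L = (n - 3 * w) div (3 * \<delta>) + 1"
  have L: "n - 3 * w < 3 * (\<delta> * L)" "3 * (\<delta> * L) \<le> n - 3 * w + 3 * \<delta>" "1 \<le> L"
  proof -
    have "n - 3 * w = 3 * \<delta> * (L - 1) + (n - 3 * w) mod (3 * \<delta>)" by (simp add: L_def)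
    moreover have "0 \<le> (n - 3 * w) mod (3 * \<delta>)" "(n - 3 * w) mod (3 * \<delta>) < 3 * \<delta>"
      using \<delta> by auto
    ultimately show "n - 3 * w < 3 * (\<delta> * L)" "3 * (\<delta> * L) \<le> n - 3 * w + 3 * \<delta>"
      by (auto simp: algebra_simps)
    show "1 \<le> L" unfolding L_def using \<delta> by (simp add: pos_imp_zdiv_nonneg_iff)
  qed
  have grow: "c * (3 * L - 2) \<le> w" if "0 \<le> c" "c \<le> \<delta>" for c
  proof -
    have "c * (3 * L - 2) \<le> \<delta> * (3 * L - 2)" using that L(3) by (intro mult_right_mono) auto
    also have "\<dots> \<le> w" using L(2) \<delta>(2) by (simp add: algebra_simps)
    finally show ?thesis .
  qed
  have L2: "4 * \<delta> \<le> w" if "2 \<le> L"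
  proof -
    have "\<delta> * 4 \<le> \<delta> * (3 * L - 2)" using that \<delta>(1) by (intro mult_left_mono) auto
    also have "\<dots> \<le> w" using grow[of \<delta>] \<delta> by simp
    finally show ?thesis by simp
  qed
  obtain k' where k': "k = 2 * k' + 1" using assms(2) by (rule oddE)
  show ?thesis
  proof (rule arc_stepI[where j = "4 * L + 1" and x = "w + \<delta> * L" and q = "k' - L"])
    have "n - k = 2 * w" using w by simp
    then have "(n - (4 * L + 1)) * k = 2 * w + (n * (k - 1) - 4 * L * k)" by (simp add: algebra_simps)
    also have "\<dots> = 2 * (w + \<delta> * L) + 2 * n * (k' - L)"
      by (simp add: \<delta>_def k' algebra_simps)
    finally show "(n - (4 * L + 1)) * k = 2 * (w + \<delta> * L) + 2 * n * (k' - L)" .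
    show "n < 3 * (w + \<delta> * L)" "3 * (w + \<delta> * L) < 2 * n" using L assms(4) by (auto simp: \<delta>_def)
    show "3 * (4 * L + 1) < n"
    proof (cases "2 \<le> L")
      case True
      then show ?thesis using grow[of 3] L2 \<delta> by simp
    next
      case False
      then have "L = 1" using L(3) by simp
      have "w \<noteq> 4" using \<delta> assms(5) by auto
      moreover have "odd \<delta>" using \<delta>(2) assms(1) by simp
      then have "\<delta> \<noteq> 4" by auto
      ultimately show ?thesis using \<open>L = 1\<close> \<delta> by simp
    qed
    show "odd n \<and> 7 * (4 * L + 1) \<le> n"
      if sq: "n dvd k^2 - 1 \<or> n dvd k^2 + 1" and g: "gcd ((n - (4 * L + 1)) div 2) n > 1"
        and gj: "gcd ((n - (4 * L + 1)) div 2) n dvd 4 * L + 1"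
    proof
      show "7 * (4 * L + 1) \<le> n"
      proof (cases "2 \<le> L")
        case True
        have "n \<le> \<delta> * \<delta> + 4" using square_near[OF _ \<delta>(1) sq] by (simp add: \<delta>_def)
        then have d: "15 * \<delta> \<le> \<delta> * \<delta> + 4" using \<delta> L2[OF True] by simp
        have "15 \<le> \<delta>"
        proof (rule ccontr)
          assume "\<not> 15 \<le> \<delta>"
          then have "\<delta> * \<delta> \<le> 14 * \<delta>" using \<delta>(1) by (intro mult_right_mono) auto
          with d have "\<delta> = 3 \<or> \<delta> = 4" using \<delta>(1) by linarith
          with d show False by auto
        qed
        then show ?thesis using grow[of 15] True L2 \<delta> by simp
      next
        case False
        then have L1: "L = 1" using L(3) by simp
        show ?thesis
        proof (rule ccontr)
          assume a: "\<not> ?thesis"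
          \<comment> \<open>Here \<open>j = 5\<close>, so a nontrivial divisor is 5 and
            \<open>n\<close> is 15 or 25. The first would force the even value \<open>k = 6\<close>;
            for 25 the squares of 9 and 11 are not 1 or -1.\<close>
          have "gcd ((n - (4 * L + 1)) div 2) n = 5" using odd_dvd_eq[of 5] gj g L1 by simp
          then have "5 dvd n" by (metis gcd_dvd2)
          moreover have "9 \<le> n" "n < 35" using a L1 \<delta> assms(1) by auto
          ultimately have "n = 15 \<or> n = 25" using assms(1) by presburger
          then show False
          proof
            assume "n = 15"
            then have "k = 6" using assms(3,4) by simp
            then show False using assms(2) by simp
          next
            assume "n = 25"
            then have "9 \<le> k" "k \<le> 11" "k \<noteq> 10" using assms(2-4) by auto
            then have "k = 9 \<or> k = 11" by presburger
            then show False using sq \<open>n = 25\<close> by auto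
          qed
        qed
      qed
    qed (use assms in auto)
  qed (use L assms in auto)
qed

section \<open>Three colours suffice in the generic case\<close>

text \<open>The range in which \<open>affine_generic\<close> or \<open>affine_3\<close> applies.
  Within \<open>2 \<le> k \<le> n/2\<close> it leaves out \<open>k = 2\<close>,
  \<open>n = 2k + 1\<close>, \<open>n = 2k + 2\<close>, \<open>(6, 3)\<close> and
  \<open>(10, 3)\<close>.\<close>

definition generic :: "int \<Rightarrow> int \<Rightarrow> bool" where
  "generic n k \<longleftrightarrow> 4 \<le> k \<and> (2 * k + 3 \<le> n \<or> n = 2 * k) \<or> k = 3 \<and> 9 \<le> n \<and> n \<noteq> 10"

lemma generic_affine:
  assumes "generic n k" and F: "caut n k F"
  shows "\<exists>u. (u = 1 \<or> u = -1 \<or> (u = k \<or> u = -k) \<and> (n dvd k^2 - 1 \<or> n dvd k^2 + 1)) \<and>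
    (\<forall>x. n dvd F x - F 0 - u * x)"
  using assms(1) unfolding generic_def
proof (elim disjE conjE)
  assume "k = 3" "9 \<le> n" "n \<noteq> 10"
  with F show ?thesis by (metis affine_3)
qed (use affine_generic[OF F] in metis)+

lemma generic_not_dvd:
  assumes "generic n k"
  shows "\<not> n dvd k - 1" "\<not> n dvd k + 1" "\<not> n dvd k"
proof -
  have "3 \<le> k" "k + 1 < n" using assms unfolding generic_def by linarith+
  then show "\<not> n dvd k - 1" "\<not> n dvd k + 1" "\<not> n dvd k" by (simp_all add: zdvd_not_zless)
qed

lemma three_colouring_arcs:
  assumes g: "generic n k" and par: "odd n \<or> even k" and n: "n \<noteq> 3 * k"
    and ne: "(n, k) \<noteq> (15, 4)" "(n, k) \<noteq> (13, 5)"
  obtains C where "ccolouring n k C" "cdist n k C" "\<And>x. C x < 3"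
proof -
  have g': "8 \<le> n" "3 \<le> k" "2 * k + 3 \<le> n \<or> n = 2 * k" "k = 3 \<or> 4 \<le> k"
    using g by (auto simp: generic_def)
  have "\<exists>t. arc_step n k t"
  proof (cases "even k")
    case True
    then have k: "4 \<le> k" using g'(4) by auto
    consider "3 * k < n" | "n < 3 * k" "even n" | "n < 3 * k" "odd n" using n by linarith
    then show ?thesis
    proof cases
      case 1 then show ?thesis using True k ne(1) by (intro arc_step_even_large) auto
    next
      case 2 then show ?thesis using True g' by (intro arc_step_even_even) auto
    next
      case 3
      then have "n \<noteq> 2 * k" by auto
      then show ?thesis using True k 3 g' by (intro arc_step_odd_even_small) auto
    qed
  next
    case False
    then have "odd n" using par by simp
    then have "n \<noteq> 2 * k" by auto
    show ?thesis
    proof (cases "3 * k < n")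
      case True then show ?thesis using False \<open>odd n\<close> g' by (intro arc_step_odd_odd_large) auto
    next
      case less: False
      then show ?thesis using False \<open>odd n\<close> n g' \<open>n \<noteq> 2 * k\<close> ne(2) by (intro arc_step_odd_odd_small) auto
    qed
  qed
  then obtain t where "arc_step n k t" ..
  then show ?thesis
    using arc_colouring[of n t k] generic_affine[OF g] generic_not_dvd[OF g] that
    unfolding arc_step_def by blast
qed

text \<open>The bipartition is disturbed by giving colour 2 to an independent set \<open>E\<close>.
  The vertex \<open>p\<close> outside \<open>E\<close> shows that a colour-preserving affine map
  respects parity, so only the symmetries of \<open>E\<close> with even translation part
  \<open>f\<close> have to be excluded.\<close>

lemma parity_colouring:
  assumes n: "even n" "odd k"
    and E: "\<And>x y. n dvd x - y \<Longrightarrow> E x \<longleftrightarrow> E y"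
      "\<And>x. E x \<Longrightarrow> \<not> E (x + 1) \<and> \<not> E (x + k)" and p: "\<not> E p"
    and aff: "\<And>F. caut n k F \<Longrightarrow> \<exists>u. (u = 1 \<or> u = -1 \<or>
        (u = k \<or> u = -k) \<and> (n dvd k^2 - 1 \<or> n dvd k^2 + 1)) \<and> (\<forall>x. n dvd F x - F 0 - u * x)"
    and rigid: "\<And>f u. even f \<Longrightarrow> odd u \<Longrightarrow> u = 1 \<or> u = -1 \<or> (u = k \<or> u = -k) \<and> (n dvd k^2 - 1 \<or> n dvd k^2 + 1)
      \<Longrightarrow> (\<And>x. E (f + u * x) \<longleftrightarrow> E x) \<Longrightarrow> n dvd f \<and> n dvd u - 1"
  obtains C where "ccolouring n k C" "cdist n k C" "\<And>x. C x < 3"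
proof -
  define C :: "int \<Rightarrow> nat" where "C x = (if E x then 2 else if even x then 0 else 1)" for x
  have par: "even x \<longleftrightarrow> even y" if "n dvd x - y" for x y
  proof -
    have "even (x - y)" using n(1) that by (rule dvd_trans)
    then show ?thesis by simp
  qed
  have "ccolouring n k C"
    using E n(2) par by (auto simp: ccolouring_def C_def)
  moreover have "cdist n k C"
    unfolding cdist_def
  proof (intro allI impI)
    fix F x assume F: "caut n k F" and CF: "\<forall>x. C (F x) = C x"
    obtain u where u: "u = 1 \<or> u = -1 \<or> (u = k \<or> u = -k) \<and> (n dvd k^2 - 1 \<or> n dvd k^2 + 1)"
      and "\<And>x. n dvd F x - F 0 - u * x" using aff[OF F] by blast
    then have Fu: "n dvd F x - (F 0 + u * x)" for x by (simp add: diff_diff_eq)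
    have EF: "E (F x) \<longleftrightarrow> E x" for x using CF[rule_format, of x] by (auto simp: C_def split: if_splits)
    have "odd u" using u n(2) by auto
    have "even (F p) \<longleftrightarrow> even p"
      using CF[rule_format, of p] p EF[of p] by (auto simp: C_def split: if_splits)
    then have "even (F 0)" using par[OF Fu[of p]] \<open>odd u\<close> by auto
    moreover have "E (F 0 + u * x) \<longleftrightarrow> E x" for x using EF E(1)[OF Fu[of x]] by simp
    ultimately have "n dvd F 0" "n dvd u - 1" using rigid[OF _ \<open>odd u\<close> u] by blast+
    then have "n dvd F x - (F 0 + u * x) + (F 0 + (u - 1) * x)"
      by (intro dvd_add[OF Fu]) simp
    then show "n dvd F x - x" by (simp add: algebra_simps)
  qed
  moreover have "C x < 3" for x by (simp add: C_def)
  ultimately show ?thesis using that by blast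
qed

text \<open>Each choice of \<open>E\<close> has exactly one odd element (5 or 3), which is fixed
  because \<open>f\<close> is even. For \<open>k = 3\<close> and \<open>k = 5\<close> the other
  element 0 is then fixed too. For larger \<open>k\<close> the relation \<open>5 (u - 1) = 0\<close>
  would leave multipliers open when 5 divides \<open>n\<close>; the additional element 2 removes
  them.\<close>

lemma three_colouring_bipartite:
  assumes g: "generic n k" and n: "even n" "odd k"
  obtains C where "ccolouring n k C" "cdist n k C" "\<And>x. C x < 3"
proof -
  have no: "\<not> n dvd c" if "0 < \<bar>c\<bar>" "\<bar>c\<bar> < n" for c using dvd_small[of c n] that by auto
  have sep: "\<not> n dvd x + b" if "n dvd x - a" "0 < \<bar>a + b\<bar>" "\<bar>a + b\<bar> < n" for a b x
    using dvd_diff[of n "x + b" "x - a"] that no[of "a + b"] by (auto simp: algebra_simps)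
  have odd_no: "\<not> n dvd c" if "odd c" for c using that n(1) dvd_trans by blast
  have per: "n dvd x - y \<Longrightarrow> n dvd x - a \<longleftrightarrow> n dvd y - a" for x y a
    using dvd_diff_trans[of n x y a] dvd_diff_trans[of n y x a] dvd_diff_sym[of n x y] by blast
  have k: "k = 3 \<or> k = 5 \<or> 7 \<le> k" using g n(2) unfolding generic_def by presburger
  then consider "k = 3" | "k = 5" | "7 \<le> k" by blast
  then show ?thesis
  proof cases
    case 1
    then have n12: "12 \<le> n" using g n(1) unfolding generic_def by presburger
    show ?thesis
    proof (rule parity_colouring[of n k "\<lambda>x. n dvd x \<or> n dvd x - 5" 1])
      show "(n dvd x \<or> n dvd x - 5) \<longleftrightarrow> (n dvd y \<or> n dvd y - 5)" if "n dvd x - y" for x y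
        using per[OF that, of 0] per[OF that, of 5] by simp
      show "\<not> (n dvd x + 1 \<or> n dvd x + 1 - 5) \<and> \<not> (n dvd x + k \<or> n dvd x + k - 5)"
        if "n dvd x \<or> n dvd x - 5" for x
        using that
      proof
        assume "n dvd x"
        then have "n dvd x - 0" by simp
        from sep[OF this, of 1] sep[OF this, of "1 - 5"] sep[OF this, of k] sep[OF this, of "k - 5"]
        show ?thesis using n12 1 by (auto simp: algebra_simps)
      next
        assume "n dvd x - 5"
        from sep[OF this, of 1] sep[OF this, of "1 - 5"] sep[OF this, of k] sep[OF this, of "k - 5"]
        show ?thesis using n12 1 by (auto simp: algebra_simps)
      qed
      show "\<not> (n dvd 1 \<or> n dvd 1 - 5)" using no[of 1] no[of "-4"] n12 by auto
      show "n dvd f \<and> n dvd u - 1" if f: "even f" and "odd u" and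
        u: "u = 1 \<or> u = -1 \<or> (u = k \<or> u = -k) \<and> (n dvd k^2 - 1 \<or> n dvd k^2 + 1)"
        and E: "\<And>x. (n dvd f + u * x \<or> n dvd f + u * x - 5) = (n dvd x \<or> n dvd x - 5)" for f u
      proof -
        have "n dvd f" using E[of 0] odd_no[of "f - 5"] f by auto
        have "n dvd f + u * 5 - 5" using E[of 5] odd_no[of "f + u * 5"] f \<open>odd u\<close> by auto
        from dvd_diff[OF this \<open>n dvd f\<close>] have "n dvd u * 5 - 5" by simp
        then show ?thesis using u \<open>n dvd f\<close> no[of 8] no[of 10] no[of "-10"] n12 1 by auto
      qed
    qed (use n generic_affine[OF g] that in blast)+
  next
    case 2
    then have n10: "n = 10 \<or> 14 \<le> n" using g n(1) unfolding generic_def by presburger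
    show ?thesis
    proof (rule parity_colouring[of n k "\<lambda>x. n dvd x \<or> n dvd x - 3" 1])
      show "(n dvd x \<or> n dvd x - 3) \<longleftrightarrow> (n dvd y \<or> n dvd y - 3)" if "n dvd x - y" for x y
        using per[OF that, of 0] per[OF that, of 3] by simp
      show "\<not> (n dvd x + 1 \<or> n dvd x + 1 - 3) \<and> \<not> (n dvd x + k \<or> n dvd x + k - 3)"
        if "n dvd x \<or> n dvd x - 3" for x
        using that
      proof
        assume "n dvd x"
        then have "n dvd x - 0" by simp
        from sep[OF this, of 1] sep[OF this, of "1 - 3"] sep[OF this, of k] sep[OF this, of "k - 3"]
        show ?thesis using n10 2 by (auto simp: algebra_simps)
      next
        assume "n dvd x - 3"
        from sep[OF this, of 1] sep[OF this, of "1 - 3"] sep[OF this, of k] sep[OF this, of "k - 3"]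
        show ?thesis using n10 2 by (auto simp: algebra_simps)
      qed
      show "\<not> (n dvd 1 \<or> n dvd 1 - 3)" using no[of 1] no[of "-2"] n10 by auto
      show "n dvd f \<and> n dvd u - 1" if f: "even f" and "odd u" and
        u: "u = 1 \<or> u = -1 \<or> (u = k \<or> u = -k) \<and> (n dvd k^2 - 1 \<or> n dvd k^2 + 1)"
        and E: "\<And>x. (n dvd f + u * x \<or> n dvd f + u * x - 3) = (n dvd x \<or> n dvd x - 3)" for f u
      proof -
        have "n dvd f" using E[of 0] odd_no[of "f - 3"] f by auto
        have "n dvd f + u * 3 - 3" using E[of 3] odd_no[of "f + u * 3"] f \<open>odd u\<close> by auto
        from dvd_diff[OF this \<open>n dvd f\<close>] have u3: "n dvd u * 3 - 3" by simp
        have "\<not> n dvd 6" using no[of 6] n10 by auto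
        moreover have False if "u = k \<or> u = - k" and d: "n dvd k^2 - 1 \<or> n dvd k^2 + 1"
        proof -
          have "n dvd 12 \<or> n dvd 18" using u3 that(1) dvd_minus_iff[of n 18] 2 by auto
          moreover have "n dvd 24 \<or> n dvd 26" using d 2 by simp
          ultimately have "n dvd 24 - 12 \<or> n dvd 26 - 2 * 12 \<or> n dvd 24 - 18 \<or> n dvd 26 - 18"
            by (metis dvd_diff dvd_mult)
          then show False using no[of 2] no[of 6] no[of 8] n10 \<open>n dvd 12 \<or> n dvd 18\<close> zdvd_imp_le[of n 12] by auto
        qed
        ultimately show ?thesis using u \<open>n dvd f\<close> u3 dvd_minus_iff[of n 6] by auto
      qed
    qed (use n generic_affine[OF g] that in blast)+
  next
    case 3
    then have n14: "14 \<le> n" "k + 7 \<le> n" "2 * k \<le> n" using g by (auto simp: generic_def)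
    show ?thesis
    proof (rule parity_colouring[of n k "\<lambda>x. n dvd x \<or> n dvd x - 2 \<or> n dvd x - 5" 1])
      show "(n dvd x \<or> n dvd x - 2 \<or> n dvd x - 5) \<longleftrightarrow> (n dvd y \<or> n dvd y - 2 \<or> n dvd y - 5)"
        if "n dvd x - y" for x y
        using per[OF that, of 0] per[OF that, of 2] per[OF that, of 5] by simp
      show "\<not> (n dvd x + 1 \<or> n dvd x + 1 - 2 \<or> n dvd x + 1 - 5) \<and>
          \<not> (n dvd x + k \<or> n dvd x + k - 2 \<or> n dvd x + k - 5)"
        if "n dvd x \<or> n dvd x - 2 \<or> n dvd x - 5" for x
      proof -
        from that show ?thesis
        proof (elim disjE)
          assume "n dvd x"
          then have "n dvd x - 0" by simp
          from sep[OF this, of 1] sep[OF this, of "-1"] sep[OF this, of "-4"] sep[OF this, of k]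
            sep[OF this, of "k - 2"] sep[OF this, of "k - 5"]
          show ?thesis using n14 3 by (simp add: algebra_simps)
        next
          assume "n dvd x - 2"
          from sep[OF this, of 1] sep[OF this, of "-1"] sep[OF this, of "-4"] sep[OF this, of k]
            sep[OF this, of "k - 2"] sep[OF this, of "k - 5"]
          show ?thesis using n14 3 by (simp add: algebra_simps)
        next
          assume "n dvd x - 5"
          from sep[OF this, of 1] sep[OF this, of "-1"] sep[OF this, of "-4"] sep[OF this, of k]
            sep[OF this, of "k - 2"] sep[OF this, of "k - 5"]
          show ?thesis using n14 3 by (simp add: algebra_simps)
        qed
      qed
      show "\<not> (n dvd 1 \<or> n dvd 1 - 2 \<or> n dvd 1 - 5)"
        using no[of 1] no[of "-1"] no[of "-4"] n14 by auto
      show "n dvd f \<and> n dvd u - 1" if f: "even f" and "odd u" and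
        u: "u = 1 \<or> u = -1 \<or> (u = k \<or> u = -k) \<and> (n dvd k^2 - 1 \<or> n dvd k^2 + 1)"
        and E: "\<And>x. (n dvd f + u * x \<or> n dvd f + u * x - 2 \<or> n dvd f + u * x - 5) =
            (n dvd x \<or> n dvd x - 2 \<or> n dvd x - 5)" for f u
      proof -
        have f02: "n dvd f \<or> n dvd f - 2" using E[of 0] odd_no[of "f - 5"] f by auto
        have f5: "n dvd f + u * 5 - 5"
          using E[of 5] odd_no[of "f + u * 5"] odd_no[of "f + u * 5 - 2"] f \<open>odd u\<close> by auto
        have f2: "n dvd f + u * 2 \<or> n dvd f + u * 2 - 2"
          using E[of 2] odd_no[of "f + u * 2 - 5"] f by auto
        \<comment> \<open>Combining \<open>5 u\<close> and \<open>2 u\<close> as 5 - 2 * 2 = 1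
          isolates \<open>u\<close>.\<close>
        have key: "n dvd u - (5 - 2 * b + a)" if "n dvd f - a" "n dvd f + u * 2 - b" for a b
          using dvd_add[OF dvd_diff[OF f5 dvd_mult[OF that(2), of 2]] that(1)] by (simp add: algebra_simps)
        have two: "n dvd 2 * (5 - 2 * b + a) - (b - a)"
          if "n dvd f - a" "n dvd f + u * 2 - b" for a b
          using dvd_diff[OF dvd_diff[OF that(2,1)] dvd_mult[OF key[OF that], of 2]] by (simp add: algebra_simps)
        from f02 f2 consider "n dvd f - 0" "n dvd f + u * 2 - 0" | "n dvd f - 0" "n dvd f + u * 2 - 2"
          | "n dvd f - 2" "n dvd f + u * 2 - 0" | "n dvd f - 2" "n dvd f + u * 2 - 2" by auto
        then show ?thesis
        proof cases
          case 1 from two[OF this] no[of 10] n14 show ?thesis by auto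
        next
          case 2 from key[OF this] 2 show ?thesis by auto
        next
          \<comment> \<open>The map that exchanges 0 and 2. It leaves only \<open>n = 16\<close> and
            \<open>k = 7\<close>, which is excluded from \<open>generic\<close> as
            \<open>n = 2k + 2\<close>.\<close>
          case c: 3
          from two[OF this] have d16: "n dvd 16" by simp
          then have "n \<le> 16" by (rule zdvd_imp_le) simp
          then have "n = 14 \<or> n = 15 \<or> n = 16" using n14 by auto
          then have "n = 16" using d16 by auto
          then have "k = 7" using 3 n14 n(2) by presburger
          then have False using g \<open>n = 16\<close> by (auto simp: generic_def)
          then show ?thesis ..
        next
          case 4 from two[OF this] no[of 6] n14 show ?thesis by auto
        qed
      qed
    qed (use n generic_affine[OF g] that in blast)+
  qed
qed

text \<open>The vertices form three blocks of length \<open>k\<close>; in block \<open>q\<close> the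
  colours alternate between \<open>q\<close> and \<open>q - 1\<close> modulo 3, starting with
  \<open>q\<close>. Adding \<open>k\<close> raises the colour by one. The irregularity at the block
  boundaries locates them, which pins down translations.\<close>

lemma three_colouring_third:
  fixes n k :: int
  assumes g: "generic n k" and n: "n = 3 * k"
  obtains C where "ccolouring n k C" "cdist n k C" "\<And>x. C x < 3"
proof -
  have k: "3 \<le> k" using g by (auto simp: generic_def)
  define c where "c x = x div k - (if even (x mod k) then 0 else 1)" for x
  define C where "C x = nat (c x mod 3)" for x
  have Ceq: "C x = C y \<longleftrightarrow> 3 dvd c x - c y" for x y
    by (simp add: C_def mod_eq_dvd_iff[symmetric] nat_eq_iff)
  have cv: "c (k * q + j) = q - (if even j then 0 else 1)" if "0 \<le> j" "j < k" for q j
    using that by (simp add: c_def)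
  have cs: "c (k * q + j + a) = q - (if even (j + a) then 0 else 1)" if "0 \<le> j + a" "j + a < k" for q j a
    using cv[OF that] by (simp add: add.assoc)
  have cw: "c (k * q + j + a) = q + 1 - (if even b then 0 else 1)" if "j + a = k + b" "0 \<le> b" "b < k" for q j a b
  proof -
    have "k * q + j + a = k * (q + 1) + b" using that(1) by (simp add: algebra_simps)
    then show ?thesis using cv[OF that(2,3), of "q + 1"] by simp
  qed
  have dec: "\<exists>q j. x = k * q + j \<and> 0 \<le> j \<and> j < k" for x
    using k by (intro exI[of _ "x div k"] exI[of _ "x mod k"]) auto
  have per: "C x = C y" if "n dvd x - y" for x y
  proof -
    obtain i where "x - y = n * i" using \<open>n dvd x - y\<close> unfolding dvd_def by blast
    then have x: "x = k * (3 * i) + y" by (simp add: n algebra_simps)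
    have "(k * (3 * i) + y) div k = 3 * i + y div k" "(k * (3 * i) + y) mod k = y mod k" using k by simp_all
    then show ?thesis unfolding Ceq x c_def by simp
  qed
  have "ccolouring n k C"
    unfolding ccolouring_def
  proof (intro conjI allI impI)
    fix x
    obtain q j where x: "x = k * q + j" "0 \<le> j" "j < k" using dec by blast
    show "C x \<noteq> C (x + 1)"
    proof (cases "j + 1 < k")
      case True
      then have "c (x + 1) = q - (if even (j + 1) then 0 else 1)"
        using cs[of j 1 q] x by simp
      then show ?thesis unfolding Ceq using cv[of j q] x by auto
    next
      case False
      then have "c (x + 1) = q + 1" using cw[of j 1 0 q] x k by simp
      then show ?thesis unfolding Ceq using cv[of j q] x by auto
    qed
    have "c (x + k) = q + 1 - (if even j then 0 else 1)"
      using cw[of j k j q] x by simp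
    then show "C x \<noteq> C (x + k)" unfolding Ceq using cv[of j q] x by auto
  qed (use per in blast)
  moreover have "cdist n k C"
    unfolding cdist_def
  proof (intro allI impI)
    fix F x assume F: "caut n k F" and CF: "\<forall>x. C (F x) = C x"
    \<comment> \<open>\<open>k\<close> divides \<open>n\<close> but neither \<open>k^2 - 1\<close>
      nor \<open>k^2 + 1\<close>, so only the multipliers 1 and -1 survive.\<close>
    have sq: "\<not> (n dvd k^2 - 1 \<or> n dvd k^2 + 1)"
    proof
      assume sq: "n dvd k^2 - 1 \<or> n dvd k^2 + 1"
      have kn: "k dvd n" unfolding n by (rule dvd_triv_right)
      from sq have "k dvd k * k - 1 \<or> k dvd k * k + 1"
        unfolding power2_eq_square by (elim disjE) (blast dest: dvd_trans[OF kn])+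
      then have "k dvd 1" using dvd_diff_right_iff[of k "k * k" 1] dvd_add_right_iff[of k "k * k" 1] by auto
      then show False using k by simp
    qed
    obtain u where u: "u = 1 \<or> u = -1" and Fu: "\<And>x. n dvd F x - F 0 - u * x"
      using generic_affine[OF g F] sq by blast
    define A where "A = F 0"
    have CA: "C (A + u * x) = C x" for x
      using CF per[of "F x" "A + u * x"] Fu[of x] by (simp add: A_def diff_diff_eq)
    have c0: "c (k - 2) = (if even k then 0 else -1)" "c (k - 1) = (if even k then -1 else 0)"
      "c k = 1" "c (k + 1) = 0"
      using cv[of "k - 2" 0] cv[of "k - 1" 0] cv[of 0 1] cv[of 1 1] k by auto
    have kA: "n dvd A" if "u = 1" "\<And>q j. A + k - 2 = k * q + j \<Longrightarrow> 0 \<le> j \<Longrightarrow> j < k \<Longrightarrow> j = k - 2"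
    proof -
      obtain q j where q: "A + k - 2 = k * q + j" "0 \<le> j" "j < k" using dec by blast
      with that have "A = k * q" by fastforce
      moreover have "3 dvd c A - c 0" using CA[of 0] by (simp add: Ceq)
      ultimately have "3 dvd q" using cv[of 0 q] cv[of 0 0] k by simp
      then show ?thesis using \<open>A = k * q\<close> by (auto simp: n)
    qed
    have "u = 1 \<and> n dvd A"
    proof (cases "even k")
      case True
      \<comment> \<open>For even \<open>k\<close>, a shift by 3 preserves the colour only from the
        second last position of a block; inside a block it flips the parity.\<close>
      have special: "j = k - 2" if "C (k * q + j + 3) = C (k * q + j)" "0 \<le> j" "j < k" for q j
      proof (rule ccontr)
        assume "j \<noteq> k - 2"
        then have "j + 3 < k \<or> j = k - 3 \<or> j = k - 1" using that by arith
        then show False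
        proof (elim disjE)
          assume "j + 3 < k"
          then show False using that cs[of j 3 q] cv[of j q] by (auto simp: Ceq split: if_splits)
        next
          assume "j = k - 3"
          then show False using that cw[of j 3 0 q] cv[of j q] k True by (auto simp: Ceq)
        next
          assume "j = k - 1"
          then show False using that cw[of j 3 2 q] cv[of j q] k True by (auto simp: Ceq)
        qed
      qed
      have e: "C (k + 1) = C (k - 2)" using c0 True by (simp add: Ceq)
      show ?thesis
        using u
      proof
        assume u1: "u = 1"
        have "C (A + k - 2 + 3) = C (A + k - 2)"
          using CA[of "k + 1"] CA[of "k - 2"] e u1 by (simp add: algebra_simps)
        then show ?thesis using kA u1 special by metis
      next
        \<comment> \<open>A reflection matches the boundary pattern, but the step to the next vertex
          then lowers the colour by one where it should raise it.\<close>
        assume u1: "u = -1"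
        obtain q j where q: "A - (k + 1) = k * q + j" "0 \<le> j" "j < k" using dec by blast
        have C3: "C (A - (k + 1)) = C (k + 1)" "C (A - (k + 1) + 3) = C (k - 2)" "C (A - (k + 1) + 1) = C k"
          using CA[of "k + 1"] CA[of "k - 2"] CA[of k] u1 by (simp_all add: algebra_simps)
        then have "j = k - 2" using special[of q j] q e by simp
        then have "c (A - (k + 1)) = q" "c (A - (k + 1) + 1) = q - 1"
          unfolding q(1) using \<open>j = k - 2\<close> cv[of j q] cs[of j 1 q] q(2,3) True k by simp_all
        then have False using C3 c0 by (simp add: Ceq) presburger
        then show ?thesis ..
      qed
    next
      case False
      \<comment> \<open>For odd \<open>k\<close>, a shift by 2 changes the colour only from the
        second last position of a block.\<close>
      have special: "j = k - 2" if "C (k * q + j + 2) \<noteq> C (k * q + j)" "0 \<le> j" "j < k" for q j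
      proof (rule ccontr)
        assume "j \<noteq> k - 2"
        then have "j + 2 < k \<or> j = k - 1" using that by arith
        then show False
        proof
          assume "j + 2 < k"
          then show False using that cs[of j 2 q] cv[of j q] by (auto simp: Ceq split: if_splits)
        next
          assume "j = k - 1"
          then show False using that cw[of j 2 1 q] cv[of j q] k False by (auto simp: Ceq)
        qed
      qed
      have e: "C k \<noteq> C (k - 2)" using c0 False by (simp add: Ceq)
      show ?thesis
        using u
      proof
        assume u1: "u = 1"
        have "C (A + k - 2 + 2) \<noteq> C (A + k - 2)"
          using CA[of k] CA[of "k - 2"] e u1 by (simp add: algebra_simps)
        then show ?thesis using kA u1 special by metis
      next
        assume u1: "u = -1"
        obtain q j where q: "A - k = k * q + j" "0 \<le> j" "j < k" using dec by blast
        have C3: "C (A - k) = C k" "C (A - k + 2) = C (k - 2)" "C (A - k + 1) = C (k - 1)"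
          using CA[of "k - 1"] CA[of "k - 2"] CA[of k] u1 by (simp_all add: algebra_simps)
        then have "j = k - 2" using special[of q j] q e by simp
        then have "c (A - k) = q - 1" "c (A - k + 1) = q"
          unfolding q(1) using \<open>j = k - 2\<close> cv[of j q] cs[of j 1 q] q(2,3) False k by simp_all
        then have False using C3 c0 False by (simp add: Ceq) presburger
        then show ?thesis ..
      qed
    qed
    then have "n dvd F x - F 0 - u * x + A" using Fu[of x] by simp
    then show "n dvd F x - x" using \<open>u = 1 \<and> n dvd A\<close> by (simp add: A_def)
  qed
  moreover have "C x < 3" for x by (simp add: C_def nat_less_iff)
  ultimately show ?thesis using that by blast
qed

section \<open>Four colours for \<open>k = 2\<close>\<close>

text \<open>The word 012012... is closed up by a final 3. If \<open>n mod 3 = 2\<close>, vertex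
  \<open>n - 2\<close> would get colour 0 like vertex \<open>n\<close>, so the word ends in 3 1 2 3
  instead. The vertices of colour 3 leave few affine maps, and the colours next to them exclude all
  but the identity.\<close>

lemma four_colouring_2:
  fixes n :: int
  assumes n: "7 \<le> n"
  obtains C where "ccolouring n 2 C" "cdist n 2 C" "\<And>x. C x < 4"
proof -
  define w :: "int \<Rightarrow> nat" where "w y = (if n mod 3 \<noteq> 2 then (if y = n - 1 then 3 else nat (y mod 3))
    else (if y = n - 1 \<or> y = n - 4 then 3 else if y = n - 3 then 1 else if y = n - 2 then 2 else nat (y mod 3)))" for y
  define C where "C x = w (x mod n)" for x
  have r: "0 \<le> x mod n" "x mod n < n" for x using n by auto
  have per: "C x = C y" if "n dvd x - y" for x y
    using that by (simp add: C_def mod_eq_dvd_iff[symmetric])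
  have Cw: "C x = w x" if "0 \<le> x" "x < n" for x using that by (simp add: C_def)
  have Cwrap: "C x = C (x - n)" for x by (rule per) simp
  have m3: "nat ((y + 1) mod 3) \<noteq> nat (y mod 3)" "nat ((y + 2) mod 3) \<noteq> nat (y mod 3)"
    "nat (y mod 3) < 3" for y :: int
  proof -
    have "(y + 1) mod 3 \<noteq> y mod 3" "(y + 2) mod 3 \<noteq> y mod 3" by presburger+
    then show "nat ((y + 1) mod 3) \<noteq> nat (y mod 3)" "nat ((y + 2) mod 3) \<noteq> nat (y mod 3)"
      by (simp_all add: eq_nat_nat_iff)
  qed (simp add: nat_less_iff)
  have w01: "w 0 = 0" "w 1 = 1" "w 2 = 2" using n by (auto simp: w_def)
  have wg: "w z = nat (z mod 3)" if "z < n - 4 \<or> n mod 3 \<noteq> 2 \<and> z < n - 1" for z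
    using that by (auto simp: w_def)
  have w3: "w z < 3" if "z < n - 4 \<or> n mod 3 \<noteq> 2 \<and> z < n - 1" for z
    using wg[OF that] m3(3) by simp
  have wtop: "w (n - 1) = 3" by (simp add: w_def)
  have wend: "w (n - 6) = 2" "w (n - 5) = 0" "w (n - 4) = 3" "w (n - 3) = 1" "w (n - 2) = 2"
    if "n mod 3 = 2"
  proof -
    have "(n - 6) mod 3 = 2" "(n - 5) mod 3 = 0" using that by presburger+
    then show "w (n - 6) = 2" "w (n - 5) = 0" by (simp_all add: wg)
  qed (use that in \<open>simp_all add: w_def\<close>)
  have "ccolouring n 2 C"
    unfolding ccolouring_def
  proof (intro conjI allI impI)
    fix x
    define y where "y = x mod n"
    have y: "0 \<le> y" "y < n" using r by (auto simp: y_def)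
    have Cy: "C (x + a) = C (y + a)" for a
      by (rule per) (simp add: y_def mod_dvd_diff)
    have Ctop: "C (n - 1) = 3" using Cw[of "n - 1"] wtop n by simp
    have Clow: "C n = 0" "C (n + 1) = 1"
      using Cwrap[of n] Cwrap[of "n + 1"] Cw[of 0] Cw[of 1] w01 n by simp_all
    have Cnext: "C (n - 2) \<noteq> 0"
    proof (cases "n mod 3 = 2")
      case False
      then have "(n - 2) mod 3 \<noteq> 0" by presburger
      moreover have "0 \<le> (n - 2) mod 3" by simp
      ultimately have "nat ((n - 2) mod 3) \<noteq> 0" by linarith
      then show ?thesis using Cw[of "n - 2"] wg[of "n - 2"] False n by simp
    qed (use Cw[of "n - 2"] wend n in simp)
    have "C y \<noteq> C (y + 1)"
    proof (cases "y + 1 < n")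
      case True
      then have "C y = w y" "C (y + 1) = w (y + 1)" using y by (auto intro: Cw)
      moreover have "w y \<noteq> w (y + 1)"
      proof (cases "y + 1 < n - 4 \<or> n mod 3 \<noteq> 2 \<and> y + 1 < n - 1")
        case True
        then have "w y = nat (y mod 3)" "w (y + 1) = nat ((y + 1) mod 3)" by (intro wg; linarith)+
        then show ?thesis using m3(1)[of y] by metis
      next
        case False
        then have "n mod 3 \<noteq> 2 \<and> y + 1 = n - 1 \<or>
            n mod 3 = 2 \<and> (y = n - 5 \<or> y = n - 4 \<or> y = n - 3 \<or> y = n - 2)"
          using \<open>y + 1 < n\<close> by arith
        then show ?thesis
        proof
          assume e: "n mod 3 \<noteq> 2 \<and> y + 1 = n - 1"
          then have "w (y + 1) = 3" using wtop by metis
          moreover have "w y < 3" using e by (intro w3) simp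
          ultimately show ?thesis by (metis less_irrefl)
        qed (use wtop wend in auto)
      qed
      ultimately show ?thesis by simp
    next
      case False
      then have "y = n - 1" using y by simp
      then show ?thesis using Ctop Clow by simp
    qed
    then show "C x \<noteq> C (x + 1)" using Cy[of 0] Cy[of 1] by simp
    have "C y \<noteq> C (y + 2)"
    proof (cases "y + 2 < n")
      case True
      then have "C y = w y" "C (y + 2) = w (y + 2)" using y by (auto intro: Cw)
      moreover have "w y \<noteq> w (y + 2)"
      proof (cases "y + 2 < n - 4 \<or> n mod 3 \<noteq> 2 \<and> y + 2 < n - 1")
        case True
        then have "w y = nat (y mod 3)" "w (y + 2) = nat ((y + 2) mod 3)" by (intro wg; linarith)+
        then show ?thesis using m3(2)[of y] by metis
      next
        case False
        then have "n mod 3 \<noteq> 2 \<and> y + 2 = n - 1 \<or>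
            n mod 3 = 2 \<and> (y = n - 6 \<or> y = n - 5 \<or> y = n - 4 \<or> y = n - 3)"
          using \<open>y + 2 < n\<close> by arith
        then show ?thesis
        proof
          assume e: "n mod 3 \<noteq> 2 \<and> y + 2 = n - 1"
          then have "w (y + 2) = 3" using wtop by metis
          moreover have "w y < 3" using e by (intro w3) simp
          ultimately show ?thesis by (metis less_irrefl)
        qed (use wtop wend in auto)
      qed
      ultimately show ?thesis by simp
    next
      case False
      then have "y = n - 1 \<or> y = n - 2" using y by auto
      then show ?thesis
      proof
        assume "y = n - 1"
        then show ?thesis using Ctop Clow by (simp add: add.commute)
      next
        assume "y = n - 2"
        then show ?thesis using Clow Cnext by simp
      qed
    qed
    then show "C x \<noteq> C (x + 2)" using Cy[of 0] Cy[of 2] by simp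
  qed (use per in blast)
  moreover have "cdist n 2 C"
    unfolding cdist_def
  proof (intro allI impI)
    fix F x assume F: "caut n 2 F" and CF: "\<forall>x. C (F x) = C x"
    obtain u where u: "u = 1 \<or> u = -1" and Fu: "\<And>x. n dvd F x - F 0 - u * x"
      using affine_2[OF F n] by metis
    define a where "a = F 0 mod n"
    have a: "0 \<le> a" "a < n" "n dvd F 0 - a" using r by (auto simp: a_def mod_dvd_diff)
    have CA: "C (a + u * x) = C x" for x
    proof -
      have "n dvd (F x - F 0 - u * x) + (F 0 - a)" using Fu a by (intro dvd_add)
      then show ?thesis using CF per[of "F x" "a + u * x"] by (simp add: algebra_simps)
    qed
    have neg: "C (- e) = w (n - e)" if "0 < e" "e \<le> n" for e
      using Cwrap[of "n - e"] Cw[of "n - e"] that by simp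
    have "u = 1 \<and> a = 0"
    proof (cases "n mod 3 = 2")
      case True
      have n8: "8 \<le> n" using n True by presburger
      have w3: "y = n - 1 \<or> y = n - 4" if "w y = 3" for y using that True m3(3)[of y] by (auto simp: w_def split: if_splits)
      have wn: "w (n - 1) = 3" "w (n - 4) = 3" "w (n - 3) = 1" "w (n - 2) = 2" using True by (auto simp: w_def)
      from u show ?thesis
      proof
        assume u1: "u = 1"
        have "a = 0 \<or> a = n - 3"
        proof (cases "a = 0")
          case False
          then have "w (a - 1) = 3" using CA[of "-1"] neg[of 1] wn n Cw[of "a - 1"] a u1 by simp
          then show ?thesis using w3 a by fastforce
        qed simp
        moreover have "a \<noteq> n - 3"
        proof
          assume "a = n - 3"
          then have "w (n - 7) = 3" using CA[of "-4"] neg[of 4] wn n n8 Cw[of "n - 7"] u1 by simp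
          then show False using w3 by fastforce
        qed
        ultimately show ?thesis using u1 by simp
      next
        assume u1: "u = -1"
        have "a = n - 2 \<or> a = n - 5"
        proof (cases "a = n - 1")
          case False
          then have "w (a + 1) = 3" using CA[of "-1"] neg[of 1] wn n Cw[of "a + 1"] a u1 by simp
          then show ?thesis using w3 by fastforce
        next
          case a1: True
          then have "w 0 = 3" using CA[of "-1"] neg[of 1] wn n Cwrap[of n] Cw[of 0] u1 by simp
          then show ?thesis using w01 by simp
        qed
        then show ?thesis
        proof
          assume "a = n - 2"
          have "C (n + 2) = C (- 4)" using CA[of "-4"] unfolding \<open>a = n - 2\<close> u1 by (simp add: add.commute)
          then have "w 2 = 3" using neg[of 4] wn n Cwrap[of "n + 2"] Cw[of 2] by simp
          then show ?thesis using w01 by simp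
        next
          assume "a = n - 5"
          then show ?thesis using CA[of "-2"] neg[of 2] wn n Cw[of "n - 3"] u1 by simp
        qed
      qed
    next
      case False
      have w3: "y = n - 1" if "w y = 3" for y using that False m3(3)[of y] by (auto simp: w_def split: if_splits)
      have wn: "w (n - 1) = 3" "w (n - 2) \<noteq> 0" using False by (auto simp: w_def) presburger
      from u show ?thesis
      proof
        assume u1: "u = 1"
        have "a = 0"
        proof (rule ccontr)
          assume "a \<noteq> 0"
          then have "w (a - 1) = 3" using CA[of "-1"] neg[of 1] wn n Cw[of "a - 1"] a u1 by simp
          then show False using w3 a by fastforce
        qed
        then show ?thesis using u1 by simp
      next
        assume u1: "u = -1"
        have "a = n - 2"
        proof (cases "a = n - 1")
          case False
          then have "w (a + 1) = 3" using CA[of "-1"] neg[of 1] wn n Cw[of "a + 1"] a u1 by simp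
          then show ?thesis using w3 by fastforce
        next
          case a1: True
          then have "w 0 = 3" using CA[of "-1"] neg[of 1] wn n Cwrap[of n] Cw[of 0] u1 by simp
          then show ?thesis using w01 by simp
        qed
        then show ?thesis using CA[of 0] Cw[of a] Cw[of 0] a w01 wn n by simp
      qed
    qed
    then have "n dvd (F x - F 0 - u * x) + (F 0 - a)" using Fu[of x] a by (intro dvd_add)
    then show "n dvd F x - x" using \<open>u = 1 \<and> a = 0\<close> by simp
  qed
  moreover have "C x < 4" for x
  proof -
    have "nat (y mod 3) < 4" for y :: int using m3(3)[of y] by simp
    then have "w y < 4" for y by (simp add: w_def)
    then show ?thesis by (simp add: C_def)
  qed
  ultimately show ?thesis using that by blast
qed

text \<open>Multiplication by -2 sends the offsets 1 and \<open>k\<close> to -2 and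
  \<open>- 2 k\<close>, which is 1 modulo \<open>n\<close>. It is thus an isomorphism onto the graph
  with \<open>k = 2\<close>, inverse to multiplication by \<open>k\<close>, and \<open>G\<close>
  below is \<open>F\<close> conjugated by it.\<close>

lemma four_colouring_half:
  fixes n k :: int
  assumes n: "7 \<le> n" "n = 2 * k + 1"
  obtains C where "ccolouring n k C" "cdist n k C" "\<And>x. C x < 4"
proof -
  obtain C where C: "ccolouring n 2 C" "cdist n 2 C" "\<And>x. C x < 4"
    using four_colouring_2[OF n(1)] by metis
  have two: "n dvd 2 * a \<longleftrightarrow> n dvd a" for a
  proof -
    have "coprime n 2" using n(2) by simp
    then show ?thesis by (simp add: coprime_dvd_mult_right_iff)
  qed
  have m2k: "n dvd - 2 * (k * a) - a" for a
  proof -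
    have "- 2 * (k * a) - a = n * (- a)" by (simp add: n(2) algebra_simps)
    then show ?thesis by (metis dvd_triv_left)
  qed
  have k2: "n dvd k * (- 2 * a) - a" for a using m2k[of a] by (simp add: mult.left_commute)
  have cadj2: "cadj n k x y \<longleftrightarrow> cadj n 2 (- 2 * x) (- 2 * y)" for x y
  proof -
    have 1: "n dvd x - y - a \<longleftrightarrow> n dvd - 2 * x - - 2 * y + 2 * a" for a
    proof -
      have "- 2 * x - - 2 * y + 2 * a = - (2 * (x - y - a))" by simp
      then show ?thesis using two[of "x - y - a"] by (simp only: dvd_minus_iff)
    qed
    have 2: "n dvd x - y - k * a \<longleftrightarrow> n dvd - 2 * x - - 2 * y - a" for a
    proof -
      have "- 2 * x - - 2 * y - a = - (2 * (x - y - k * a)) + (- 2 * (k * a) - a)" by (simp add: algebra_simps)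
      then show ?thesis using two[of "x - y - k * a"] dvd_add_left_iff[OF m2k[of a]] by (simp only: dvd_minus_iff)
    qed
    show ?thesis using 1[of 1] 1[of "-1"] 2[of 1] 2[of "-1"] by (auto simp: cadj_def)
  qed
  define C' where "C' x = C (- 2 * x)" for x
  have "ccolouring n k C'"
    unfolding ccolouring_def
  proof (intro conjI allI impI)
    fix x y assume "n dvd x - y"
    then have "n dvd - 2 * (x - y)" by (rule dvd_mult)
    then show "C' x = C' y" unfolding C'_def by (intro ccolouring_cong[OF C(1)]) (simp add: algebra_simps)
  next
    fix x
    have "cadj n k x (x + 1)" "cadj n k x (x + k)" by (simp_all add: cadj_def)
    then show "C' x \<noteq> C' (x + 1)" "C' x \<noteq> C' (x + k)"
      unfolding C'_def cadj2 by (blast dest: ccolouring_cadj[OF C(1)])+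
  qed
  moreover have "cdist n k C'"
    unfolding cdist_def
  proof (intro allI impI)
    fix F x assume F: "caut n k F" and CF: "\<forall>x. C' (F x) = C' x"
    define G where "G y = - 2 * F (k * y)" for y
    have "caut n 2 G"
      unfolding caut_def
    proof (intro conjI allI)
      fix x y
      have "G x - G y = 2 * (F (k * y) - F (k * x))" by (simp add: G_def)
      then have "n dvd G x - G y \<longleftrightarrow> n dvd F (k * y) - F (k * x)" by (simp only: two)
      also have "\<dots> \<longleftrightarrow> n dvd k * y - k * x" by (rule caut_inj[OF F])
      also have "\<dots> \<longleftrightarrow> n dvd 2 * (k * y - k * x)" by (simp only: two)
      also have "2 * (k * y - k * x) = (- 2 * (k * (x - y)) - (x - y)) + (x - y)" by (simp add: algebra_simps)
      also have "n dvd \<dots> \<longleftrightarrow> n dvd x - y" by (rule dvd_add_right_iff[OF m2k])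
      finally show "n dvd G x - G y \<longleftrightarrow> n dvd x - y" .
    next
      fix z
      obtain w where w: "n dvd F w - k * z" using caut_surj[OF F] by blast
      have "n dvd F (k * (- 2 * w)) - F w" using caut_inj[OF F] k2[of w] by blast
      then have "n dvd F (k * (- 2 * w)) - k * z" using w by (rule dvd_diff_trans)
      then have "n dvd - 2 * (F (k * (- 2 * w)) - k * z) + (- 2 * (k * z) - z)"
        by (intro dvd_add dvd_mult m2k)
      moreover have "- 2 * (F (k * (- 2 * w)) - k * z) + (- 2 * (k * z) - z) = G (- 2 * w) - z"
        by (simp add: G_def algebra_simps)
      ultimately show "\<exists>x. n dvd G x - z" by metis
    next
      fix x y
      have "cadj n 2 (G x) (G y) \<longleftrightarrow> cadj n 2 (- 2 * (k * x)) (- 2 * (k * y))"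
        unfolding G_def cadj2[symmetric] by (rule caut_cadj[OF F])
      also have "\<dots> \<longleftrightarrow> cadj n 2 x y" by (rule cadj_cong[OF m2k m2k])
      finally show "cadj n 2 (G x) (G y) \<longleftrightarrow> cadj n 2 x y" .
    qed
    moreover have "C (G y) = C y" for y
    proof -
      have "C (G y) = C (- 2 * (k * y))" using CF by (simp add: C'_def G_def)
      also have "\<dots> = C y" by (rule ccolouring_cong[OF C(1) m2k])
      finally show ?thesis .
    qed
    ultimately have G: "n dvd G y - y" for y using C(2) unfolding cdist_def by blast
    have "n dvd F (k * (- 2 * x)) - F x" using caut_inj[OF F] k2[of x] by blast
    then have "n dvd - 2 * (F (k * (- 2 * x)) - F x)" by (rule dvd_mult)
    from dvd_diff[OF G[of "- 2 * x"] this] have "n dvd - 2 * (F x - x)"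
      by (simp add: G_def algebra_simps)
    then have "n dvd - (2 * (F x - x))" by simp
    then show "n dvd F x - x" by (simp only: dvd_minus_iff two)
  qed
  moreover have "C' x < 4" for x using C(3) by (simp add: C'_def)
  ultimately show ?thesis using that by blast
qed

section \<open>Lower bounds from translations\<close>

lemma caut_translation: "caut n k (\<lambda>x. x + b)"
proof -
  have "n dvd (z - b) + b - z" for z :: int by simp
  then have "\<exists>x. n dvd x + b - z" for z by blast
  then show ?thesis by (auto simp: caut_def cadj_def)
qed

lemma cdist_translation: "cdist n k C \<Longrightarrow> (\<And>x. C (x + b) = C x) \<Longrightarrow> n dvd b"
  unfolding cdist_def using caut_translation[of n k b] by force

lemma no_two_colouring:
  assumes "ccolouring n k C" "cdist n k C" "\<And>x. C x < 2" "3 \<le> n"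
  shows False
proof -
  have "C (x + 2) = C x" for x
  proof -
    have "C x \<noteq> C (x + 1)" "C (x + 1) \<noteq> C (x + 1 + 1)" using assms(1) unfolding ccolouring_def by blast+
    then show ?thesis using assms(3)[of x] assms(3)[of "x + 1"] assms(3)[of "x + 2"]
      by (simp add: add.assoc)
  qed
  then have "n dvd 2" using cdist_translation[OF assms(2)] by blast
  then show False using assms(4) zdvd_imp_le[of n 2] by simp
qed

text \<open>Three consecutive vertices form a triangle, so with three colours the colouring has
  period 3.\<close>

lemma no_three_colouring_2:
  assumes "ccolouring n 2 C" "cdist n 2 C" "\<And>x. C x < 3" "4 \<le> n"
  shows False
proof -
  have ne: "C x \<noteq> C (x + 1)" "C x \<noteq> C (x + 2)" for x using assms(1) unfolding ccolouring_def by blast+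
  have "C (x + 3) = C x" for x
    using ne[of x] ne[of "x + 1"] ne[of "x + 2"]
      assms(3)[of x] assms(3)[of "x + 1"] assms(3)[of "x + 2"] assms(3)[of "x + 3"]
    by (simp add: add.assoc)
  then have "n dvd 3" using cdist_translation[OF assms(2)] by blast
  then show False using assms(4) zdvd_imp_le[of n 3] by simp
qed

text \<open>As \<open>2 k\<close> is -1 modulo \<open>n\<close>, the vertices \<open>x\<close>,
  \<open>x + k\<close>, \<open>x + 2 k\<close> form a triangle. This gives the period
  \<open>3 k\<close>, which is \<open>k - 1\<close> modulo \<open>n\<close>.\<close>

lemma no_three_colouring_half:
  assumes C: "ccolouring n k C" "cdist n k C" "\<And>x. C x < 3" and n: "7 \<le> n" "n = 2 * k + 1"
  shows False
proof -
  have "C (x + 3 * k) = C x" for x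
  proof -
    have ne: "C y \<noteq> C (y + k)" "C y \<noteq> C (y + 2 * k)" for y
    proof -
      show "C y \<noteq> C (y + k)" using C(1) unfolding ccolouring_def by blast
      have "y - (y + 2 * k) - 1 = - n" by (simp add: n(2))
      then have "cadj n k y (y + 2 * k)" by (simp only: cadj_def dvd_minus_iff dvd_refl simp_thms)
      then show "C y \<noteq> C (y + 2 * k)" using ccolouring_cadj[OF C(1)] by blast
    qed
    have s: "x + k + k = x + 2 * k" "x + k + 2 * k = x + 3 * k" "x + 2 * k + k = x + 3 * k" by simp_all
    show ?thesis
      using ne[of x] ne[of "x + k"] ne(1)[of "x + 2 * k"]
        C(3)[of x] C(3)[of "x + k"] C(3)[of "x + 2 * k"] C(3)[of "x + 3 * k"]
      unfolding s by linarith
  qed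
  then have "n dvd 3 * k - n" using cdist_translation[OF C(2)] by simp
  then have "n dvd k - 1" using n(2) by simp
  then show False using n zdvd_imp_le[of n "k - 1"] by simp
qed

section \<open>Complete multipartite circulants\<close>

text \<open>Vertices congruent modulo \<open>p\<close> have the same neighbours, so exchanging two
  of them that share a colour would be a nontrivial symmetry.\<close>

lemma multipartite_injective:
  assumes adj: "\<And>x y. cadj n k x y \<longleftrightarrow> \<not> p dvd x - y" and p: "p dvd n"
    and C: "ccolouring n k C" "cdist n k C" and eq: "C x = C y"
  shows "n dvd x - y"
proof -
  have pxy: "p dvd x - y" using ccolouring_cadj[OF C(1)] adj eq by blast
  define F where "F z = (if n dvd z - x then y else if n dvd z - y then x else z)" for z
  have pF: "p dvd F z - z" for z
    using dvd_trans[OF p, of "z - x"] dvd_trans[OF p, of "z - y"] pxy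
      dvd_diff_trans[of p y x z] dvd_diff_trans[of p x y z] dvd_diff_sym
    by (auto simp: F_def)
  have FF: "n dvd F (F z) - z" for z
    using dvd_diff_sym[of n z x] dvd_diff_sym[of n z y] dvd_diff_trans[of n z x y] dvd_diff_sym[of n x y]
    by (auto simp: F_def)
  have Fc: "n dvd F z - F w" if "n dvd z - w" for z w
  proof -
    have "n dvd z - a \<longleftrightarrow> n dvd w - a" for a
      using that dvd_diff_trans[of n z w a] dvd_diff_trans[of n w z a] dvd_diff_sym[of n z w] by blast
    then show ?thesis using that by (simp add: F_def)
  qed
  have "caut n k F"
    unfolding caut_def
  proof (intro conjI allI)
    show "n dvd F z - F w \<longleftrightarrow> n dvd z - w" for z w
    proof
      assume "n dvd F z - F w"
      then have "n dvd F (F z) - F (F w)" by (rule Fc)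
      from dvd_diff_trans[OF _ dvd_diff_trans[OF this FF]] show "n dvd z - w"
        using FF[of z] dvd_diff_sym by blast
    qed (rule Fc)
    show "\<exists>w. n dvd F w - z" for z using FF by blast
    show "cadj n k (F z) (F w) \<longleftrightarrow> cadj n k z w" for z w
    proof -
      have "p dvd (F z - z) - (F w - w)" by (rule dvd_diff[OF pF pF])
      then have "p dvd (F z - F w) - (z - w)" by (simp add: algebra_simps)
      then have "p dvd F z - F w \<longleftrightarrow> p dvd z - w"
        using dvd_diff_right_iff dvd_diff_left_iff by (metis dvd_add_right_iff diff_add_cancel)
      then show ?thesis by (simp add: adj)
    qed
  qed
  moreover have "C (F z) = C z" for z
    using ccolouring_cong[OF C(1), of z x] ccolouring_cong[OF C(1), of z y] eq by (auto simp: F_def)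
  ultimately have "n dvd F x - x" using C(2) unfolding cdist_def by blast
  then show ?thesis by (simp add: F_def dvd_diff_sym)
qed

lemma dcn_multipartite:
  fixes n k :: nat
  assumes "2 \<le> n" "\<not> n dvd k" "p dvd int n"
    and adj: "\<And>x y. cadj (int n) (int k) x y \<longleftrightarrow> \<not> p dvd x - y"
  shows "distinguishing_chromatic_number (circulant n k) = n"
proof (rule antisym)
  define C where "C x = nat (x mod int n)" for x
  have Ceq: "C x = C y \<longleftrightarrow> int n dvd x - y" for x y
    using assms(1) by (simp add: C_def nat_eq_iff mod_eq_dvd_iff[symmetric])
  show "distinguishing_chromatic_number (circulant n k) \<le> n"
  proof (rule dcn_le[of n k C])
    show "ccolouring (int n) (int k) C"
      using assms(1,2) by (auto simp: ccolouring_def Ceq dvd_diff_sym[of "int n" _ "_ + _"])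
    show "cdist (int n) (int k) C" by (auto simp: cdist_def Ceq)
    show "C x < n" for x using assms(1) by (simp add: C_def nat_less_iff)
  qed (use assms in auto)
  have "n - 1 < distinguishing_chromatic_number (circulant n k)"
  proof (rule dcn_gt)
    fix C assume C: "ccolouring (int n) (int k) C" "cdist (int n) (int k) C" and less: "\<And>x. C x < n - 1"
    have "inj_on (\<lambda>i. C (int i)) {..<n}"
    proof (rule inj_onI)
      fix i j assume ij: "i \<in> {..<n}" "j \<in> {..<n}" and "C (int i) = C (int j)"
      then have "int n dvd int i - int j" by (intro multipartite_injective[OF adj assms(3) C])
      then show "i = j" using ij dvd_diff_nat_eq[of i n j] by simp
    qed
    moreover have "(\<lambda>i. C (int i)) ` {..<n} \<subseteq> {..<n - 1}" using less by auto
    ultimately have "n \<le> n - 1" by (metis card_inj_on_le card_lessThan finite_lessThan)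
    then show False using assms(1) by simp
  qed (use assms in auto)
  then show "n \<le> distinguishing_chromatic_number (circulant n k)" by simp
qed

text \<open>In this order the graphs are K_4, K_5, K_{2,2,2}, K_{3,3} and K_{4,4}; \<open>p\<close>
  is the number of parts.\<close>

lemma dcn_small:
  "distinguishing_chromatic_number (circulant 4 2) = 4"
  "distinguishing_chromatic_number (circulant 5 2) = 5"
  "distinguishing_chromatic_number (circulant 6 2) = 6"
  "distinguishing_chromatic_number (circulant 6 3) = 6"
  "distinguishing_chromatic_number (circulant 8 3) = 8"
proof -
  have "4 dvd a - 1 \<or> 4 dvd a + 1 \<or> 4 dvd a - 2 \<or> 4 dvd a + 2 \<longleftrightarrow> \<not> 4 dvd a" for a :: int by presburger
  then show "distinguishing_chromatic_number (circulant 4 2) = 4"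
    by (intro dcn_multipartite[where p = 4]) (simp_all add: cadj_def)
  have "5 dvd a - 1 \<or> 5 dvd a + 1 \<or> 5 dvd a - 2 \<or> 5 dvd a + 2 \<longleftrightarrow> \<not> 5 dvd a" for a :: int by presburger
  then show "distinguishing_chromatic_number (circulant 5 2) = 5"
    by (intro dcn_multipartite[where p = 5]) (simp_all add: cadj_def)
  have "6 dvd a - 1 \<or> 6 dvd a + 1 \<or> 6 dvd a - 2 \<or> 6 dvd a + 2 \<longleftrightarrow> \<not> 3 dvd a" for a :: int by presburger
  then show "distinguishing_chromatic_number (circulant 6 2) = 6"
    by (intro dcn_multipartite[where p = 3]) (simp_all add: cadj_def)
  have "6 dvd a - 1 \<or> 6 dvd a + 1 \<or> 6 dvd a - 3 \<or> 6 dvd a + 3 \<longleftrightarrow> \<not> 2 dvd a" for a :: int by presburger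
  then show "distinguishing_chromatic_number (circulant 6 3) = 6"
    by (intro dcn_multipartite[where p = 2]) (simp_all add: cadj_def)
  have "8 dvd a - 1 \<or> 8 dvd a + 1 \<or> 8 dvd a - 3 \<or> 8 dvd a + 3 \<longleftrightarrow> \<not> 2 dvd a" for a :: int by presburger
  then show "distinguishing_chromatic_number (circulant 8 3) = 8"
    by (intro dcn_multipartite[where p = 2]) (simp_all add: cadj_def)
qed

section \<open>The circulants of order 10, 13 and 15\<close>

lemma residue_cases:
  fixes x :: int
  assumes "0 < n" "\<And>r. r \<in> set [0..n - 1] \<Longrightarrow> n dvd x - r \<Longrightarrow> P"
  shows P
  using assms(2)[of "x mod n"] assms(1) mod_dvd_diff(2)[of n x] by auto

lemma ccolouring_list:
  fixes n k :: int and L :: "nat list"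
  assumes "0 < n" "\<forall>r\<in>set [0..n - 1]. L ! nat (r mod n) \<noteq> L ! nat ((r + 1) mod n) \<and>
    L ! nat (r mod n) \<noteq> L ! nat ((r + k) mod n)"
  shows "ccolouring n k (\<lambda>x. L ! nat (x mod n))"
  unfolding ccolouring_def
proof (intro conjI allI impI)
  fix x
  have "x mod n \<in> set [0..n - 1]" using assms(1) by simp
  then show "L ! nat (x mod n) \<noteq> L ! nat ((x + 1) mod n)" "L ! nat (x mod n) \<noteq> L ! nat ((x + k) mod n)"
    using assms(2) by (metis mod_add_left_eq mod_mod_trivial)+
qed (simp add: mod_eq_dvd_iff[symmetric])

text \<open>The unique vertex of colour 3 is fixed, so \<open>F\<close> is multiplication by some
  \<open>u\<close>; \<open>a\<close>, \<open>b\<close> and \<open>d\<close> are vertices whose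
  colours rule out \<open>-1\<close>, \<open>k\<close> and \<open>- k\<close>.\<close>

lemma cdist_marked:
  fixes n k :: int
  assumes C: "ccolouring n k C" and g: "generic n k" and mark: "\<And>x. C x = 3 \<Longrightarrow> n dvd x" "C 0 = 3"
    and moved: "C (- a) \<noteq> C a" "C (k * b) \<noteq> C b" "C (- k * d) \<noteq> C d"
  shows "cdist n k C"
  unfolding cdist_def
proof (intro allI impI)
  fix F x assume F: "caut n k F" and CF: "\<forall>x. C (F x) = C x"
  obtain u where u: "u = 1 \<or> u = -1 \<or> u = k \<or> u = - k" and Fu: "\<And>x. n dvd F x - F 0 - u * x"
    using generic_affine[OF g F] by blast
  have "n dvd F 0" using mark CF by simp
  then have Fx: "n dvd F x - u * x" for x using dvd_add[OF Fu[of x]] by fastforce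
  then have "C (u * x) = C x" for x using CF ccolouring_cong[OF C Fx[of x]] by simp
  with moved u have "u = 1" by (metis mult_minus1)
  with Fx show "n dvd F x - x" by fastforce
qed

text \<open>The obstruction is the chromatic number itself: the 26 edges are handed to the solver as
  disequations between 13 colours.\<close>

lemma no_three_colouring_13:
  assumes C: "ccolouring 13 5 C" and less: "\<And>x. C x < 3"
  shows False
proof -
  have v: "C x = 0 \<or> C x = 1 \<or> C x = 2" for x using less[of x] by auto
  have e: "13 dvd x - y - 1 \<or> 13 dvd x - y + 1 \<or> 13 dvd x - y - 5 \<or> 13 dvd x - y + 5 \<Longrightarrow> C x \<noteq> C y" for x y
    using ccolouring_cadj[OF C, of x y] by (simp add: cadj_def)
  show False
    using e[of 0 1] e[of 1 2] e[of 2 3] e[of 3 4] e[of 4 5] e[of 5 6] e[of 6 7] e[of 7 8] e[of 8 9] 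
      e[of 9 10] e[of 10 11] e[of 11 12] e[of 12 0] e[of 0 5] e[of 1 6] e[of 2 7] e[of 3 8] 
      e[of 4 9] e[of 5 10] e[of 6 11] e[of 7 12] e[of 8 0] e[of 9 1] e[of 10 2] e[of 11 3] 
      e[of 12 4]
      v[of 0] v[of 1] v[of 2] v[of 3] v[of 4] v[of 5] v[of 6] v[of 7] v[of 8] v[of 9] v[of 10] 
      v[of 11] v[of 12]
    by simp (smt (verit))
qed

lemma four_colouring_13:
  obtains C where "ccolouring 13 5 C" "cdist 13 5 C" "\<And>x. C x < 4"
proof -
  define L :: "nat list" where "L = [3, 0, 1, 0, 1, 2, 1, 2, 1, 2, 0, 2, 0]"
  define C where "C x = L ! nat (x mod 13)" for x :: int
  have c: "ccolouring 13 5 C"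
    unfolding C_def L_def by (rule ccolouring_list) (simp, code_simp)
  have range: "C x < 4 \<and> (C x = 3 \<longrightarrow> 13 dvd x)" for x
  proof (rule residue_cases[of 13 x])
    fix r assume r: "r \<in> set [0..13 - 1]" "13 dvd x - r"
    have "\<forall>r\<in>set [0..13 - 1]. L ! nat (r mod 13) < 4 \<and> (L ! nat (r mod 13) = 3 \<longrightarrow> r = 0)"
      unfolding L_def by code_simp
    then have "C r < 4 \<and> (C r = 3 \<longrightarrow> r = 0)" using r(1) unfolding C_def by blast
    then show "C x < 4 \<and> (C x = 3 \<longrightarrow> 13 dvd x)" using ccolouring_cong[OF c r(2)] r(2) by auto
  qed simp
  moreover have "cdist 13 5 C"
  proof (rule cdist_marked[OF c, of 2 1 1])
    show "generic 13 5" by (simp add: generic_def)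
    show "13 dvd x" if "C x = 3" for x using range that by blast
  qed (simp_all add: C_def L_def)
  ultimately show ?thesis using that c by blast
qed

text \<open>Each alternative is invariance under an automorphism. The first three list the 2-cycles
  of \<open>11 * x\<close>, \<open>11 * x + 5\<close> and \<open>11 * x + 10\<close> modulo 15,
  where 11 is \<open>- k\<close>; the last is the translation by 3.\<close>

lemma three_colouring_15_symmetric:
  assumes C: "ccolouring 15 4 C" and less: "\<And>x. C x < 3"
  shows "(C 1 = C 11 \<and> C 2 = C 7 \<and> C 4 = C 14 \<and> C 5 = C 10 \<and> C 8 = C 13) \<or>
    (C 0 = C 5 \<and> C 2 = C 12 \<and> C 3 = C 8 \<and> C 6 = C 11 \<and> C 9 = C 14) \<or>
    (C 0 = C 10 \<and> C 1 = C 6 \<and> C 3 = C 13 \<and> C 4 = C 9 \<and> C 7 = C 12) \<or>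
    (C 0 = C 3 \<and> C 1 = C 4 \<and> C 2 = C 5 \<and> C 3 = C 6 \<and> C 4 = C 7 \<and> C 5 = C 8 \<and> C 6 = C 9 \<and> C 7 = C 10 \<and> C 8 = C 11 \<and> C 9 = C 12 \<and> C 10 = C 13 \<and> C 11 = C 14)"
proof -
  have v: "C x = 0 \<or> C x = 1 \<or> C x = 2" for x using less[of x] by auto
  have e: "15 dvd x - y - 1 \<or> 15 dvd x - y + 1 \<or> 15 dvd x - y - 4 \<or> 15 dvd x - y + 4 \<Longrightarrow> C x \<noteq> C y" for x y
    using ccolouring_cadj[OF C, of x y] by (simp add: cadj_def)
  show ?thesis
    using e[of 0 1] e[of 1 2] e[of 2 3] e[of 3 4] e[of 4 5] e[of 5 6] e[of 6 7] e[of 7 8] e[of 8 9] 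
      e[of 9 10] e[of 10 11] e[of 11 12] e[of 12 13] e[of 13 14] e[of 14 0] e[of 0 4] e[of 1 5] 
      e[of 2 6] e[of 3 7] e[of 4 8] e[of 5 9] e[of 6 10] e[of 7 11] e[of 8 12] e[of 9 13] 
      e[of 10 14] e[of 11 0] e[of 12 1] e[of 13 2] e[of 14 3]
      v[of 0] v[of 1] v[of 2] v[of 3] v[of 4] v[of 5] v[of 6] v[of 7] v[of 8] v[of 9] v[of 10] 
      v[of 11] v[of 12] v[of 13] v[of 14]
    by simp (smt (verit))
qed

text \<open>Modulo 15 the factor 11 is \<open>- k\<close>, and \<open>k^2 = 16\<close> is 1, so it
  permutes the four offsets.\<close>

lemma caut_15_times_11: "caut 15 4 (\<lambda>x. 11 * x + b)"
proof -
  have "\<exists>x. 15 dvd 11 * x + b - z" for z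
    by (intro exI[of _ "11 * (z - b)"]) presburger
  moreover have m: "15 dvd 11 * t \<longleftrightarrow> 15 dvd t" for t :: int
  proof
    assume "15 dvd 11 * t"
    from dvd_diff[OF dvd_mult[OF this, of 11] dvd_triv_left[of 15 "8 * t"]]
    have "15 dvd 11 * (11 * t) - 15 * (8 * t)" .
    moreover have "11 * (11 * t) - 15 * (8 * t) = t" by simp
    ultimately show "15 dvd t" by metis
  qed simp
  have "15 dvd 11 * x + b - (11 * y + b) \<longleftrightarrow> 15 dvd x - y" for x y
  proof -
    have "11 * x + b - (11 * y + b) = 11 * (x - y)" by simp
    then show ?thesis by (simp only: m)
  qed
  moreover have "cadj 15 4 (11 * x + b) (11 * y + b) \<longleftrightarrow> cadj 15 4 x y" for x y
  proof -
    have "15 dvd 11 * t - 1 \<or> 15 dvd 11 * t + 1 \<or> 15 dvd 11 * t - 4 \<or> 15 dvd 11 * t + 4 \<longleftrightarrow>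
      15 dvd t - 1 \<or> 15 dvd t + 1 \<or> 15 dvd t - 4 \<or> 15 dvd t + 4" for t :: int
      using m[of "t + 4"] m[of "t - 4"] m[of "t + 1"] m[of "t - 1"]
        dvd_add_left_iff[of 15 45 "11 * t - 1"] dvd_add_left_iff[of 15 "-45" "11 * t + 1"]
        dvd_add_left_iff[of 15 15 "11 * t - 4"] dvd_add_left_iff[of 15 "-15" "11 * t + 4"]
      by (auto simp: algebra_simps)
    from this[of "x - y"] show ?thesis by (simp add: cadj_def right_diff_distrib)
  qed
  ultimately show ?thesis unfolding caut_def by blast
qed

lemma no_three_colouring_15:
  assumes C: "ccolouring 15 4 C" "cdist 15 4 C" and less: "\<And>x. C x < 3"
  shows False
proof -
  have ex: "C x = C (x mod 15)" for x by (rule ccolouring_cong[OF C(1) mod_dvd_diff(2)])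
  have red: "C (u * x + b) = C x"
    if "\<forall>r\<in>set [0..14]. C ((u * r + b) mod 15) = C r" for u b x
  proof (rule residue_cases[of 15 x])
    fix r assume r: "r \<in> set [0..15 - 1]" "15 dvd x - r"
    then have "15 dvd u * (x - r)" by simp
    then have "15 dvd (u * x + b) - (u * r + b)" by (simp add: algebra_simps)
    then have "C (u * x + b) = C ((u * r + b) mod 15)"
      using ccolouring_cong[OF C(1)] ex[of "u * r + b"] by metis
    with that r ccolouring_cong[OF C(1) r(2)] show "C (u * x + b) = C x" by simp
  qed simp
  have no: "\<not> (\<forall>r\<in>set [0..14]. C ((11 * r + b) mod 15) = C r)" for b
  proof
    assume "\<forall>r\<in>set [0..14]. C ((11 * r + b) mod 15) = C r"
    then have *: "15 dvd 11 * x + b - x" for x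
      using red C(2) caut_15_times_11[of b] unfolding cdist_def by blast
    from dvd_diff[OF *[of 1] *[of 0]] show False by simp
  qed
  have "\<not> (\<forall>r\<in>set [0..14]. C ((1 * r + 3) mod 15) = C r)"
  proof
    assume "\<forall>r\<in>set [0..14]. C ((1 * r + 3) mod 15) = C r"
    from red[OF this] have "(15::int) dvd 3" by (intro cdist_translation[OF C(2)]) simp
    then show False by simp
  qed
  with no[of 0] no[of 5] no[of 10] three_colouring_15_symmetric[OF C(1) less] show False
    by (simp add: upto_rec1) (smt (verit))
qed

lemma four_colouring_15:
  obtains C where "ccolouring 15 4 C" "cdist 15 4 C" "\<And>x. C x < 4"
proof -
  define L :: "nat list" where "L = [3, 0, 1, 0, 1, 2, 0, 1, 0, 1, 2, 0, 1, 2, 1]"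
  define C where "C x = L ! nat (x mod 15)" for x :: int
  have c: "ccolouring 15 4 C"
    unfolding C_def L_def by (rule ccolouring_list) (simp, code_simp)
  have range: "C x < 4 \<and> (C x = 3 \<longrightarrow> 15 dvd x)" for x
  proof (rule residue_cases[of 15 x])
    fix r assume r: "r \<in> set [0..15 - 1]" "15 dvd x - r"
    have "\<forall>r\<in>set [0..15 - 1]. L ! nat (r mod 15) < 4 \<and> (L ! nat (r mod 15) = 3 \<longrightarrow> r = 0)"
      unfolding L_def by code_simp
    then have "C r < 4 \<and> (C r = 3 \<longrightarrow> r = 0)" using r(1) unfolding C_def by blast
    then show "C x < 4 \<and> (C x = 3 \<longrightarrow> 15 dvd x)" using ccolouring_cong[OF c r(2)] r(2) by auto
  qed simp
  moreover have "cdist 15 4 C"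
  proof (rule cdist_marked[OF c, of 1 1 8])
    show "generic 15 4" by (simp add: generic_def)
    show "15 dvd x" if "C x = 3" for x using range that by blast
  qed (simp_all add: C_def L_def)
  ultimately show ?thesis using that c by blast
qed

text \<open>The graph \<open>C\<^sub>1\<^sub>0(1,3)\<close> is \<open>K\<^sub>5\<^sub>,\<^sub>5\<close> minus the perfect matching of the pairs
  \<open>{x, x + 5}\<close>; exchanging two such pairs is an automorphism, so no two of them may be coloured alike.\<close>

lemma card_le_colour_pairs:
  fixes a b :: "'i \<Rightarrow> 'c"
  assumes "finite I" "finite K" "card K \<le> 4" "a ` I \<subseteq> K" "b ` I \<subseteq> K"
    and "\<And>i j. i \<in> I \<Longrightarrow> j \<in> I \<Longrightarrow> i \<noteq> j \<Longrightarrow> a i \<noteq> b j"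
    and "inj_on (\<lambda>i. (a i, b i)) I"
  shows "card I \<le> card K"
  using assms
proof (induction "card K" arbitrary: I K rule: less_induct)
  case less
  show ?case
  \<comment> \<open>A pair with two equal colours has this colour for itself, and both are removed
    together. Without such pairs the colours used by \<open>a\<close> and by \<open>b\<close> are
    disjoint, and there are at most as many pairs as products allow.\<close>
  proof (cases "\<exists>j\<in>I. a j = b j")
    case True
    then obtain j where j: "j \<in> I" "a j = b j" by blast
    have jK: "a j \<in> K" using j less.prems(4) by blast
    then have K: "card (K - {a j}) < card K" using less.prems(2) by (metis card_Diff1_less)
    have "card (I - {j}) \<le> card (K - {a j})"
    proof (rule less.hyps[OF K])
      show "a ` (I - {j}) \<subseteq> K - {a j}" using less.prems(4) less.prems(6)[of _ j] j by fastforce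
      show "b ` (I - {j}) \<subseteq> K - {a j}" using less.prems(5) less.prems(6)[of j] j by fastforce
      show "inj_on (\<lambda>i. (a i, b i)) (I - {j})" using less.prems(7) by (rule inj_on_subset) blast
    qed (use less.prems K in auto)
    then show ?thesis using j jK less.prems(1,2) by (simp add: card_Diff_singleton)
      (metis Suc_diff_1 card_gt_0_iff diff_le_mono empty_iff le_diff_iff Suc_leI)
  next
    case False
    have disj: "a ` I \<inter> b ` I = {}" using False less.prems(6) by fastforce
    have "card I \<le> card (a ` I \<times> b ` I)"
      using less.prems(1,7) by (intro card_inj_on_le[where f = "\<lambda>i. (a i, b i)"]) auto
    then have I: "card I \<le> card (a ` I) * card (b ` I)" by (simp add: card_cartesian_product)
    have "card (a ` I) + card (b ` I) = card (a ` I \<union> b ` I)"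
      using disj less.prems(1) by (simp add: card_Un_disjoint)
    also have "\<dots> \<le> card K" using less.prems(2,4,5) by (intro card_mono) auto
    finally have s: "card (a ` I) + card (b ` I) \<le> card K" .
    \<comment> \<open>This is where four colours matter: 2 + 3 = 5 but 2 * 3 = 6.\<close>
    moreover have "p * q \<le> r" if "p + q \<le> r" "r \<le> 4" for p q r :: nat
    proof -
      have "p = 0 \<or> p = 1 \<or> p = 2 \<or> p = 3 \<or> p = 4" using that by arith
      then show ?thesis using that by (elim disjE) auto
    qed
    ultimately show ?thesis using I less.prems(3) by (meson order_trans)
  qed
qed

lemma cadj_10_3: "cadj 10 3 x y \<longleftrightarrow> odd (x - y) \<and> \<not> 5 dvd x - y"
proof -
  have "10 dvd t - 1 \<or> 10 dvd t + 1 \<or> 10 dvd t - 3 \<or> 10 dvd t + 3 \<longleftrightarrow> odd t \<and> \<not> 5 dvd t" for t :: int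
    by presburger
  then show ?thesis by (simp add: cadj_def)
qed

lemma dvd_10_iff: "10 dvd t \<longleftrightarrow> even t \<and> 5 dvd t" for t :: int by presburger

lemma no_four_colouring_10:
  assumes C: "ccolouring 10 3 C" "cdist 10 3 C" and less: "\<And>x. C x < 4"
  shows False
proof -
  have "\<not> inj_on (\<lambda>i. (C (2 * i), C (2 * i + 5))) {0..<5}"
  proof
    assume "inj_on (\<lambda>i. (C (2 * i), C (2 * i + 5))) {0..<5}"
    then have "card {0..<5::int} \<le> card {..<4::nat}"
    proof (rule card_le_colour_pairs[rotated -1])
      fix i j :: int assume ij: "i \<in> {0..<5}" "j \<in> {0..<5}" "i \<noteq> j"
      have "\<not> 5 dvd i - j" using ij dvd_small[of "i - j" 5] by auto
      then have "cadj 10 3 (2 * i) (2 * j + 5)" unfolding cadj_10_3 by presburger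
      then show "C (2 * i) \<noteq> C (2 * j + 5)" by (rule ccolouring_cadj[OF C(1)])
    qed (use less in auto)
    then show False by simp
  qed
  then obtain i j :: int where ij: "i \<in> {0..<5}" "j \<in> {0..<5}" "i \<noteq> j"
    and eq: "C (2 * i) = C (2 * j)" "C (2 * i + 5) = C (2 * j + 5)" by (auto simp: inj_on_def)
  have nij: "\<not> 5 dvd i - j" using ij dvd_small[of "i - j" 5] by auto
  \<comment> \<open>The classes of \<open>2 * i\<close> and \<open>2 * j\<close> modulo 5 are
    exchanged by even shifts, so each pair keeps its even and its odd vertex.\<close>
  define F where "F z = (if 5 dvd z - 2 * i then z + 2 * (j - i) else if 5 dvd z - 2 * j then z + 2 * (i - j) else z)" for z
  have par: "even (F z) \<longleftrightarrow> even z" for z by (simp add: F_def)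
  have F5: "5 dvd F z - F w" if "5 dvd z - w" for z w
  proof -
    have "5 dvd z - a \<longleftrightarrow> 5 dvd w - a" for a using that by presburger
    then show ?thesis using that by (simp add: F_def)
  qed
  have FF: "F (F z) = z" for z
    using nij unfolding F_def by (simp; presburger)
  have F5iff: "5 dvd F z - F w \<longleftrightarrow> 5 dvd z - w" for z w using F5[of z w] F5[of "F z" "F w"] FF by auto
  have "caut 10 3 F"
    unfolding caut_def cadj_10_3 dvd_10_iff using par F5iff FF by (auto intro: exI[of _ "F _"])
  moreover have "C (F z) = C z" for z
  proof -
    have c: "C z = C y" if "10 dvd z - y" for z y by (rule ccolouring_cong[OF C(1) that])
    have two: "C (z + 2 * (j - i)) = C z" if "5 dvd z - 2 * i" "C (2 * i) = C (2 * j)" "C (2 * i + 5) = C (2 * j + 5)" for z i j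
    proof -
      have "10 dvd z - 2 * i \<or> 10 dvd z - (2 * i + 5)" using that(1) by presburger
      then show ?thesis
      proof
        assume "10 dvd z - 2 * i"
        then show ?thesis using c[of z "2 * i"] c[of "z + 2 * (j - i)" "2 * j"] that by (simp add: algebra_simps)
      next
        assume "10 dvd z - (2 * i + 5)"
        then show ?thesis using c[of z "2 * i + 5"] c[of "z + 2 * (j - i)" "2 * j + 5"] that by (simp add: algebra_simps)
      qed
    qed
    show ?thesis using two[of z i j] two[of z j i] eq by (simp add: F_def)
  qed
  ultimately have "10 dvd F (2 * i) - 2 * i" using C(2) unfolding cdist_def by blast
  then have "10 dvd 2 * (j - i)" by (simp add: F_def)
  then show False using nij by presburger
qed

lemma five_colouring_10:
  obtains C where "ccolouring 10 3 C" "cdist 10 3 C" "\<And>x. C x < 5"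
proof -
  \<comment> \<open>The pairs \<open>(x, x + 5)\<close> with \<open>x\<close> even receive (0,2),
    (0,3), (1,2), (1,3) and (4,4): all products of \<open>{0, 1}\<close> and \<open>{2, 3}\<close>,
    and one pair with a colour of its own.\<close>
  define L :: "nat list" where "L = [0, 3, 0, 4, 1, 2, 1, 3, 4, 2]"
  define C where "C x = L ! nat (x mod 10)" for x :: int
  have c: "ccolouring 10 3 C"
    unfolding C_def L_def by (rule ccolouring_list) (simp, code_simp)
  have "cdist 10 3 C"
    unfolding cdist_def
  proof (intro allI impI)
    fix F x assume F: "caut 10 3 F" and CF: "\<forall>x. C (F x) = C x"
    define f where "f r = F r mod 10" for r
    have f: "f r \<in> set [0..9]" "C (f r) = C r" "10 dvd F r - f r" for r
      using CF ccolouring_cong[OF c, of "F r" "f r"] by (auto simp: f_def mod_dvd_diff)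
    have cls: "\<forall>s\<in>set [0..9]. (C s = 0 \<longrightarrow> s = 0 \<or> s = 2) \<and> (C s = 1 \<longrightarrow> s = 4 \<or> s = 6) \<and>
        (C s = 2 \<longrightarrow> s = 5 \<or> s = 9) \<and> (C s = 3 \<longrightarrow> s = 1 \<or> s = 7) \<and> (C s = 4 \<longrightarrow> s = 3 \<or> s = 8)"
      by (simp add: C_def L_def upto_rec1)
    have inj: "f r \<noteq> f s" if "\<not> 10 dvd r - s" for r s
    proof
      assume "f r = f s"
      then have "10 dvd F r - F s" using dvd_diff[OF f(3)[of r] f(3)[of s]] by simp
      with that caut_inj[OF F] show False by blast
    qed
    have adj: "odd (f r - f s) \<and> \<not> 5 dvd f r - f s \<longleftrightarrow> odd (r - s) \<and> \<not> 5 dvd r - s" for r s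
      using caut_cadj[OF F, of r s] cadj_cong[OF f(3) f(3), of 3 r s] by (simp add: cadj_10_3)
    have Cv: "C 0 = 0" "C 1 = 3" "C 2 = 0" "C 3 = 4" "C 4 = 1" "C 5 = 2" "C 6 = 1" "C 7 = 3" "C 8 = 4" "C 9 = 2"
      by (simp_all add: C_def L_def)
    \<comment> \<open>Every colour class has two vertices. The non-adjacency of 0 and 5 settles
      these two; adjacency to vertices already known to be fixed, together with injectivity, settles
      the others.\<close>
    have "f 0 = 0 \<or> f 0 = 2" "f 5 = 5 \<or> f 5 = 9" using cls f[of 0] f[of 5] Cv by auto
    then have f0: "f 0 = 0" "f 5 = 5" using adj[of 0 5] by auto
    have "f 2 = 0 \<or> f 2 = 2" "f 9 = 5 \<or> f 9 = 9" using cls f[of 2] f[of 9] Cv by auto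
    then have f2: "f 2 = 2" "f 9 = 9" using f0 inj[of 2 0] inj[of 9 5] by auto
    have "f 4 = 4 \<or> f 4 = 6" "f 6 = 4 \<or> f 6 = 6" using cls f[of 4] f[of 6] Cv by auto
    then have f4: "f 4 = 4" "f 6 = 6" using f2 adj[of 4 9] inj[of 6 4] by auto
    have "f 1 = 1 \<or> f 1 = 7" "f 7 = 1 \<or> f 7 = 7" using cls f[of 1] f[of 7] Cv by auto
    then have f1: "f 1 = 1" "f 7 = 7" using f4 adj[of 1 6] inj[of 7 1] by auto
    have "f 3 = 3 \<or> f 3 = 8" "f 8 = 3 \<or> f 8 = 8" using cls f[of 3] f[of 8] Cv by auto
    then have f3: "f 3 = 3" "f 8 = 8" using f0 adj[of 8 5] inj[of 3 8] by auto
    have fr: "\<forall>r\<in>set [0..9]. f r = r" using f0 f1 f2 f3 f4 by (simp add: upto_rec1)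
    show "10 dvd F x - x"
    proof (rule residue_cases[of 10 x])
      fix r assume r: "r \<in> set [0..10 - 1]" "10 dvd x - r"
      then have "10 dvd F x - F r" using caut_inj[OF F] by blast
      moreover have "10 dvd F r - r" using f(3)[of r] fr r(1) by simp
      ultimately have "10 dvd F x - r" by (rule dvd_diff_trans)
      then show "10 dvd F x - x" using r(2) dvd_diff_sym dvd_diff_trans by blast
    qed simp
  qed
  moreover have "C x < 5" for x
  proof (rule residue_cases[of 10 x])
    fix r assume r: "r \<in> set [0..10 - 1]" "10 dvd x - r"
    have "\<forall>r\<in>set [0..10 - 1]. L ! nat (r mod 10) < 5" unfolding L_def by code_simp
    then have "C r < 5" using r(1) unfolding C_def by blast
    then show "C x < 5" using ccolouring_cong[OF c r(2)] by simp
  qed simp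
  ultimately show ?thesis using that c by blast
qed

section \<open>The case \<open>k = n/2 - 1\<close>\<close>

text \<open>Here \<open>x\<close> and \<open>x + h\<close> are twins, and the quotient by the twin relation is a cycle of length
  \<open>h\<close>. A colouring is a closed walk of length \<open>h\<close> in the Kneser graph of colour pairs.\<close>

lemma cadj_twin: "cadj (2 * h) (h - 1) x y \<longleftrightarrow> h dvd x - y - 1 \<or> h dvd x - y + 1"
proof
  assume "cadj (2 * h) (h - 1) x y"
  then have "h dvd x - y - 1 \<or> h dvd x - y + 1 \<or> h dvd x - y - (h - 1) \<or> h dvd x - y + (h - 1)"
    unfolding cadj_def by (blast intro: dvd_mult_right)
  moreover have "x - y - (h - 1) = (x - y + 1) - h" "x - y + (h - 1) = (x - y - 1) + h" by simp_all
  ultimately show "h dvd x - y - 1 \<or> h dvd x - y + 1" by (metis dvd_add_left_iff dvd_diff_left_iff dvd_refl)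
next
  have two: "2 * h dvd a \<or> 2 * h dvd a + h" if a: "h dvd a" for a
  proof -
    obtain q where q: "a = h * q" using a ..
    show ?thesis
    proof (cases "even q")
      case True
      then show ?thesis by (auto simp: q elim!: evenE)
    next
      case False
      then obtain r where "q = 2 * r + 1" by (rule oddE)
      then have "a + h = 2 * h * (r + 1)" by (simp add: q algebra_simps)
      then show ?thesis by simp
    qed
  qed
  have shift: "2 * h dvd a + h \<Longrightarrow> 2 * h dvd a - h" for a
    using dvd_diff[of "2 * h" "a + h" "2 * h"] by simp
  assume "h dvd x - y - 1 \<or> h dvd x - y + 1"
  then show "cadj (2 * h) (h - 1) x y"
  proof
    assume "h dvd x - y - 1"
    from two[OF this] show ?thesis by (auto simp: cadj_def algebra_simps)
  next
    assume "h dvd x - y + 1"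
    from two[OF this] shift[of "x - y + 1"] show ?thesis by (auto simp: cadj_def algebra_simps)
  qed
qed

text \<open>Such an \<open>F\<close> rotates the quotient cycle by \<open>c\<close>; inside the twin
  pairs it may choose freely.\<close>

lemma caut_twinI:
  assumes inj: "\<And>x y. 2 * h dvd F x - F y \<longleftrightarrow> 2 * h dvd x - y" and surj: "\<And>z. \<exists>x. 2 * h dvd F x - z"
    and cls: "\<And>x. h dvd F x - x - c"
  shows "caut (2 * h) (h - 1) F"
proof -
  have d: "h dvd (F x - F y) - (x - y)" for x y
    using dvd_diff[OF cls[of x] cls[of y]] by (simp add: algebra_simps)
  have "h dvd F x - F y + a \<longleftrightarrow> h dvd x - y + a" for x y a
  proof -
    have "F x - F y + a = ((F x - F y) - (x - y)) + (x - y + a)" by simp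
    then show ?thesis using dvd_add_right_iff[OF d] by metis
  qed
  from this[of _ _ 1] this[of _ _ "-1"] show ?thesis
    unfolding caut_def cadj_twin using inj surj by auto
qed

text \<open>Twins need different colours, since exchanging them is an automorphism. Among four
  colours disjoint pairs are complementary, so the pairs at \<open>x\<close> and
  \<open>x + 2\<close> coincide. Moving two steps along the quotient cycle to the twin of the same
  colour is then a nontrivial symmetry.\<close>

lemma no_four_colouring_twin:
  assumes C: "ccolouring (2 * h) (h - 1) C" "cdist (2 * h) (h - 1) C" and less: "\<And>x. C x < 4" and h: "5 \<le> h"
  shows False
proof -
  let ?n = "2 * h"
  have c: "C x = C y" if "?n dvd x - y" for x y by (rule ccolouring_cong[OF C(1) that])
  have half: "?n dvd x - y \<or> ?n dvd x - y - h" if d: "h dvd x - y" for x y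
  proof -
    obtain q where "x - y = h * q" using d ..
    then show ?thesis
      by (cases "even q") (auto elim!: evenE oddE simp: algebra_simps)
  qed
  have nh: "\<not> ?n dvd h" using h zdvd_imp_le[of ?n h] by auto
  have ch: "C (x + h + h) = C x" for x by (rule c) simp
  have twin: "C x \<noteq> C (x + h)" for x
  proof
    assume eq: "C x = C (x + h)"
    define F where "F z = (if h dvd z - x then z + h else z)" for z
    have Fh: "h dvd F z - x \<longleftrightarrow> h dvd z - x" for z
      using dvd_add_left_iff[of h h "z - x"] by (simp add: F_def algebra_simps)
    have "caut ?n (h - 1) F"
    proof (rule caut_twinI[where c = 0])
      show "?n dvd F z - F w \<longleftrightarrow> ?n dvd z - w" for z w
      proof
        assume a: "?n dvd z - w"
        then have "h dvd z - w" by (rule dvd_mult_right)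
        then have "h dvd z - x \<longleftrightarrow> h dvd w - x"
          using dvd_diff_trans[of h z w x] dvd_diff_trans[of h w z x] dvd_diff_sym by blast
        then show "?n dvd F z - F w" using a by (simp add: F_def)
      next
        assume a: "?n dvd F z - F w"
        then have "h dvd F z - F w" by (rule dvd_mult_right)
        then have "h dvd F z - x \<longleftrightarrow> h dvd F w - x"
          using dvd_diff_trans[of h "F z" "F w" x] dvd_diff_trans[of h "F w" "F z" x] dvd_diff_sym by blast
        then show "?n dvd z - w" using a unfolding Fh by (simp add: F_def split: if_splits)
      qed
      show "\<exists>w. ?n dvd F w - z" for z
      proof (cases "h dvd z - x")
        case True
        from dvd_add[OF this dvd_refl] have "h dvd (z + h) - x" by (simp add: algebra_simps)
        then have "F (z + h) = z + 2 * h" by (simp add: F_def)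
        then show ?thesis by (intro exI[of _ "z + h"]) simp
      next
        case False
        then show ?thesis by (intro exI[of _ z]) (simp add: F_def)
      qed
    qed (simp add: F_def)
    moreover have "C (F z) = C z" for z
    proof (cases "h dvd z - x")
      case True
      from half[OF this] consider "?n dvd z - x" | "?n dvd z - (x + h)" by (auto simp: diff_diff_eq)
      then show ?thesis
      proof cases
        case 1
        then have "C (z + h) = C (x + h)" "C z = C x" by (auto intro!: c)
        then show ?thesis using True eq by (simp add: F_def)
      next
        case 2
        then have "C (z + h) = C (x + h + h)" "C z = C (x + h)" by (auto intro!: c simp: algebra_simps)
        then show ?thesis using True eq ch by (simp add: F_def)
      qed
    qed (simp add: F_def)
    ultimately have "?n dvd F x - x" using C(2) unfolding cdist_def by blast
    then show False using nh by (simp add: F_def)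
  qed
  have adj: "C x \<noteq> C y" if "h dvd x - y - 1 \<or> h dvd x - y + 1" for x y
    using ccolouring_cadj[OF C(1)] that unfolding cadj_twin by blast
  have four: "r = p \<or> r = q"
    if "p < 4" "q < 4" "a < 4" "b < 4" "r < 4" "p \<noteq> q" "a \<noteq> b" "a \<noteq> p" "a \<noteq> q" "b \<noteq> p" "b \<noteq> q" "a \<noteq> r" "b \<noteq> r"
    for p q a b r :: nat
  proof -
    have "card {p, q, a, b} = card {..<4::nat}" using that(6-11) by simp
    moreover have "{p, q, a, b} \<subseteq> {..<4}" using that(1-4) by simp
    ultimately have "{p, q, a, b} = {..<4}" by (intro card_subset_eq) simp_all
    then have "r \<in> {p, q, a, b}" using that(5) by simp
    then show ?thesis using that(12,13) by auto
  qed
  have two: "C (x + 2) = C x \<or> C (x + 2) = C (x + h)" "C (x + 2 + h) = C x \<or> C (x + 2 + h) = C (x + h)" for x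
  proof -
    have "C (x + 1) \<noteq> C x" "C (x + 1) \<noteq> C (x + h)" "C (x + 1 + h) \<noteq> C x" "C (x + 1 + h) \<noteq> C (x + h)"
      "C (x + 1) \<noteq> C (x + 2)" "C (x + 1) \<noteq> C (x + 2 + h)" "C (x + 1 + h) \<noteq> C (x + 2)" "C (x + 1 + h) \<noteq> C (x + 2 + h)"
      by (rule adj; simp)+
    note ne = this
    show "C (x + 2) = C x \<or> C (x + 2) = C (x + h)"
      by (rule four[of _ _ "C (x + 1)" "C (x + 1 + h)"]) (rule less twin ne)+
    show "C (x + 2 + h) = C x \<or> C (x + 2 + h) = C (x + h)"
      by (rule four[of _ _ "C (x + 1)" "C (x + 1 + h)"]) (rule less twin ne)+
  qed
  define F where "F x = (if C (x + 2) = C x then x + 2 else x + 2 + h)" for x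
  have CF: "C (F x) = C x" for x using two[of x] twin[of "x + 2"] by (auto simp: F_def)
  have Fcls: "h dvd F x - x - 2" for x by (simp add: F_def)
  have Finj: "?n dvd F x - F y \<longleftrightarrow> ?n dvd x - y" for x y
  proof
    assume a: "?n dvd x - y"
    then have "C x = C y" "C (x + 2) = C (y + 2)" by (auto intro!: c)
    then show "?n dvd F x - F y" using a by (simp add: F_def)
  next
    assume a: "?n dvd F x - F y"
    then have "h dvd F x - F y" by (rule dvd_mult_right)
    from dvd_diff[OF this dvd_diff[OF Fcls[of x] Fcls[of y]]] have "h dvd x - y" by (simp add: algebra_simps)
    moreover have False if "?n dvd x - y - h"
    proof -
      have "C x = C (y + h)" using that by (intro c) (simp add: diff_diff_eq)
      moreover have "C x = C y" using c[OF a] CF by simp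
      ultimately show False using twin[of y] by simp
    qed
    ultimately show "?n dvd x - y" using half by blast
  qed
  have "caut ?n (h - 1) F"
  proof (rule caut_twinI[OF Finj _ Fcls])
    fix z
    have "F (z - 2) = z \<or> F (z - 2) = z + h" by (simp add: F_def)
    moreover have "F (z - 2 - h) = z - h \<or> F (z - 2 - h) = z" by (simp add: F_def)
    moreover have "\<not> ?n dvd F (z - 2) - F (z - 2 - h)" using nh by (simp add: Finj)
    ultimately have "F (z - 2) = z \<or> F (z - 2 - h) = z" by auto
    then show "\<exists>x. ?n dvd F x - z" by (metis diff_self dvd_0_right)
  qed
  with CF C(2) have "?n dvd F 0 - 0" unfolding cdist_def by blast
  then have "h dvd F 0" by (simp add: dvd_mult_right)
  with dvd_diff[OF this Fcls[of 0]] have "h dvd 2" by simp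
  then show False using h zdvd_imp_le[of h 2] by simp
qed

text \<open>The sets \<open>Q i\<close> form a cycle of length 5 or 6 in the Petersen graph,
  according to the parity of \<open>h\<close>, and the walk is prolonged by going back and forth
  between \<open>Q 0\<close> and \<open>Q 1\<close>. As \<open>Q 3\<close> and \<open>Q 4\<close>
  are visited once, two adjacent points of the quotient cycle are fixed, hence all of them, and
  twins are told apart by colour.\<close>

lemma five_colouring_twin:
  fixes h :: int
  assumes h: "5 \<le> h"
  obtains C where "ccolouring (2 * h) (h - 1) C" "cdist (2 * h) (h - 1) C" "\<And>x. C x < 5"
proof -
  let ?n = "2 * h"
  define L where "L = (if odd h then 5 else 6 :: int)"
  define A where "A = (if odd h then [0, 2, 4, 1, 3] else [0, 2, 0, 1, 0, 2 :: nat])"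
  define B where "B = (if odd h then [1, 3, 0, 2, 4] else [1, 3, 4, 2, 3, 4 :: nat])"
  \<comment> \<open>\<open>h - L\<close> is even, so the tail 0, 1, ..., 0, 1, if any, ends in 1 and
    closes up with the 0 at the start.\<close>
  define idx where "idx i = (if i < L then i else (i - L) mod 2)" for i
  define C where "C x = (if x mod ?n < h then A else B) ! nat (idx (x mod h))" for x
  define Q where "Q i = {A ! nat i, B ! nat i}" for i
  have L: "L \<le> h" "even (h - L)" "L = 5 \<or> L = 6" using h by (auto simp: L_def)
  have A5: "A ! 0 = 0" "B ! 0 = 1" "A ! 1 = 2" "B ! 1 = 3" by (auto simp: A_def B_def)
  have idx: "0 \<le> idx i" "idx i < L" if "0 \<le> i" for i using that L by (auto simp: idx_def)
  have rng: "\<forall>i\<in>set [0..L - 1]. A ! nat i < 5 \<and> B ! nat i < 5 \<and> A ! nat i \<noteq> B ! nat i"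
    by (auto simp: L_def A_def B_def upto_rec1)
  have kneser: "\<forall>i\<in>set [0..L - 1]. Q i \<inter> Q (if i = L - 1 then 0 else i + 1) = {}"
    by (auto simp: Q_def L_def A_def B_def upto_rec1)
  have Q01: "Q 1 \<inter> Q 0 = {}" using A5 by (auto simp: Q_def)
  have Qdist: "\<forall>i\<in>set [0..L - 1]. \<forall>j\<in>set [0..L - 1]. Q i = Q j \<longrightarrow> i = j"
    by (auto simp: Q_def L_def A_def B_def upto_rec1 doubleton_eq_iff)
  define q where "q x = idx (x mod h)" for x
  have m: "0 \<le> x mod h" "x mod h < h" for x using h by auto
  have q: "q x \<in> set [0..L - 1]" for x using idx[OF m(1)[of x]] by (simp add: q_def)
  have qcong: "q x = q y" if "h dvd x - y" for x y using that by (simp add: q_def mod_eq_dvd_iff[symmetric])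
  have half: "?n dvd x - y \<or> ?n dvd x - y - h" if d: "h dvd x - y" for x y
  proof -
    obtain r where "x - y = h * r" using d ..
    then show ?thesis
      by (cases "even r") (auto elim!: evenE oddE simp: algebra_simps)
  qed
  have c: "C x = C y" if "?n dvd x - y" for x y
  proof -
    have "h dvd x - y" using that by (rule dvd_mult_right)
    then show ?thesis using that by (simp add: C_def mod_eq_dvd_iff[symmetric])
  qed
  have side: "(x + h) mod ?n < h \<longleftrightarrow> \<not> x mod ?n < h" for x
  proof -
    define r where "r = x mod ?n"
    have r: "0 \<le> r" "r < ?n" using h by (auto simp: r_def)
    have xr: "(x + h) mod ?n = (r + h) mod ?n" by (simp add: r_def mod_add_left_eq)
    show ?thesis
    proof (cases "r < h")
      case True
      then have "(r + h) mod ?n = r + h" using r by (intro mod_pos_pos_trivial) auto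
      then show ?thesis using True r unfolding xr r_def[symmetric] by simp
    next
      case False
      have "(r + h) mod ?n = (r - h) mod ?n" using minus_mod_self2[of "r + h" ?n] by simp
      also have "\<dots> = r - h" using False r by (intro mod_pos_pos_trivial) auto
      finally show ?thesis using False r unfolding xr r_def[symmetric] by simp
    qed
  qed
  have pair: "Q (q x) = {C x, C (x + h)}" "C x \<noteq> C (x + h)" for x
  proof -
    have "A ! nat (q x) \<noteq> B ! nat (q x)" using rng q[of x] by blast
    moreover have "q (x + h) = q x" by (rule qcong) simp
    ultimately show "Q (q x) = {C x, C (x + h)}" "C x \<noteq> C (x + h)"
      using side[of x] by (auto simp: C_def Q_def q_def[symmetric])
  qed
  have qstep: "Q (q x) \<inter> Q (q (x + 1)) = {}" for x
  proof -
    define i where "i = x mod h"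
    have i: "0 \<le> i" "i < h" using m by (auto simp: i_def)
    have i1: "(x + 1) mod h = (if i = h - 1 then 0 else i + 1)"
    proof -
      have "(x + 1) mod h = (i + 1) mod h" by (simp add: i_def mod_add_left_eq)
      then show ?thesis using i by auto
    qed
    have K: "Q j \<inter> Q (if j = L - 1 then 0 else j + 1) = {}" if "0 \<le> j" "j < L" for j
      using kneser that by simp
    consider "i < L" | "L \<le> i" "i < h - 1" | "L \<le> i" "i = h - 1" using i by linarith
    then show ?thesis
    proof cases
      case 1
      have "idx (if i = h - 1 then 0 else i + 1) = (if i = L - 1 then 0 else i + 1)"
      proof (cases "i = L - 1")
        case True
        have "idx 0 = 0" "idx L = 0" using L(3) by (auto simp: idx_def)
        then show ?thesis using True by simp
      next
        case False
        then have "i \<noteq> h - 1" "i + 1 < L" using 1 L(1) by linarith+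
        then show ?thesis using False by (simp add: idx_def)
      qed
      then show ?thesis using K[of i] i 1 by (simp add: q_def i1 i_def[symmetric] idx_def)
    next
      case 2
      then have "idx i = (i - L) mod 2" "idx (i + 1) = (i - L + 1) mod 2" by (auto simp: idx_def algebra_simps)
      moreover have "(i - L) mod 2 = 0 \<and> (i - L + 1) mod 2 = 1 \<or> (i - L) mod 2 = 1 \<and> (i - L + 1) mod 2 = 0"
        by presburger
      ultimately show ?thesis using 2 Q01 by (auto simp: q_def i1 i_def[symmetric] Int_commute)
    next
      case 3
      then have "(i - L) mod 2 = 1" using L(2) by presburger
      then have "idx i = 1" "idx 0 = 0" using 3 L by (auto simp: idx_def)
      then show ?thesis using 3 Q01 by (simp add: q_def i1 i_def[symmetric])
    qed
  qed
  have proper: "C x \<noteq> C y" if "h dvd y - x - 1" for x y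
  proof -
    have "q y = q (x + 1)" using that by (intro qcong) (simp add: diff_diff_eq)
    then show ?thesis using qstep[of x] pair(1)[of x] pair(1)[of y] by auto
  qed
  have "ccolouring ?n (h - 1) C"
    unfolding ccolouring_def
  proof (intro conjI allI impI)
    fix x
    show "C x \<noteq> C (x + 1)" by (rule proper) simp
    show "C x \<noteq> C (x + (h - 1))" by (rule proper[symmetric]) simp
  qed (use c in blast)
  moreover have "cdist ?n (h - 1) C"
    unfolding cdist_def
  proof (intro allI impI)
    fix F x assume F: "caut ?n (h - 1) F" and CF: "\<forall>x. C (F x) = C x"
    have no: "\<not> h dvd a" if "0 < \<bar>a\<bar>" "\<bar>a\<bar> < 5" for a using dvd_small[of a h] that h by auto
    \<comment> \<open>Describing twins by their neighbourhoods makes the relation invariant under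
      automorphisms. Points with a common neighbourhood could otherwise only differ if
      \<open>h\<close> divided 4.\<close>
    have twins: "h dvd x - y \<longleftrightarrow> (\<forall>z. cadj ?n (h - 1) z x \<longleftrightarrow> cadj ?n (h - 1) z y)" for x y
    proof
      assume d: "h dvd x - y"
      have "h dvd z - x + a \<longleftrightarrow> h dvd z - y + a" for z a
      proof -
        have "z - y + a = (x - y) + (z - x + a)" by simp
        then show ?thesis using dvd_add_right_iff[OF d] by metis
      qed
      from this[of _ 1] this[of _ "-1"] show "\<forall>z. cadj ?n (h - 1) z x \<longleftrightarrow> cadj ?n (h - 1) z y"
        by (simp add: cadj_twin)
    next
      assume a: "\<forall>z. cadj ?n (h - 1) z x \<longleftrightarrow> cadj ?n (h - 1) z y"
      have "cadj ?n (h - 1) (x + 1) x" "cadj ?n (h - 1) (x - 1) x" unfolding cadj_twin by simp_all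
      then have "cadj ?n (h - 1) (x + 1) y" "cadj ?n (h - 1) (x - 1) y" using a by blast+
      moreover have "x + 1 - y - 1 = x - y" "x + 1 - y + 1 = x - y + 2" "x - 1 - y - 1 = x - y - 2"
        "x - 1 - y + 1 = x - y" by simp_all
      ultimately have "h dvd x - y \<or> h dvd x - y + 2 \<and> h dvd x - y - 2"
        unfolding cadj_twin by metis
      moreover have False if "h dvd x - y + 2" "h dvd x - y - 2"
        using dvd_diff[OF that] no[of 4] by simp
      ultimately show "h dvd x - y" by blast
    qed
    have Ftwin: "h dvd F x - F y \<longleftrightarrow> h dvd x - y" for x y
    proof -
      have "cadj ?n (h - 1) z (F x) \<longleftrightarrow> cadj ?n (h - 1) w x" if "?n dvd F w - z" for z w x
        using caut_cadj[OF F, of w x] cadj_cong[OF that, of "F x" "F x"] by simp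
      then show ?thesis unfolding twins using caut_surj[OF F] caut_cadj[OF F] by metis
    qed
    have nh: "\<not> ?n dvd h" using h zdvd_imp_le[of ?n h] by auto
    have qF: "q (F x) = q x" for x
    proof -
      have "h dvd F (x + h) - F x" by (simp add: Ftwin)
      moreover have "\<not> ?n dvd F (x + h) - F x" using caut_inj[OF F, of "x + h" x] nh by simp
      ultimately have "?n dvd F (x + h) - (F x + h)" using half[of "F (x + h)" "F x"] by (simp add: diff_diff_eq)
      then have "C (F x + h) = C (x + h)" using c CF by metis
      then have "Q (q (F x)) = Q (q x)" using pair(1) CF by metis
      then show ?thesis using Qdist q by blast
    qed
    have q34: "h dvd y - e" if "q y = q e" "e = 3 \<or> e = 4" for y e
    proof -
      have "e mod h = e" using that h by auto
      moreover have "idx e = e" using that L by (auto simp: idx_def)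
      ultimately have "idx (y mod h) = e" using that(1) by (simp add: q_def)
      then have "y mod h = e" using that(2) pos_mod_bound[of 2 "y mod h - L"] by (auto simp: idx_def split: if_splits)
      then show ?thesis using mod_dvd_diff(2)[of h y] by simp
    qed
    \<comment> \<open>On the quotient cycle two consecutive fixed points determine the next one: it
      stays adjacent to \<open>x + 1\<close>, and by injectivity on classes it cannot land on
      \<open>x\<close>.\<close>
    have up: "h dvd F x - x \<and> h dvd F (x + 1) - (x + 1)" if "3 \<le> x" for x
      using that
    proof (induction x rule: int_ge_induct)
      case base
      show ?case using q34[of "F 3" 3] q34[of "F 4" 4] qF by simp
    next
      case (step x)
      have "cadj ?n (h - 1) (F (x + 2)) (F (x + 1))"
        unfolding caut_cadj[OF F] by (simp add: cadj_def)
      then have "h dvd F (x + 2) - F (x + 1) - 1 \<or> h dvd F (x + 2) - F (x + 1) + 1"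
        by (simp add: cadj_twin)
      moreover have "h dvd F (x + 1) - (x + 1)" "h dvd F x - x" using step.IH by auto
      moreover have False if "h dvd F (x + 2) - F (x + 1) + 1"
      proof -
        have "h dvd F (x + 2) - F x"
          using dvd_diff[OF dvd_add[OF that conjunct2[OF step.IH]] conjunct1[OF step.IH]]
          by (simp add: algebra_simps)
        then have "h dvd 2" by (simp add: Ftwin)
        then show False using no[of 2] by simp
      qed
      ultimately have "h dvd (F (x + 2) - F (x + 1) - 1) + (F (x + 1) - (x + 1))" by (metis dvd_add)
      then show ?case using step.IH by (simp add: algebra_simps)
    qed
    have all: "h dvd F x - x" for x
    proof -
      \<comment> \<open>A representative of the class of \<open>x\<close> modulo \<open>h\<close>
        that is at least 3, so that \<open>up\<close> reaches it.\<close>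
      define y where "y = x + h * (\<bar>x\<bar> + 3)"
      have "\<bar>x\<bar> + 3 \<le> h * (\<bar>x\<bar> + 3)" using h mult_right_mono[of 1 h "\<bar>x\<bar> + 3"] by simp
      then have "3 \<le> y" by (simp add: y_def)
      have yx: "h dvd y - x" by (simp add: y_def)
      then have "h dvd F y - F x" by (simp add: Ftwin)
      moreover have "h dvd F y - y" using up[OF \<open>3 \<le> y\<close>] by blast
      ultimately show ?thesis using yx dvd_diff_trans dvd_diff_sym by blast
    qed
    from half[OF all[of x]] show "?n dvd F x - x"
    proof
      assume "?n dvd F x - x - h"
      then have "C (F x) = C (x + h)" by (intro c) (simp add: diff_diff_eq)
      then show ?thesis using CF pair(2)[of x] by simp
    qed
  qed
  moreover have "C x < 5" for x
    using rng q[of x] by (simp add: C_def q_def)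
  ultimately show ?thesis using that by blast
qed

section \<open>The distinguishing chromatic number\<close>

lemma dcn_eqI:
  fixes n k m :: nat
  assumes "2 \<le> n" "\<not> n dvd k" and C: "ccolouring (int n) (int k) C" "cdist (int n) (int k) C" "\<And>x. C x < Suc m"
    and no: "\<And>C. ccolouring (int n) (int k) C \<Longrightarrow> cdist (int n) (int k) C \<Longrightarrow> (\<And>x. C x < m) \<Longrightarrow> False"
  shows "distinguishing_chromatic_number (circulant n k) = Suc m"
proof -
  have "m < distinguishing_chromatic_number (circulant n k)"
    by (rule dcn_gt[OF assms(1,2)]) (rule no)
  with dcn_le[OF assms(1,2) C] show ?thesis by simp
qed

lemma dcn_generic:
  assumes g: "generic (int n) (int k)" and ne: "(n, k) \<noteq> (15, 4)" "(n, k) \<noteq> (13, 5)"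
  shows "distinguishing_chromatic_number (circulant n k) = 3"
proof -
  have n: "8 \<le> n" using g by (auto simp: generic_def)
  have nk: "\<not> n dvd k" using generic_not_dvd(3)[OF g] by simp
  obtain C where C: "ccolouring (int n) (int k) C" "cdist (int n) (int k) C" "\<And>x. C x < 3"
  proof (cases "even n \<and> odd k")
    case True
    then show ?thesis using three_colouring_bipartite[OF g] that by auto
  next
    case False
    show ?thesis
    proof (cases "n = 3 * k")
      case True
      then show ?thesis using three_colouring_third[OF g] that by auto
    next
      case n3: False
      have "odd (int n) \<or> even (int k)" "int n \<noteq> 3 * int k"
        "(int n, int k) \<noteq> (15, 4)" "(int n, int k) \<noteq> (13, 5)"
        using False n3 ne by auto
      then show ?thesis using three_colouring_arcs[OF g] that by metis
    qed
  qed
  have "distinguishing_chromatic_number (circulant n k) = Suc 2"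
  proof (rule dcn_eqI[OF _ nk])
    show False if "ccolouring (int n) (int k) C" "cdist (int n) (int k) C" "\<And>x. C x < 2" for C
      using no_two_colouring[OF that] n by simp
  qed (use n C in simp_all)
  then show ?thesis by simp
qed

theorem theorem1p2:
  fixes n k :: nat
  assumes "2 \<le> k" and "k \<le> n div 2"
  shows "distinguishing_chromatic_number (circulant n k) =
    (if (n, k) \<in> {(4,2), (5,2), (6,2), (6,3), (8,3)} then n
     else if (n, k) = (10,3) then 5
     else if (n, k) \<in> {(15,4), (13,5)} then 4
     else if real k = real n / 2 \<and> n \<ge> 8 then 3
     else if real k = real n / 2 - 1 \<and> n \<ge> 10 then 5
     else if (k = 2 \<or> real k = (real n - 1) / 2) \<and> n \<ge> 7 then 4
     else 3)"
proof -
  let ?d = "distinguishing_chromatic_number (circulant n k)"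
  have n: "2 \<le> n" "2 * k \<le> n" using assms by auto
  have nk: "\<not> n dvd k" using assms by (auto dest: dvd_imp_le)
  have half: "real k = real n / 2 \<longleftrightarrow> n = 2 * k" "real k = real n / 2 - 1 \<longleftrightarrow> n = 2 * k + 2"
    "real k = (real n - 1) / 2 \<longleftrightarrow> n = 2 * k + 1" by (auto simp: field_simps)
  consider "(n, k) \<in> {(4,2), (5,2), (6,2), (6,3), (8,3)}" | "n = 10" "k = 3" | "n = 15" "k = 4" | "n = 13" "k = 5"
    | "n = 2 * k + 2" "10 \<le> n" | "k = 2" "7 \<le> n" | "n = 2 * k + 1" "7 \<le> n" "k \<noteq> 2"
    | "(n, k) \<noteq> (15, 4)" "(n, k) \<noteq> (13, 5)" "(n, k) \<noteq> (10, 3)" "8 \<le> n" "n = 2 * k \<or> 2 * k + 3 \<le> n" "3 \<le> k"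
  proof -
    consider (a) "k = 2" | (b) "3 \<le> k" "n = 2 * k" | (c) "3 \<le> k" "n = 2 * k + 1"
      | (d) "3 \<le> k" "n = 2 * k + 2" | (e) "3 \<le> k" "2 * k + 3 \<le> n" using assms(1) n by linarith
    then show ?thesis
    proof cases
      case a
      then have "n = 4 \<or> n = 5 \<or> n = 6 \<or> 7 \<le> n" using n by linarith
      then show ?thesis using a that(1,6) by auto
    next
      case b
      then have "n = 6 \<and> k = 3 \<or> 8 \<le> n" by presburger
      then show ?thesis using b that(1,8) by auto
    next
      case c
      then show ?thesis using that(7) by linarith
    next
      case d
      then have "n = 8 \<and> k = 3 \<or> 10 \<le> n" by presburger
      then show ?thesis using d that(1,5) by auto
    next
      case e
      then show ?thesis using that(2,3,4,8) by auto
    qed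
  qed
  then show ?thesis
  proof cases
    case 1
    then show ?thesis using dcn_small by auto
  next
    case 2
    obtain C where C: "ccolouring 10 3 C" "cdist 10 3 C" "\<And>x. C x < 5" using five_colouring_10 by blast
    have "?d = Suc 4"
      unfolding 2
    proof (rule dcn_eqI)
      show False if "ccolouring (int 10) (int 3) C" "cdist (int 10) (int 3) C" "\<And>x. C x < 4" for C
        using no_four_colouring_10[of C] that by simp
    qed (use C in simp_all)
    then show ?thesis using 2 by simp
  next
    case 3
    obtain C where C: "ccolouring 15 4 C" "cdist 15 4 C" "\<And>x. C x < 4" using four_colouring_15 by blast
    have "?d = Suc 3"
      unfolding 3
    proof (rule dcn_eqI)
      show False if "ccolouring (int 15) (int 4) C" "cdist (int 15) (int 4) C" "\<And>x. C x < 3" for C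
        using no_three_colouring_15[of C] that by simp
    qed (use C in simp_all)
    then show ?thesis using 3 by simp
  next
    case 4
    obtain C where C: "ccolouring 13 5 C" "cdist 13 5 C" "\<And>x. C x < 4" using four_colouring_13 by blast
    have "?d = Suc 3"
      unfolding 4
    proof (rule dcn_eqI)
      show False if "ccolouring (int 13) (int 5) C" "cdist (int 13) (int 5) C" "\<And>x. C x < 3" for C
        using no_three_colouring_13[of C] that by simp
    qed (use C in simp_all)
    then show ?thesis using 4 by simp
  next
    case 5
    define h where "h = int k + 1"
    have h: "int n = 2 * h" "int k = h - 1" "5 \<le> h" using 5 by (auto simp: h_def)
    obtain C where C: "ccolouring (2 * h) (h - 1) C" "cdist (2 * h) (h - 1) C" "\<And>x. C x < 5"
      using five_colouring_twin[OF h(3)] by blast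
    have "?d = Suc 4"
    proof (rule dcn_eqI[OF n(1) nk])
      show False if "ccolouring (int n) (int k) C" "cdist (int n) (int k) C" "\<And>x. C x < 4" for C
        using no_four_colouring_twin[of h C] that h by simp
    qed (use C h in simp_all)
    moreover have "n \<noteq> 13" "n \<noteq> 15" using 5 by presburger+
    ultimately show ?thesis using 5 half by auto
  next
    case 6
    obtain C where C: "ccolouring (int n) 2 C" "cdist (int n) 2 C" "\<And>x. C x < 4"
      using four_colouring_2[of "int n"] 6 by auto
    have "?d = Suc 3"
    proof (rule dcn_eqI[OF n(1) nk])
      show False if "ccolouring (int n) (int k) C" "cdist (int n) (int k) C" "\<And>x. C x < 3" for C
        using no_three_colouring_2[of "int n" C] that 6 by simp
    qed (use C 6 in simp_all)
    then show ?thesis using 6 half by auto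
  next
    case 7
    have h: "7 \<le> int n" "int n = 2 * int k + 1" using 7 by auto
    obtain C where C: "ccolouring (int n) (int k) C" "cdist (int n) (int k) C" "\<And>x. C x < 4"
      using four_colouring_half[OF h] by blast
    have "?d = Suc 3"
    proof (rule dcn_eqI[OF n(1) nk])
      show False if "ccolouring (int n) (int k) C" "cdist (int n) (int k) C" "\<And>x. C x < 3" for C
        using no_three_colouring_half[of "int n" "int k" C] that h by blast
    qed (use C in simp_all)
    moreover have "n \<noteq> 8" using 7 by presburger
    ultimately show ?thesis using 7 half by auto
  next
    case 8
    have "generic (int n) (int k)" using 8 by (auto simp: generic_def)
    then have d: "?d = 3" using dcn_generic 8 by blast
    have "n \<noteq> 2 * k + 2" "n \<noteq> 2 * k + 1" "k \<noteq> 2" using 8(5,6) by linarith+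
    moreover have "(n, k) \<notin> {(4,2), (5,2), (6,2), (6,3), (8,3)}" using 8(4,5) by auto
    moreover have "(n, k) \<notin> {(15,4), (13,5)}" using 8(1,2) by blast
    ultimately show ?thesis using d 8(3) unfolding half by simp
  qed
qed

end
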